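(* Let $d\ge2$, let $\Omega\subset\mathbf{R}^d$ be a bounded open $C^{1,1}$ set, and let $\phi,L,V,V^*$ be as in the context. Let $f:\mathbf{R}\to[0,\infty)$ be a nondecreasing $C^1$ function with $f(0)=0$ such that the following hold, with $F,\varphi$ as in the context. (1) There are constants $0<m\le M$ such that $(1+m)f(t)\le t f'(t)\le (1+M)f(t)$ for all $t\in\mathbf{R}$. (2) For some $R>0$ there is a constant $C_1>0$ such that for every $r\ge R$ $$\int_r^\infty \frac{dt}{\sqrt{\phi^{-1}(\varphi(t)^{-2})}}\le C_1\,\frac{r}{\sqrt{\phi^{-1}(\varphi(r)^{-2})}}.$$ (3) $\displaystyle\lim_{s\to\infty}V^{-1}\Big(\sqrt{\tfrac{s}{f(s)}}\Big)\sqrt{s f(s)}=\infty.$ Then there exists a supersolution $\overline u:\mathbf{R}^d\to\mathbf{R}$ to the problem $$-Lu=-f(u)\ \text{in }\Omega,\qquad u=0\ \text{in }\mathbf{R}^d\setminus\Omega,\qquad \lim_{\Omega\ni x\to\partial\Omega}V^*(\delta_\Omega(x))u(x)=\infty,$$ such that $\overline u\in C^{1,1}(\Omega)$ (locally in $\Omega$). Here supersolution means that $-L\overline u(x)\ge -f(\overline u(x))$ pointwise for $x\in\Omega$, $\overline u=0$ on $\mathbf{R}^d\setminus\Omega$, and $\lim_{\Omega\ni x\to\partial\Omega}V^*(\delta_\Omega(x))\overline u(x)=\infty$.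
   Context: **Operator.** $\phi:[0,\infty)\to[0,\infty)$ is a complete Bernstein function with zero drift, i.e. $\phi(\lambda)=\int_0^\infty(1-e^{-\lambda s})\nu(s)\,ds$ with $\nu$ a completely monotone Lévy density, satisfying the scaling condition: there are $a_1,a_2>0$ and $0<\delta_1\le\delta_2<1$ with $a_1\lambda^{\delta_1}\le \phi(\lambda t)/\phi(t)\le a_2\lambda^{\delta_2}$ for all $\lambda\ge1$, $t\ge1$. $\phi^{-1}$ is the inverse function of $\phi$. $L=-\phi(-\Delta)$ acts pointwise as $Lu(x)=\mathrm{P.V.}\int_{\mathbf{R}^d}(u(y)-u(x))\,j(|y-x|)\,dy$, where $j(r)=\int_0^\infty(4\pi s)^{-d/2}e^{-r^2/(4s)}\nu(s)\,ds$. **Renewal functions.** $V(t)=\int_0^\infty\mathbf{P}(H_s\le t)\,ds$, where $H$ is the ascending ladder height process of the one-dimensional subordinate Brownian motion with characteristic exponent $\phi(\theta^2)$, $\theta\in\mathbf{R}$. Equivalently, $\int_{[0,\infty)}e^{-\xi t}\,dV(t)=1/\kappa(\xi)$, $\kappa(\xi)=\exp\big(\frac1\pi\int_0^\infty\frac{\log\phi(\xi^2\theta^2)}{1+\theta^2}d\theta\big)$, $\xi>0$. $V$ is continuous and strictly increasing on $[0,\infty)$ with $V(0)=0$, $V(\infty)=\infty$, and $V^{-1}$ is its inverse. $V^*$ is the renewal function defined in the same way with $\phi$ replaced by the conjugate Bernstein function $\phi^*(s)=s/\phi(s)$. **Nonlinearity.** $F(t)=\int_0^tf(s)\,ds$,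 with $F(t)>0$ for $t>0$; $\varphi(t)=\int_t^\infty\frac{ds}{\sqrt{F(s)}}$, $t>0$. **Geometry.** $\delta_\Omega(x)=\mathrm{dist}(x,\partial\Omega)$. *)

theory Defs
  imports "HOL-Analysis.Analysis"
begin

definition completely_monotone :: "(real \<Rightarrow> real) \<Rightarrow> bool" where
  "completely_monotone \<nu> \<longleftrightarrow>
     (\<forall>n. \<forall>s>0. (deriv ^^ n) \<nu> differentiable (at s) \<and> 0 \<le> (- 1) ^ n * (deriv ^^ n) \<nu> s)"

text \<open>Only the values of \<open>\<phi>\<close> on \<open>[0,\<infinity>)\<close> and of \<open>\<nu>\<close> on \<open>(0,\<infinity>)\<close> matter.\<close>

definition complete_bernstein :: "(real \<Rightarrow> real) \<Rightarrow> (real \<Rightarrow> real) \<Rightarrow> bool" where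
  "complete_bernstein \<phi> \<nu> \<longleftrightarrow>
     completely_monotone \<nu> \<and>
     set_integrable lborel {0<..} (\<lambda>s. min 1 s * \<nu> s) \<and>
     (\<forall>x\<ge>0. \<phi> x = (LBINT s:{0<..}. (1 - exp (- x * s)) * \<nu> s))"

definition scaling_condition :: "(real \<Rightarrow> real) \<Rightarrow> bool" where
  "scaling_condition \<phi> \<longleftrightarrow>
     (\<exists>a\<^sub>1 a\<^sub>2 \<delta>\<^sub>1 \<delta>\<^sub>2. a\<^sub>1 > 0 \<and> a\<^sub>2 > 0 \<and> 0 < \<delta>\<^sub>1 \<and> \<delta>\<^sub>1 \<le> \<delta>\<^sub>2 \<and> \<delta>\<^sub>2 < 1 \<and>
        (\<forall>x\<ge>1. \<forall>t\<ge>1. a\<^sub>1 * x powr \<delta>\<^sub>1 \<le> \<phi> (x * t) / \<phi> t \<and>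
                          \<phi> (x * t) / \<phi> t \<le> a\<^sub>2 * x powr \<delta>\<^sub>2))"

definition jump_density :: "nat \<Rightarrow> (real \<Rightarrow> real) \<Rightarrow> real \<Rightarrow> real" where
  "jump_density d \<nu> r =
     (LBINT s:{0<..}. (4 * pi * s) powr (- (real d / 2)) * exp (- (r\<^sup>2 / (4 * s))) * \<nu> s)"

text \<open>\<open>has_L \<nu> u x l\<close>: the principal value defining \<open>Lu(x)\<close> exists as a real number and equals
  \<open>l\<close>. A relation is used because Bochner integrals and limits have default values when they
  do not exist.\<close>

definition has_L ::
    "(real \<Rightarrow> real) \<Rightarrow> ('a::euclidean_space \<Rightarrow> real) \<Rightarrow> 'a \<Rightarrow> real \<Rightarrow> bool" where
  "has_L \<nu> u x l \<longleftrightarrow>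
     (\<forall>\<epsilon>>0. set_integrable lborel {y. \<epsilon> < dist y x}
               (\<lambda>y. (u y - u x) * jump_density DIM('a) \<nu> (dist y x))) \<and>
     ((\<lambda>\<epsilon>. LINT y:{y. \<epsilon> < dist y x}|lborel.
               (u y - u x) * jump_density DIM('a) \<nu> (dist y x)) \<longlongrightarrow> l) (at_right 0)"

definition ladder_exponent :: "(real \<Rightarrow> real) \<Rightarrow> real \<Rightarrow> real" where
  "ladder_exponent \<phi> \<xi> =
     exp (1 / pi * (LBINT \<theta>:{0<..}. ln (\<phi> (\<xi>\<^sup>2 * \<theta>\<^sup>2)) / (1 + \<theta>\<^sup>2)))"

text \<open>The renewal function \<open>t \<mapsto> \<integral> P(H\<^sub>s \<le> t) ds\<close> of the ascending ladder height process \<open>H\<close> of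
  the subordinate Brownian motion with exponent \<open>\<phi>(\<theta>\<^sup>2)\<close>, determined by the Laplace--Stieltjes
  transform of its renewal measure. It is a right-continuous distribution function on the whole
  line, vanishing on the negative half-line, so that \<open>interval_measure V\<close> is \<open>dV\<close>, including a
  possible atom at \<open>0\<close>.\<close>

definition renewal_function :: "(real \<Rightarrow> real) \<Rightarrow> (real \<Rightarrow> real) \<Rightarrow> bool" where
  "renewal_function \<phi> V \<longleftrightarrow>
     mono V \<and> (\<forall>t. continuous (at_right t) V) \<and> (\<forall>t<0. V t = 0) \<and>
     (\<forall>\<xi>>0. (\<integral>\<^sup>+t\<in>{0..}. ennreal (exp (- \<xi> * t)) \<partial>interval_measure V)
              = ennreal (1 / ladder_exponent \<phi> \<xi>))"

definition conjugate_bernstein :: "(real \<Rightarrow> real) \<Rightarrow> real \<Rightarrow> real" where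
  "conjugate_bernstein \<phi> s = s / \<phi> s"

text \<open>\<open>F\<close> and \<open>\<varphi>\<close>; both are used for positive arguments only.\<close>

definition F_prim :: "(real \<Rightarrow> real) \<Rightarrow> real \<Rightarrow> real" where
  "F_prim f t = (LBINT s:{0..t}. f s)"

definition varphi :: "(real \<Rightarrow> real) \<Rightarrow> real \<Rightarrow> real" where
  "varphi f t = (LBINT s:{t<..}. 1 / sqrt (F_prim f s))"

text \<open>\<open>\<Omega>\<close> is an open set with \<open>C\<^sup>1\<^sup>,\<^sup>1\<close> boundary, with uniform characteristics \<open>(R, \<Lambda>)\<close>:
  near each boundary point \<open>z\<close>, in orthonormal coordinates centred at \<open>z\<close> with last axis \<open>e\<close>,
  it is the set above the graph of \<open>\<Gamma>\<close>. The hyperplane orthogonal to \<open>e\<close> plays the role of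
  \<open>d - 1\<close> dimensional space; \<open>\<Gamma>\<close> is defined on the full space but evaluated only on that
  hyperplane (a function on the hyperplane is extended constantly along \<open>e\<close>).\<close>

definition C11_open_set :: "'a::euclidean_space set \<Rightarrow> bool" where
  "C11_open_set \<Omega> \<longleftrightarrow> open \<Omega> \<and>
     (\<exists>R>0. \<exists>\<Lambda>>0. \<forall>z\<in>frontier \<Omega>. \<exists>e \<Gamma> G. norm e = 1 \<and>
        (\<forall>w. GDERIV \<Gamma> w :> G w) \<and> \<Lambda>-lipschitz_on UNIV G \<and> (\<forall>w. norm (G w) \<le> \<Lambda>) \<and>
        \<Gamma> 0 = 0 \<and> G 0 = 0 \<and>
        \<Omega> \<inter> ball z R =
          {y \<in> ball z R. \<Gamma> ((y - z) - ((y - z) \<bullet> e) *\<^sub>R e) < (y - z) \<bullet> e})"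

definition locally_C11_on :: "'a::euclidean_space set \<Rightarrow> ('a \<Rightarrow> real) \<Rightarrow> bool" where
  "locally_C11_on \<Omega> u \<longleftrightarrow>
     (\<exists>G. (\<forall>x\<in>\<Omega>. GDERIV u x :> G x) \<and>
          (\<forall>K. compact K \<and> K \<subseteq> \<Omega> \<longrightarrow> (\<exists>C. C-lipschitz_on K G)))"

abbreviation bdist :: "'a::euclidean_space set \<Rightarrow> 'a \<Rightarrow> real" where
  "bdist \<Omega> x \<equiv> infdist x (frontier \<Omega>)"

definition supersolution ::
    "(real \<Rightarrow> real) \<Rightarrow> (real \<Rightarrow> real) \<Rightarrow> (real \<Rightarrow> real) \<Rightarrow> 'a::euclidean_space set \<Rightarrow> ('a \<Rightarrow> real) \<Rightarrow> bool"
  where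
  "supersolution \<nu> f Vs \<Omega> u \<longleftrightarrow>
     (\<forall>x\<in>\<Omega>. \<exists>l. has_L \<nu> u x l \<and> - l \<ge> - f (u x)) \<and>
     (\<forall>x. x \<notin> \<Omega> \<longrightarrow> u x = 0) \<and>
     filterlim (\<lambda>x. Vs (bdist \<Omega> x) * u x) at_top
       (inf (filtercomap (bdist \<Omega>) (at_right 0)) (principal \<Omega>))"

end

theory Submission
  imports Defs "HOL-Probability.Probability"
begin

text \<open>Write \<open>\<delta>\<close> for the distance to the boundary and let \<open>U(t)\<close> solve \<open>f(U(t)) / U(t) = \<phi>(t\<^sup>-\<^sup>2)\<close>.
  The supersolution is a large multiple of a regularization \<open>u\<close> of \<open>U(\<delta>(x))\<close>: an average of bumps
  centred at \<open>p \<in> \<Omega>\<close> with radius \<open>\<delta>(p) / 4\<close>. It is comparable to \<open>U(\<delta>)\<close>, and its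
  second-order Taylor remainders are of size \<open>U(\<delta>) \<delta>\<^sup>-\<^sup>2 |y - x|\<^sup>2\<close>, whatever the regularity
  of \<open>\<delta>\<close>; the boundary enters only through the volume of its neighbourhoods.

  At scale \<open>r = \<delta>(x)\<close>, up to a constant factor, the jumps shorter than \<open>r\<close> contribute at most
  \<open>C U(r) \<phi>(r\<^sup>-\<^sup>2)\<close> to \<open>L u(x)\<close>. For the longer ones, \<open>U(\<delta>)\<close> is decomposed into the layers
  \<open>\<delta> < 2\<^sup>-\<^sup>k r\<close>, and the Keller--Osserman condition (2) says that the sum over the layers is
  again at most \<open>C U(r) \<phi>(r\<^sup>-\<^sup>2)\<close>. Hence \<open>L u \<le> C U(\<delta>) \<phi>(\<delta>\<^sup>-\<^sup>2) = C f(U(\<delta>)) \<le> C' f(u)\<close>, and the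
  superlinear growth of \<open>f\<close> absorbs \<open>C'\<close> when \<open>u\<close> is multiplied by a large constant.

  The Laplace transforms give \<open>V(t) \<ge> c \<phi>(t\<^sup>-\<^sup>2)\<^sup>-\<^sup>1\<^sup>/\<^sup>2\<close> and \<open>V\<^sup>*(t) \<ge> c t \<phi>(t\<^sup>-\<^sup>2)\<^sup>1\<^sup>/\<^sup>2\<close>, by
  which (3) turns into the blow-up of \<open>V\<^sup>*(\<delta>) u\<close>.\<close>

section \<open>The boundary layer\<close>

text \<open>The form of (2) matches the layers for the following reason. By (1), varphi(t)^(-2) is
  comparable to f(t)/t, so by the scaling of \<phi> the integrand in (2) is comparable to the
  inverse function of U. Integrating that inverse over [U(r), \<infinity>) gives, up to constants,
  the sum over k of r 2^(-k) (U(2^(-k-1) r) - U(2^(-k) r)). The same numbers arise from the long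
  jumps: the layer \<delta> < 2^(-k) r has mass at most a constant times 2^(-k) \<phi>(r^(-2)) under
  the jumps longer than r, and inside it U(\<delta>) is charged with the difference of consecutive
  profile values. All comparisons lose constants, and these have to pass through \<phi> and its
  inverse in both directions. A constant in the argument of \<phi> is taken out by concavity,
  \<phi>(c x) \<le> c \<phi>(x) for c \<ge> 1; a constant outside is absorbed into the argument by
  the lower half of the scaling condition. The latter is available only for arguments at least 1,
  hence only near the boundary.\<close>

lemma measure_lborel_translate:
  fixes a :: "'a::euclidean_space"
  assumes "A \<in> sets borel"
  shows "measure lborel ((\<lambda>y. a + y) -` A) = measure lborel A"
proof -
  have "measure lborel A = measure (distr lborel borel ((+) a)) A"
    by (simp add: lborel_distr_plus)
  also have "\<dots> = measure lborel ((+) a -` A)"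
    using assms by (subst measure_distr) auto
  finally show ?thesis by simp
qed

text \<open>About \<open>\<rho> / \<tau>\<close> disjoint translates of the strip along \<open>e\<close> fit into a ball of radius \<open>3 \<rho>\<close>,
  which replaces an application of Fubini in the direction \<open>e\<close>.\<close>

lemma measure_strip_le:
  fixes e x :: "'a::euclidean_space" and H :: "'a \<Rightarrow> real"
  assumes e: "norm e = 1" and [measurable]: "H \<in> borel_measurable borel"
    and H: "\<And>y s. H (y + s *\<^sub>R e) = H y + s" and \<tau>: "0 < \<tau>" "\<tau> \<le> \<rho>"
  shows "measure lborel {y \<in> ball x \<rho>. 0 < H y \<and> H y \<le> \<tau>}
    \<le> measure lborel (ball 0 1 :: 'a set) * 3 ^ DIM('a) * \<tau> * \<rho> ^ (DIM('a) - 1)"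
proof -
  \<comment> \<open>\<open>S k\<close> is \<open>S 0\<close> shifted by \<open>k * \<tau>\<close>
    along \<open>e\<close>; as \<open>H\<close> grows at unit speed in that direction, different
    shifts occupy disjoint ranges of \<open>H\<close>.\<close>
  define S where "S k = {y. dist x (y - (real k * \<tau>) *\<^sub>R e) < \<rho> \<and> real k * \<tau> < H y \<and> H y \<le> (real k + 1) * \<tau>}" for k :: nat
  define N where "N = nat \<lceil>\<rho> / \<tau>\<rceil>"
  have N1: "\<rho> / \<tau> \<le> real N" "real N \<le> \<rho> / \<tau> + 1"
    using \<tau> by (auto simp: N_def)
  have N: "\<rho> \<le> real N * \<tau>" "real N * \<tau> \<le> 2 * \<rho>"
    using N1 \<tau> by (auto simp: field_simps)
  have S_meas[measurable]: "S k \<in> sets borel" for k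
    unfolding S_def by measurable
  have sub: "S k \<subseteq> ball x (3 * \<rho>)" if "k < N" for k
  proof
    fix y assume "y \<in> S k"
    then have "dist x (y - (real k * \<tau>) *\<^sub>R e) < \<rho>" by (simp add: S_def)
    moreover have "dist (y - (real k * \<tau>) *\<^sub>R e) y = real k * \<tau>"
      using e \<tau> by (simp add: dist_norm)
    moreover have "real k * \<tau> \<le> real N * \<tau>" using that \<tau> by simp
    ultimately show "y \<in> ball x (3 * \<rho>)"
      using N dist_triangle[of x y "y - (real k * \<tau>) *\<^sub>R e"] by simp
  qed
  have eq: "measure lborel (S k) = measure lborel (S 0)" for k
  proof -
    have "(\<lambda>y. (real k * \<tau>) *\<^sub>R e + y) -` S k = S 0"
      by (auto simp: S_def H add.commute algebra_simps)
    then show ?thesis using measure_lborel_translate[OF S_meas, of "(real k * \<tau>) *\<^sub>R e" k] by simp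
  qed
  have fin: "emeasure lborel (S k) \<noteq> \<infinity>" if "k < N" for k
    using emeasure_mono[OF sub[OF that], of lborel] emeasure_lborel_ball_finite[of x "3 * \<rho>"]
    by (auto simp: top_unique less_top)
  have disj: "disjoint_family_on S {..<N}"
  proof -
    have "S i \<inter> S j = {}" if "i < j" for i j
    proof -
      have "(real i + 1) * \<tau> \<le> real j * \<tau>" using that \<tau> by simp
      then show ?thesis by (auto simp: S_def)
    qed
    then show ?thesis unfolding disjoint_family_on_def
      by (auto simp: neq_iff)
  qed
  have "real N * measure lborel (S 0) = (\<Sum>k<N. measure lborel (S k))"    by (subst sum.cong[OF refl eq]) simp
  also have "\<dots> = measure lborel (\<Union>k<N. S k)"
    using fin disj by (subst measure_finite_Union) auto
  also have "\<dots> \<le> measure lborel (ball x (3 * \<rho>))"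
    using sub emeasure_lborel_ball_finite[of x "3 * \<rho>"]
    by (intro measure_mono_fmeasurable) (auto intro!: fmeasurableI sets.finite_UN)
  also have "\<dots> = (3 * \<rho>) ^ DIM('a) * measure lborel (ball 0 1 :: 'a set)"
    using \<tau> by (intro content_ball_conv_unit_ball) auto
  finally have "real N * measure lborel (S 0) \<le> (3 * \<rho>) ^ DIM('a) * measure lborel (ball 0 1 :: 'a set)" .
  moreover have "\<rho> / \<tau> * measure lborel (S 0) \<le> real N * measure lborel (S 0)"
    using N1 by (intro mult_right_mono) auto
  ultimately have "\<rho> / \<tau> * measure lborel (S 0) \<le> (3 * \<rho>) ^ DIM('a) * measure lborel (ball 0 1 :: 'a set)" by linarith
  also have "(3 * \<rho>) ^ DIM('a) = 3 ^ DIM('a) * (\<rho> * \<rho> ^ (DIM('a) - 1))"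
    by (simp add: power_mult_distrib flip: power_Suc)
  finally have "measure lborel (S 0) \<le> measure lborel (ball 0 1 :: 'a set) * 3 ^ DIM('a) * \<tau> * \<rho> ^ (DIM('a) - 1)"
    using \<tau> by (simp add: field_simps)
  also have "S 0 = {y \<in> ball x \<rho>. 0 < H y \<and> H y \<le> \<tau>}" by (auto simp: S_def)
  finally show ?thesis .
qed

lemma norm_minus_projection_le:
  fixes v e :: "'a::real_inner"
  assumes "norm e = 1"
  shows "norm (v - (v \<bullet> e) *\<^sub>R e) \<le> norm v"
proof -
  have "e \<bullet> e = 1" using assms by (simp add: norm_eq_1)
  then have "(v - (v \<bullet> e) *\<^sub>R e) \<bullet> (v - (v \<bullet> e) *\<^sub>R e) = v \<bullet> v - (v \<bullet> e) * (v \<bullet> e)"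
    by (simp only: inner_diff_left inner_diff_right inner_scaleR_left inner_scaleR_right inner_commute[of e v])
      simp
  then have "norm (v - (v \<bullet> e) *\<^sub>R e) ^ 2 = norm v ^ 2 - (v \<bullet> e) ^ 2"
    unfolding power2_norm_eq_inner by (simp only: power2_eq_square)
  then show ?thesis by (rule power2_le_imp_le[OF eq_refl[THEN order_trans]]) simp_all
qed

lemma gderiv_bounded_imp_lipschitz:
  fixes \<Gamma> :: "'a::euclidean_space \<Rightarrow> real"
  assumes "\<And>w. GDERIV \<Gamma> w :> G w" "\<And>w. norm (G w) \<le> K"
  shows "\<bar>\<Gamma> a - \<Gamma> b\<bar> \<le> K * norm (a - b)"
proof -
  have "norm (\<Gamma> a - \<Gamma> b) \<le> K * norm (a - b)"
  proof (rule differentiable_bound[of UNIV])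
    show "(\<Gamma> has_derivative (\<lambda>h. h \<bullet> G x)) (at x within UNIV)" for x
      using assms(1)[of x] by (simp add: gderiv_def)
    show "onorm (\<lambda>h. h \<bullet> G x) \<le> K" for x
    proof (rule onorm_le)
      fix h
      have "norm (h \<bullet> G x) \<le> norm h * norm (G x)" using Cauchy_Schwarz_ineq2[of h "G x"] by simp
      also have "\<dots> \<le> norm h * K" using assms(2)[of x] by (intro mult_left_mono) auto
      finally show "norm (h \<bullet> G x) \<le> K * norm h" by (simp add: mult.commute)
    qed
  qed auto
  then show ?thesis by simp
qed

text \<open>In a chart the height \<open>H\<close> above the graph is
  \<open>(1 + \<Lambda>)\<close>-Lipschitz and nonpositive at frontier points, so
  \<open>\<delta> y < t\<close> forces \<open>0 < H y \<le> (1 + \<Lambda>) * t\<close> and the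
  strip estimate applies. Finitely many charts cover the compact frontier; for large
  \<open>t\<close> the volume of \<open>\<Omega>\<close> suffices.\<close>

lemma measure_boundary_layer_le:
  fixes \<Omega> :: "'a::euclidean_space set"
  assumes bdd: "bounded \<Omega>" and C11: "C11_open_set \<Omega>"
  obtains C where "C > 0"
    "\<And>x t \<rho>. 0 < t \<Longrightarrow> t \<le> \<rho> \<Longrightarrow>
      measure lborel {y \<in> \<Omega>. bdist \<Omega> y < t \<and> dist x y < \<rho>} \<le> C * t * \<rho> ^ (DIM('a) - 1)"
proof (cases "\<Omega> = {}")
  case True
  then show ?thesis using that[of 1] by auto
next
  case False
  define \<delta> where "\<delta> = bdist \<Omega>"
  define n where "n = DIM('a) - 1"
  from C11 obtain R \<Lambda> where R: "R > 0" "\<Lambda> > 0" and opn: "open \<Omega>" and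
    chart: "\<forall>z\<in>frontier \<Omega>. \<exists>e \<Gamma> G. norm e = 1 \<and>
        (\<forall>w. GDERIV \<Gamma> w :> G w) \<and> \<Lambda>-lipschitz_on UNIV G \<and> (\<forall>w. norm (G w) \<le> \<Lambda>) \<and>
        \<Gamma> 0 = 0 \<and> G 0 = 0 \<and>
        \<Omega> \<inter> ball z R =
          {y \<in> ball z R. \<Gamma> ((y - z) - ((y - z) \<bullet> e) *\<^sub>R e) < (y - z) \<bullet> e}"
    unfolding C11_open_set_def by (elim conjE exE) (rule that)
  have ne: "frontier \<Omega> \<noteq> {}"
    using False bdd by (metis frontier_eq_empty not_bounded_UNIV)
  have cpt: "compact (frontier \<Omega>)" using bdd by (rule compact_frontier_bounded)
  have \<delta>_meas[measurable]: "\<delta> \<in> borel_measurable borel"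
    unfolding \<delta>_def by (intro borel_measurable_continuous_onI continuous_intros)
  have \<Omega>_meas[measurable]: "\<Omega> \<in> sets borel" using opn by simp
  define B where "B = measure lborel (ball 0 1 :: 'a set)"
  define C1 where "C1 = B * 3 ^ DIM('a) * (1 + \<Lambda>) * (1 + \<Lambda>) ^ n"
  have B0: "B > 0" by (simp add: B_def)
  then have C10: "C1 > 0" using R by (simp add: C1_def)
  \<comment> \<open>Restricting to \<open>R / 2\<close>, with \<open>t < R / 2\<close>, keeps the
    frontier point nearest to \<open>y\<close> inside the ball of radius \<open>R\<close> where the
    chart is valid.\<close>
  have loc: "measure lborel {y \<in> \<Omega>. \<delta> y < t \<and> dist x y < \<rho> \<and> dist z y < R / 2} \<le> C1 * t * \<rho> ^ n"
    if z: "z \<in> frontier \<Omega>" and t: "0 < t" "t < R / 2" "t \<le> \<rho>" for x z t \<rho>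
  proof -
    obtain e \<Gamma> G where e: "norm e = 1" and \<Gamma>: "\<And>w. GDERIV \<Gamma> w :> G w" "\<And>w. norm (G w) \<le> \<Lambda>"
      and eq: "\<Omega> \<inter> ball z R = {y \<in> ball z R. \<Gamma> ((y - z) - ((y - z) \<bullet> e) *\<^sub>R e) < (y - z) \<bullet> e}"
      using bspec[OF chart z] by (elim conjE exE) (rule that, auto)
    define H where "H y = (y - z) \<bullet> e - \<Gamma> ((y - z) - ((y - z) \<bullet> e) *\<^sub>R e)" for y
    note lip = gderiv_bounded_imp_lipschitz[OF \<Gamma>]
    have cont: "continuous_on UNIV \<Gamma>"
      using \<Gamma>(1) by (intro continuous_at_imp_continuous_on ballI) (auto simp: gderiv_def intro: has_derivative_continuous)
    have [measurable]: "\<Gamma> \<in> borel_measurable borel" by (rule borel_measurable_continuous_onI[OF cont])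
    have [measurable]: "H \<in> borel_measurable borel" unfolding H_def by measurable
    have ee: "e \<bullet> e = 1" using e by (simp add: norm_eq_1)
    have H_shift: "H (y + s *\<^sub>R e) = H y + s" for y s
    proof -
      have "(y + s *\<^sub>R e - z) - ((y + s *\<^sub>R e - z) \<bullet> e) *\<^sub>R e = (y - z) - ((y - z) \<bullet> e) *\<^sub>R e"
        using ee by (simp add: algebra_simps inner_diff inner_add)
      then show ?thesis unfolding H_def by (simp only:) (simp add: inner_diff inner_add ee)
    qed
    have H_lip: "H y - H w \<le> (1 + \<Lambda>) * norm (y - w)" for y w
    proof -
      have "\<bar>(y - w) \<bullet> e\<bar> \<le> norm (y - w)" using Cauchy_Schwarz_ineq2[of "y - w" e] e by simp
      moreover have "\<bar>\<Gamma> ((y - z) - ((y - z) \<bullet> e) *\<^sub>R e) - \<Gamma> ((w - z) - ((w - z) \<bullet> e) *\<^sub>R e)\<bar>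
        \<le> \<Lambda> * norm ((y - w) - ((y - w) \<bullet> e) *\<^sub>R e)"
        using lip[of "(y - z) - ((y - z) \<bullet> e) *\<^sub>R e" "(w - z) - ((w - z) \<bullet> e) *\<^sub>R e"]
        by (simp add: algebra_simps inner_diff)
      moreover have "\<Lambda> * norm ((y - w) - ((y - w) \<bullet> e) *\<^sub>R e) \<le> \<Lambda> * norm (y - w)"
        using R e by (intro mult_left_mono norm_minus_projection_le) auto
      ultimately show ?thesis unfolding H_def by (simp add: algebra_simps inner_diff)
    qed
    have sub: "{y \<in> \<Omega>. \<delta> y < t \<and> dist x y < \<rho> \<and> dist z y < R / 2}
      \<subseteq> {y \<in> ball x ((1 + \<Lambda>) * \<rho>). 0 < H y \<and> H y \<le> (1 + \<Lambda>) * t}"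
    proof safe
      fix y assume y: "y \<in> \<Omega>" "\<delta> y < t" "dist x y < \<rho>" "dist z y < R / 2"
      show "y \<in> ball x ((1 + \<Lambda>) * \<rho>)"
      proof -
        have "1 * \<rho> \<le> (1 + \<Lambda>) * \<rho>" using R t by (intro mult_right_mono) auto
        then show ?thesis using y(3) by simp
      qed
      have "y \<in> \<Omega> \<inter> ball z R" using y R by auto
      then show "0 < H y" using eq by (auto simp: H_def)
      obtain w where w: "w \<in> frontier \<Omega>" "\<delta> y = dist y w"
        using infdist_attains_inf[of "frontier \<Omega>" y] ne by (auto simp: \<delta>_def)
      have "dist z w < R"
        using w y t dist_triangle[of z w y] by simp
      moreover have "w \<notin> \<Omega>" using w(1) opn by (auto simp: frontier_def interior_open)
      ultimately have "\<not> 0 < H w" using eq by (auto simp: H_def)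
      then have "H y \<le> (1 + \<Lambda>) * norm (y - w)" using H_lip[of y w] by linarith
      also have "\<dots> \<le> (1 + \<Lambda>) * t" using w y R by (intro mult_left_mono) (auto simp: dist_norm)
      finally show "H y \<le> (1 + \<Lambda>) * t" .
    qed
    have "measure lborel {y \<in> \<Omega>. \<delta> y < t \<and> dist x y < \<rho> \<and> dist z y < R / 2}
      \<le> measure lborel {y \<in> ball x ((1 + \<Lambda>) * \<rho>). 0 < H y \<and> H y \<le> (1 + \<Lambda>) * t}"
    proof (rule measure_mono_fmeasurable[OF sub])
      have "ball x ((1 + \<Lambda>) * \<rho>) \<in> fmeasurable lborel"
        using emeasure_lborel_ball_finite by (intro fmeasurableI) auto
      then show "{y \<in> ball x ((1 + \<Lambda>) * \<rho>). 0 < H y \<and> H y \<le> (1 + \<Lambda>) * t} \<in> fmeasurable lborel"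
        by (rule fmeasurableI2) auto
    qed measurable
    also have "\<dots> \<le> B * 3 ^ DIM('a) * ((1 + \<Lambda>) * t) * ((1 + \<Lambda>) * \<rho>) ^ n"
      unfolding B_def n_def using e H_shift t R by (intro measure_strip_le[of e]) auto
    also have "\<dots> = C1 * t * \<rho> ^ n" by (simp add: C1_def power_mult_distrib)
    finally show ?thesis .
  qed
  obtain Z where Z: "Z \<subseteq> frontier \<Omega>" "finite Z" "frontier \<Omega> \<subseteq> (\<Union>z\<in>Z. ball z (R / 4))"
  proof (rule compactE_image[OF cpt, of "frontier \<Omega>" "\<lambda>z. ball z (R / 4)"])
    show "frontier \<Omega> \<subseteq> (\<Union>z\<in>frontier \<Omega>. ball z (R / 4))" using R by auto
  qed auto
  \<comment> \<open>\<open>C2\<close> serves the case \<open>t \<ge> R / 4\<close>, where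
    \<open>4 / R * t\<close> and \<open>4 / R * \<rho>\<close> are at least 1. The summand 1 in the
    final constant gives strict positivity without inspecting \<open>card Z\<close>.\<close>
  define C2 where "C2 = measure lborel \<Omega> * (4 / R) * (4 / R) ^ n"
  have C20: "C2 \<ge> 0" using R by (simp add: C2_def)
  have fm\<Omega>: "\<Omega> \<in> fmeasurable lborel"
    using bdd by (intro fmeasurableI emeasure_bounded_finite) auto
  have fm: "{y \<in> \<Omega>. P y} \<in> fmeasurable lborel" if [measurable]: "Measurable.pred borel P" for P
    by (rule fmeasurableI2[OF fm\<Omega>]) auto
  have main: "measure lborel {y \<in> \<Omega>. \<delta> y < t \<and> dist x y < \<rho>} \<le> (real (card Z) * C1 + C2 + 1) * t * \<rho> ^ n"
    if t: "0 < t" "t \<le> \<rho>" for x t \<rho>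
  proof -
    have pos: "0 \<le> t * \<rho> ^ n" using t by simp
    show ?thesis
    proof (cases "t < R / 4")
      case True
      have sub: "{y \<in> \<Omega>. \<delta> y < t \<and> dist x y < \<rho>}
        \<subseteq> (\<Union>z\<in>Z. {y \<in> \<Omega>. \<delta> y < t \<and> dist x y < \<rho> \<and> dist z y < R / 2})"
      proof
        fix y assume y: "y \<in> {y \<in> \<Omega>. \<delta> y < t \<and> dist x y < \<rho>}"
        obtain w where w: "w \<in> frontier \<Omega>" "\<delta> y = dist y w"
          using infdist_attains_inf[of "frontier \<Omega>" y] ne by (auto simp: \<delta>_def)
        obtain z where z: "z \<in> Z" "dist z w < R / 4" using w Z by auto
        have "dist z y < R / 2" using dist_triangle[of z y w] w z y True by (simp add: dist_commute)
        with y z show "y \<in> (\<Union>z\<in>Z. {y \<in> \<Omega>. \<delta> y < t \<and> dist x y < \<rho> \<and> dist z y < R / 2})" by auto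
      qed
      have "measure lborel {y \<in> \<Omega>. \<delta> y < t \<and> dist x y < \<rho>}
        \<le> measure lborel (\<Union>z\<in>Z. {y \<in> \<Omega>. \<delta> y < t \<and> dist x y < \<rho> \<and> dist z y < R / 2})"
        using Z by (intro measure_mono_fmeasurable[OF sub] fmeasurable.finite_UN fm) measurable
      also have "\<dots> \<le> (\<Sum>z\<in>Z. measure lborel {y \<in> \<Omega>. \<delta> y < t \<and> dist x y < \<rho> \<and> dist z y < R / 2})"
        using Z by (intro measure_UNION_le) auto
      also have "\<dots> \<le> (\<Sum>z\<in>Z. C1 * t * \<rho> ^ n)"
        using Z t True by (intro sum_mono loc) auto
      also have "\<dots> = (real (card Z) * C1) * (t * \<rho> ^ n)" by simp
      also have "\<dots> \<le> (real (card Z) * C1 + C2 + 1) * (t * \<rho> ^ n)"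
        using pos C20 by (intro mult_right_mono) auto
      finally show ?thesis by (simp add: mult.assoc)
    next
      case False
      have "measure lborel {y \<in> \<Omega>. \<delta> y < t \<and> dist x y < \<rho>} \<le> measure lborel \<Omega>"
        by (intro measure_mono_fmeasurable fm\<Omega>) auto
      also have "\<dots> = measure lborel \<Omega> * 1 * 1" by simp
      also have "\<dots> \<le> measure lborel \<Omega> * (4 / R * t) * (4 / R * \<rho>) ^ n"
      proof -
        have "1 \<le> 4 / R * t" "1 \<le> 4 / R * \<rho>" using False R t by (simp_all add: field_simps)
        moreover have "0 \<le> 4 / R * t" using R t by simp
        ultimately show ?thesis using R t by (intro mult_mono one_le_power mult_nonneg_nonneg) auto
      qed
      also have "\<dots> = C2 * (t * \<rho> ^ n)" by (simp add: C2_def power_mult_distrib power_divide)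
      also have "\<dots> \<le> (real (card Z) * C1 + C2 + 1) * (t * \<rho> ^ n)"
        using pos C10 by (intro mult_right_mono) auto
      finally show ?thesis by (simp add: mult.assoc)
    qed
  qed
  show ?thesis
  proof (rule that)
    show "real (card Z) * C1 + C2 + 1 > 0" using C10 C20 by (simp add: add_nonneg_pos)
  qed (use main in \<open>simp add: \<delta>_def n_def\<close>)
qed

section \<open>The jump density\<close>

lemma power_div_fact_le_exp:
  fixes x :: real
  assumes "x \<ge> 0"
  shows "x ^ n / fact n \<le> exp x"
proof -
  have "(\<Sum>k\<in>{n}. x ^ k /\<^sub>R fact k) \<le> (\<Sum>k. x ^ k /\<^sub>R fact k)"
    using assms by (intro sum_le_suminf summable_exp_generic) auto
  then show ?thesis by (simp add: exp_def divide_inverse mult.commute)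
qed

text \<open>The constant from bounding \<open>exp (- (q\<^sup>2 / 4))\<close> in two steps:
  completing a square replaces it by \<open>exp (3 / 8 - (1 + q) / 4)\<close>, and one term of the
  exponential series turns this into a negative power of \<open>1 + q\<close> of any order
  \<open>n\<close>.\<close>

definition gauss_const :: "nat \<Rightarrow> real" where
  "gauss_const n = exp (3 / 8) * fact n * 4 ^ n"

lemma gauss_const_pos: "gauss_const n > 0"
  by (simp add: gauss_const_def)

lemma exp_neg_square_le:
  fixes q :: real
  assumes "q \<ge> 0"
  shows "exp (- (q\<^sup>2 / 4)) \<le> gauss_const n / (1 + q) ^ n"
proof -
  have "0 \<le> (q - 1 / 2)\<^sup>2" by simp
  then have "- (q\<^sup>2 / 4) \<le> 3 / 8 - (1 + q) / 4" by (simp add: power2_eq_square field_simps)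
  then have "exp (- (q\<^sup>2 / 4)) \<le> exp (3 / 8 - (1 + q) / 4)" by simp
  also have "\<dots> = exp (3 / 8) / exp ((1 + q) / 4)" by (simp add: exp_diff)
  also have "\<dots> \<le> exp (3 / 8) / (((1 + q) / 4) ^ n / fact n)"
    using assms by (intro divide_left_mono power_div_fact_le_exp) auto
  also have "\<dots> = gauss_const n / (1 + q) ^ n"
    by (simp add: gauss_const_def power_divide field_simps)
  finally show ?thesis .
qed

definition heat_kernel :: "nat \<Rightarrow> real \<Rightarrow> real \<Rightarrow> real" where
  "heat_kernel d s r = (4 * pi * s) powr (- (real d / 2)) * exp (- (r\<^sup>2 / (4 * s)))"

lemma heat_kernel_nonneg: "0 \<le> heat_kernel d s r"
  by (simp add: heat_kernel_def)

text \<open>Diffusive scaling with polynomial decay of arbitrary order \<open>n\<close> in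
  \<open>r / sqrt s\<close>; each later use picks the order that its own estimate consumes.\<close>

lemma heat_kernel_le:
  assumes s: "s > 0" and r: "r \<ge> 0"
  shows "heat_kernel d s r \<le> gauss_const n / (sqrt s ^ d * (1 + r / sqrt s) ^ n)"
proof -
  have "(4 * pi * s) powr (- (real d / 2)) \<le> s powr (- (real d / 2))"
    using s pi_gt3 by (intro powr_mono2') auto
  also have "\<dots> = 1 / sqrt s ^ d"
  proof -
    have "sqrt s ^ d = (s powr (1 / 2)) powr real d"
      using s by (simp add: powr_half_sqrt powr_realpow)
    then show ?thesis by (simp add: powr_powr powr_minus_divide)
  qed
  finally have *: "(4 * pi * s) powr (- (real d / 2)) \<le> 1 / sqrt s ^ d" .
  have "r\<^sup>2 / (4 * s) = (r / sqrt s)\<^sup>2 / 4" using s by (simp add: power_divide)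
  then have "exp (- (r\<^sup>2 / (4 * s))) \<le> gauss_const n / (1 + r / sqrt s) ^ n"
    using exp_neg_square_le[of "r / sqrt s" n] s r by (simp only:) simp
  with * have "heat_kernel d s r \<le> 1 / sqrt s ^ d * (gauss_const n / (1 + r / sqrt s) ^ n)"
    unfolding heat_kernel_def using s by (intro mult_mono) auto
  then show ?thesis by simp
qed

text \<open>In order \<open>d + 2\<close>, \<open>d\<close> powers of \<open>q = r / sqrt s\<close>
  turn \<open>sqrt s ^ d\<close> into \<open>r ^ d\<close>, and the other two give the factor
  \<open>min 1 (s / r\<^sup>2)\<close>.\<close>

lemma heat_kernel_le_min:
  assumes s: "s > 0" and r: "r > 0"
  shows "heat_kernel d s r \<le> gauss_const (d + 2) * min 1 (s / r\<^sup>2) / r ^ d"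
proof -
  define q where "q = r / sqrt s"
  have q: "q > 0" and rq: "r = q * sqrt s" using s r by (auto simp: q_def)
  have "heat_kernel d s r \<le> gauss_const (d + 2) / (sqrt s ^ d * (1 + q) ^ (d + 2))"
    unfolding q_def using s r by (intro heat_kernel_le) auto
  also have "\<dots> = gauss_const (d + 2) / (sqrt s ^ d * ((1 + q) ^ d * (1 + q)\<^sup>2))"
    by (simp add: power_add power2_eq_square)
  also have "\<dots> \<le> gauss_const (d + 2) / (sqrt s ^ d * (q ^ d * max 1 (q\<^sup>2)))"
  proof (intro divide_left_mono mult_left_mono mult_mono)
    have "q\<^sup>2 \<le> (1 + q)\<^sup>2" using q by (intro power_mono) auto
    moreover have "1 \<le> (1 + q)\<^sup>2" using q by (intro one_le_power) auto
    ultimately show "max 1 (q\<^sup>2) \<le> (1 + q)\<^sup>2" by simp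
    show "q ^ d \<le> (1 + q) ^ d" using q by (intro power_mono) auto
    show "0 < sqrt s ^ d * ((1 + q) ^ d * (1 + q)\<^sup>2) * (sqrt s ^ d * (q ^ d * max 1 (q\<^sup>2)))"
      using s q by (intro mult_pos_pos zero_less_power) (auto simp: max_def)
  qed (use s q gauss_const_pos[of "d + 2"] in auto)
  also have "\<dots> = gauss_const (d + 2) * (1 / max 1 (q\<^sup>2)) / r ^ d"
    by (simp add: rq power_mult_distrib)
  also have "1 / max 1 (q\<^sup>2) = min 1 (s / r\<^sup>2)"
    using s r by (auto simp: q_def max_def min_def power_divide field_simps)
  finally show ?thesis .
qed

lemma suminf_ennreal_geometric_half:
  assumes "c \<ge> 0"
  shows "(\<Sum>i. ennreal (c * (1 / 2) ^ i)) = ennreal (c * 2)"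
proof (rule suminf_ennreal_eq)
  show "(\<lambda>i. c * (1 / 2) ^ i) sums (c * 2)"
    using geometric_sums[of "1 / 2 :: real"] by (intro sums_mult) simp
qed (use assms in simp)

text \<open>Dyadic balls of radius \<open>2 ^ i * \<sigma>\<close>: decay of order
  \<open>DIM('a) + 1\<close> beats the volume growth of order \<open>DIM('a)\<close> by one factor
  \<open>1 / 2\<close> per step.\<close>

lemma nn_integral_one_plus_norm_power:
  fixes \<sigma> :: real
  assumes \<sigma>: "\<sigma> > 0"
  shows "(\<integral>\<^sup>+(z::'a::euclidean_space). ennreal (1 / (1 + norm z / \<sigma>) ^ (DIM('a) + 1)) \<partial>lborel)
    \<le> ennreal (measure lborel (ball 0 1 :: 'a set) * 2 ^ (DIM('a) + 2) * \<sigma> ^ DIM('a))"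
proof -
  define d where "d = DIM('a)"
  define B where "B = measure lborel (ball 0 1 :: 'a set)"
  have B0: "B \<ge> 0" by (simp add: B_def)
  define F where "F i z = ennreal (2 ^ (d + 1) / 2 ^ (i * (d + 1))) * indicator (ball 0 (2 ^ i * \<sigma>)) z" for i :: nat and z :: 'a
  have pw: "ennreal (1 / (1 + norm z / \<sigma>) ^ (d + 1)) \<le> (\<Sum>i. F i z)" for z
  proof -
    define q where "q = norm z / \<sigma>"
    have q0: "q \<ge> 0" using \<sigma> by (simp add: q_def)
    obtain i0 where "q < 2 ^ i0" using real_arch_pow[of 2 q] by auto
    \<comment> \<open>The least such \<open>i\<close> satisfies
      \<open>2 ^ i / 2 \<le> 1 + q\<close>; the summand 1 covers \<open>i = 0\<close>.\<close>
    define i where "i = (LEAST i. q < 2 ^ i)"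
    have i: "q < 2 ^ i" unfolding i_def by (rule LeastI) fact
    have "2 ^ i / 2 \<le> 1 + q"
    proof (cases i)
      case (Suc k)
      then have "\<not> q < 2 ^ k" using not_less_Least[of k "\<lambda>i. q < 2 ^ i"] by (simp add: i_def)
      then show ?thesis using Suc by simp
    qed (use q0 in simp)
    then have "(2 ^ i / 2) ^ (d + 1) \<le> (1 + q) ^ (d + 1)" by (intro power_mono) auto
    then have "1 / (1 + q) ^ (d + 1) \<le> 1 / (2 ^ i / 2) ^ (d + 1)"
      using q0 by (intro divide_left_mono) auto
    also have "\<dots> = 2 ^ (d + 1) / 2 ^ (i * (d + 1))"
      by (simp only: power_divide power_mult) simp
    finally have "ennreal (1 / (1 + q) ^ (d + 1)) \<le> F i z"
      using i \<sigma> by (simp add: F_def q_def field_simps ennreal_leI)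
    also have "\<dots> \<le> (\<Sum>i. F i z)" using sum_le_suminf[of "\<lambda>i. F i z" "{i}"] by simp
    finally show ?thesis by (simp add: q_def)
  qed
  have "(\<integral>\<^sup>+(z::'a). ennreal (1 / (1 + norm z / \<sigma>) ^ (d + 1)) \<partial>lborel) \<le> (\<integral>\<^sup>+z. (\<Sum>i. F i z) \<partial>lborel)"
    by (intro nn_integral_mono pw)
  also have "\<dots> = (\<Sum>i. \<integral>\<^sup>+z. F i z \<partial>lborel)"
    unfolding F_def by (intro nn_integral_suminf borel_measurable_times_ennreal borel_measurable_const borel_measurable_indicator) simp
  also have "\<dots> = (\<Sum>i. ennreal (B * 2 ^ (d + 1) * \<sigma> ^ d * (1 / 2) ^ i))"
  proof (rule arg_cong[of _ _ suminf], rule ext)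
    fix i
    have "(\<integral>\<^sup>+z. F i z \<partial>lborel) = ennreal (2 ^ (d + 1) / 2 ^ (i * (d + 1))) * emeasure lborel (ball 0 (2 ^ i * \<sigma>) :: 'a set)"
      unfolding F_def by (subst nn_integral_cmult_indicator) auto
    also have "emeasure lborel (ball 0 (2 ^ i * \<sigma>) :: 'a set) = ennreal (measure lborel (ball 0 (2 ^ i * \<sigma>) :: 'a set))"
      using emeasure_lborel_ball_finite[of "0::'a" "2 ^ i * \<sigma>"] by (intro emeasure_eq_ennreal_measure) auto
    also have "measure lborel (ball 0 (2 ^ i * \<sigma>) :: 'a set) = (2 ^ i * \<sigma>) ^ d * B"
      unfolding B_def d_def using \<sigma> by (intro content_ball_conv_unit_ball) auto
    finally have "(\<integral>\<^sup>+z. F i z \<partial>lborel) = ennreal (2 ^ (d + 1) / 2 ^ (i * (d + 1)) * ((2 ^ i * \<sigma>) ^ d * B))"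
      using B0 \<sigma> by (simp only:) (rule ennreal_mult'[symmetric], simp)
    also have "2 ^ (d + 1) / 2 ^ (i * (d + 1)) * ((2 ^ i * \<sigma>) ^ d * B) = B * 2 ^ (d + 1) * \<sigma> ^ d * (1 / 2) ^ i"
      by (simp add: power_mult_distrib power_add power_mult power_divide)
    finally show "(\<integral>\<^sup>+z. F i z \<partial>lborel) = ennreal (B * 2 ^ (d + 1) * \<sigma> ^ d * (1 / 2) ^ i)" .
  qed
  also have "\<dots> = ennreal (B * 2 ^ (d + 1) * \<sigma> ^ d * 2)"
    using B0 \<sigma> by (intro suminf_ennreal_geometric_half) simp
  finally show ?thesis by (simp add: d_def B_def mult.assoc mult.commute mult.left_commute)
qed

text \<open>The weight is at most \<open>min 1 (s / r\<^sup>2) * (1 + q)\<^sup>2\<close> with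
  \<open>q = norm z / sqrt s\<close>, so decay of order \<open>d + 3\<close> leaves the integrable
  order \<open>d + 1\<close>.\<close>

lemma nn_integral_heat_kernel_le:
  assumes s: "s > 0" and r: "r > 0"
  shows "(\<integral>\<^sup>+(z::'a::euclidean_space). ennreal (min 1 ((norm z)\<^sup>2 / r\<^sup>2) * heat_kernel DIM('a) s (norm z)) \<partial>lborel)
    \<le> ennreal (gauss_const (DIM('a) + 3) * measure lborel (ball 0 1 :: 'a set) * 2 ^ (DIM('a) + 2) * min 1 (s / r\<^sup>2))"
proof -
  define d where "d = DIM('a)"
  define K where "K = gauss_const (d + 3)"
  have K: "K > 0" by (simp add: K_def gauss_const_pos)
  define B where "B = measure lborel (ball 0 1 :: 'a set)"
  define A where "A = min 1 (s / r\<^sup>2) * K / sqrt s ^ d"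
  have A0: "A \<ge> 0" using s K by (simp add: A_def)
  have pw: "min 1 ((norm z)\<^sup>2 / r\<^sup>2) * heat_kernel d s (norm z) \<le> A * (1 / (1 + norm z / sqrt s) ^ (d + 1))"
    for z :: 'a
  proof -
    define q where "q = norm z / sqrt s"
    have q: "q \<ge> 0" using s by (simp add: q_def)
    have z: "(norm z)\<^sup>2 = q\<^sup>2 * s" using s by (simp add: q_def power_divide)
    have "min 1 ((norm z)\<^sup>2 / r\<^sup>2) \<le> min 1 (s / r\<^sup>2) * (1 + q)\<^sup>2"
    proof -
      have "q\<^sup>2 \<le> (1 + q)\<^sup>2" using q by (intro power_mono) auto
      then have "q\<^sup>2 * (s / r\<^sup>2) \<le> (1 + q)\<^sup>2 * (s / r\<^sup>2)" using s by (intro mult_right_mono) auto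
      moreover have "1 \<le> (1 + q)\<^sup>2" using q by (intro one_le_power) auto
      ultimately show ?thesis by (simp add: z min_def mult.commute)
    qed
    moreover have "heat_kernel d s (norm z) \<le> K / (sqrt s ^ d * (1 + q) ^ (d + 3))"
      unfolding q_def K_def using s by (intro heat_kernel_le) auto
    ultimately have "min 1 ((norm z)\<^sup>2 / r\<^sup>2) * heat_kernel d s (norm z)
      \<le> (min 1 (s / r\<^sup>2) * (1 + q)\<^sup>2) * (K / (sqrt s ^ d * (1 + q) ^ (d + 3)))"
      using s q by (intro mult_mono) (auto simp: heat_kernel_nonneg)
    also have "\<dots> = A * ((1 + q)\<^sup>2 / (1 + q) ^ (d + 3))" by (simp add: A_def)
    also have "(1 + q)\<^sup>2 / (1 + q) ^ (d + 3) = 1 / (1 + q) ^ (d + 1)"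
    proof -
      have "(1 + q) ^ (d + 3) = (1 + q)\<^sup>2 * (1 + q) ^ (d + 1)" by (simp add: power_add power2_eq_square power3_eq_cube)
      then show ?thesis using q by simp
    qed
    finally show ?thesis by (simp add: q_def)
  qed
  have "(\<integral>\<^sup>+(z::'a). ennreal (min 1 ((norm z)\<^sup>2 / r\<^sup>2) * heat_kernel d s (norm z)) \<partial>lborel)
    \<le> (\<integral>\<^sup>+(z::'a). ennreal A * ennreal (1 / (1 + norm z / sqrt s) ^ (d + 1)) \<partial>lborel)"
    using pw A0 by (intro nn_integral_mono) (simp add: ennreal_mult'[symmetric] ennreal_leI)
  also have "\<dots> = ennreal A * (\<integral>\<^sup>+(z::'a). ennreal (1 / (1 + norm z / sqrt s) ^ (d + 1)) \<partial>lborel)"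
    by (intro nn_integral_cmult) measurable
  also have "\<dots> \<le> ennreal A * ennreal (B * 2 ^ (d + 2) * sqrt s ^ d)"
    unfolding B_def d_def using s by (intro mult_left_mono nn_integral_one_plus_norm_power) auto
  also have "\<dots> = ennreal (A * (B * 2 ^ (d + 2) * sqrt s ^ d))"
    using A0 by (simp add: ennreal_mult')
  also have "A * (B * 2 ^ (d + 2) * sqrt s ^ d) = K * B * 2 ^ (d + 2) * min 1 (s / r\<^sup>2)"
    using s by (simp add: A_def)
  finally show ?thesis by (simp add: d_def K_def B_def)
qed

text \<open>Dyadic shells around \<open>x\<close> from radius \<open>r\<close> on: mass in balls
  growing one power slower than \<open>dist x y ^ DIM('a)\<close> leaves a geometric series. It is
  applied to boundary layers, where \<open>A\<close> is proportional to the thickness.\<close>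

lemma nn_integral_inverse_dist_power_le:
  fixes S :: "'a::euclidean_space set"
  assumes S[measurable]: "S \<in> sets borel" and r: "r > 0" and A: "A \<ge> 0"
    and meas: "\<And>\<rho>. \<rho> \<ge> r \<Longrightarrow> emeasure lborel {y \<in> S. dist x y < \<rho>} \<le> ennreal (A * \<rho> ^ (DIM('a) - 1))"
  shows "(\<integral>\<^sup>+y. indicator {y \<in> S. r \<le> dist x y} y * ennreal (1 / dist x y ^ DIM('a)) \<partial>lborel)
    \<le> ennreal (2 ^ DIM('a) * A / r)"
proof -
  define d where "d = DIM('a)"
  have d: "d = Suc (d - 1)" by (simp add: d_def)
  define F where "F i y = ennreal (1 / (2 ^ i * r) ^ d) * indicator {y \<in> S. dist x y < 2 ^ Suc i * r} y" for i :: nat and y :: 'a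
  have pw: "indicator {y \<in> S. r \<le> dist x y} y * ennreal (1 / dist x y ^ d) \<le> (\<Sum>i. F i y)" for y
  proof (cases "y \<in> S \<and> r \<le> dist x y")
    case True
    define q where "q = dist x y / r"
    have q1: "1 \<le> q" using True r by (simp add: q_def)
    obtain i0 where "q < 2 ^ i0" using real_arch_pow[of 2 q] by auto
    define k where "k = (LEAST i. q < 2 ^ i)"
    have k: "q < 2 ^ k" unfolding k_def by (rule LeastI) fact
    then obtain i where i: "k = Suc i" using q1 by (cases k) auto
    then have "\<not> q < 2 ^ i" using not_less_Least[of i "\<lambda>i. q < 2 ^ i"] by (simp add: k_def)
    then have l: "2 ^ i * r \<le> dist x y" using r by (simp add: q_def field_simps)
    have u: "dist x y < 2 ^ Suc i * r" using k i r by (simp add: q_def field_simps)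
    have "(2 ^ i * r) ^ d \<le> dist x y ^ d" using l r by (intro power_mono) auto
    moreover have "0 < (2 ^ i * r) ^ d" using r by simp
    ultimately have "1 / dist x y ^ d \<le> 1 / (2 ^ i * r) ^ d"
      by (intro divide_left_mono mult_pos_pos) auto
    then have "indicator {y \<in> S. r \<le> dist x y} y * ennreal (1 / dist x y ^ d) \<le> F i y"
      using True u by (simp add: F_def ennreal_leI)
    also have "\<dots> \<le> (\<Sum>i. F i y)" using sum_le_suminf[of "\<lambda>i. F i y" "{i}"] by simp
    finally show ?thesis .
  qed auto
  have "(\<integral>\<^sup>+y. indicator {y \<in> S. r \<le> dist x y} y * ennreal (1 / dist x y ^ d) \<partial>lborel)
    \<le> (\<integral>\<^sup>+y. (\<Sum>i. F i y) \<partial>lborel)"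
    by (intro nn_integral_mono pw)
  also have "\<dots> = (\<Sum>i. \<integral>\<^sup>+y. F i y \<partial>lborel)"
    unfolding F_def by (rule nn_integral_suminf) measurable
  also have "\<dots> \<le> (\<Sum>i. ennreal (2 ^ (d - 1) * A / r * (1 / 2) ^ i))"
  proof (rule suminf_le)
    fix i
    have "(\<integral>\<^sup>+y. F i y \<partial>lborel) = ennreal (1 / (2 ^ i * r) ^ d) * emeasure lborel {y \<in> S. dist x y < 2 ^ Suc i * r}"
      unfolding F_def by (subst nn_integral_cmult_indicator) auto
    also have "\<dots> \<le> ennreal (1 / (2 ^ i * r) ^ d) * ennreal (A * (2 ^ Suc i * r) ^ (d - 1))"
    proof (intro mult_left_mono)
      have "1 * r \<le> 2 ^ Suc i * r" using r by (intro mult_right_mono one_le_power) auto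
      then show "emeasure lborel {y \<in> S. dist x y < 2 ^ Suc i * r} \<le> ennreal (A * (2 ^ Suc i * r) ^ (d - 1))"
        unfolding d_def by (intro meas) simp
    qed simp
    also have "\<dots> = ennreal (1 / (2 ^ i * r) ^ d * (A * (2 ^ Suc i * r) ^ (d - 1)))"
      using A r by (simp add: ennreal_mult'[symmetric])
    also have "1 / (2 ^ i * r) ^ d * (A * (2 ^ Suc i * r) ^ (d - 1)) = 2 ^ (d - 1) * A / r * (1 / 2) ^ i"
    proof -
      have "(2 ^ Suc i * r) ^ (d - 1) = 2 ^ (d - 1) * (2 ^ i * r) ^ (d - 1)"
        by (simp add: power_mult_distrib mult.assoc)
      moreover have "(2 ^ i * r) ^ d = (2 ^ i * r) * (2 ^ i * r) ^ (d - 1)"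
        by (subst d) simp
      ultimately show ?thesis using r by (simp add: power_divide mult.commute)
    qed
    finally show "(\<integral>\<^sup>+y. F i y \<partial>lborel) \<le> ennreal (2 ^ (d - 1) * A / r * (1 / 2) ^ i)" .
  qed auto
  also have "\<dots> = ennreal (2 ^ (d - 1) * A / r * 2)"
    using A r by (intro suminf_ennreal_geometric_half) simp
  also have "2 ^ (d - 1) * A / r * 2 = 2 ^ d * A / r"
    by (subst (2) d) simp
  finally show ?thesis by (simp add: d_def)
qed

text \<open>With the next lemma, \<open>1 - exp (- w)\<close> and \<open>min 1 w\<close> are
  comparable. Integrated against the Levy density, this lets \<open>\<phi> x\<close> control
  \<open>min 1 (x * s)\<close>, the form in which the heat kernel bounds arrive.\<close>

lemma min_one_le_one_minus_exp:
  fixes w :: real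
  assumes "w \<ge> 0"
  shows "min 1 w \<le> 2 * (1 - exp (- w))"
proof -
  have "1 + w \<le> exp w" by (rule exp_ge_add_one_self)
  then have "exp (- w) \<le> 1 / (1 + w)" using assms by (simp add: exp_minus field_simps)
  moreover have "min 1 w \<le> 2 * (1 - 1 / (1 + w))"
  proof (cases "w \<le> 1")
    case True
    then have "w * w \<le> w * 1" using assms by (intro mult_left_mono) auto
    then show ?thesis using assms True by (simp add: field_simps)
  qed (use assms in \<open>simp add: field_simps\<close>)
  ultimately show ?thesis by (auto intro: order_trans)
qed

lemma one_minus_exp_le_min:
  fixes w :: real
  assumes "w \<ge> 0"
  shows "1 - exp (- w) \<le> min 1 w"
  using exp_ge_add_one_self[of "- w"] by simp

text \<open>Concavity of \<open>1 - exp (- w)\<close>, which vanishes at 0; it follows from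
  \<open>1 + w \<le> exp w\<close>, used at \<open>w\<close> and at
  \<open>- ((c - 1) * w)\<close>.\<close>

lemma one_minus_exp_mult_le:
  fixes w c :: real
  assumes "w \<ge> 0" "c \<ge> 1"
  shows "1 - exp (- (c * w)) \<le> c * (1 - exp (- w))"
proof -
  have "exp (- w) * (1 + w) \<le> exp (- w) * exp w" by (intro mult_left_mono exp_ge_add_one_self) simp
  then have "exp (- w) * (1 + w) \<le> 1" by (simp flip: exp_add)
  then have "(c - 1) * (exp (- w) * (1 + w)) \<le> (c - 1) * 1" using assms by (intro mult_left_mono) auto
  moreover have "exp (- w) * (1 + (- ((c - 1) * w))) \<le> exp (- w) * exp (- ((c - 1) * w))"
    by (intro mult_left_mono exp_ge_add_one_self) simp
  moreover have "exp (- w) * exp (- ((c - 1) * w)) = exp (- (c * w))"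
    by (simp add: algebra_simps flip: exp_add)
  ultimately show ?thesis by (simp add: algebra_simps)
qed

section \<open>The Levy density and the growth of \<phi>\<close>

locale levy_density =
  fixes \<phi> \<nu> :: "real \<Rightarrow> real"
  assumes nu_nonneg: "\<And>s. s > 0 \<Longrightarrow> 0 \<le> \<nu> s"
    and nu_cont: "continuous_on {0<..} \<nu>"
    and nu_int: "set_integrable lborel {0<..} (\<lambda>s. min 1 s * \<nu> s)"
    and phi_eq: "\<And>x. x \<ge> 0 \<Longrightarrow> \<phi> x = (LBINT s:{0<..}. (1 - exp (- x * s)) * \<nu> s)"

lemma complete_bernstein_levy_density:
  assumes "complete_bernstein \<phi> \<nu>"
  shows "levy_density \<phi> \<nu>"
proof
  have cm: "completely_monotone \<nu>" using assms by (simp add: complete_bernstein_def)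
  then have "\<nu> differentiable (at s) \<and> 0 \<le> \<nu> s" if "s > 0" for s
    using that unfolding completely_monotone_def by (auto dest: spec[of _ 0])
  then show "\<And>s. s > 0 \<Longrightarrow> 0 \<le> \<nu> s" "continuous_on {0<..} \<nu>"
    by (auto intro!: continuous_at_imp_continuous_on differentiable_imp_continuous_within)
qed (use assms in \<open>auto simp: complete_bernstein_def\<close>)

context levy_density
begin

text \<open>The values of \<open>\<nu>\<close> on the nonpositive half-line are arbitrary; extension
  by 0 makes the density Borel measurable and nonnegative on the whole line.\<close>

definition nu0 :: "real \<Rightarrow> real" where
  "nu0 s = indicator {0<..} s * \<nu> s"

lemma nu0_measurable[measurable]: "nu0 \<in> borel_measurable borel"
  using borel_measurable_continuous_on_indicator[OF _ nu_cont] by (simp add: nu0_def[abs_def])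

lemma nu0_nonneg: "0 \<le> nu0 s"
  by (simp add: nu0_def nu_nonneg indicator_def)

lemma set_integral_nu: "(LBINT s:{0<..}. g s * \<nu> s) = (\<integral>s. g s * nu0 s \<partial>lborel)"
  by (simp add: set_lebesgue_integral_def nu0_def mult.left_commute)

lemma integrable_min_nu0: "integrable lborel (\<lambda>s. min 1 s * nu0 s)"
  using nu_int by (simp add: set_integrable_def nu0_def mult.left_commute)

lemma integrable_nu0:
  assumes [measurable]: "g \<in> borel_measurable borel"
    and "\<And>s. s > 0 \<Longrightarrow> \<bar>g s\<bar> \<le> K * min 1 s"
  shows "integrable lborel (\<lambda>s. g s * nu0 s)"
proof (rule Bochner_Integration.integrable_bound)
  show "integrable lborel (\<lambda>s. K * (min 1 s * nu0 s))" using integrable_min_nu0 by simp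
  show "AE s in lborel. norm (g s * nu0 s) \<le> norm (K * (min 1 s * nu0 s))"
  proof (rule AE_I2)
    fix s :: real
    show "norm (g s * nu0 s) \<le> norm (K * (min 1 s * nu0 s))"
    proof (cases "s > 0")
      case True
      have "\<bar>g s\<bar> * nu0 s \<le> K * min 1 s * nu0 s"
        using assms(2)[OF True] nu0_nonneg by (intro mult_right_mono) auto
      moreover have "0 \<le> \<bar>g s\<bar> * nu0 s" using nu0_nonneg by simp
      ultimately show ?thesis using nu0_nonneg[of s] by (simp add: mult.assoc abs_mult[of "g s"])
    qed (simp add: nu0_def)
  qed
qed measurable

lemma min_mult_le:
  assumes "x \<ge> 0" "s > 0"
  shows "min 1 (x * s) \<le> max 1 x * min 1 (s::real)"
proof (cases "s \<le> 1")
  case True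
  have "x * s \<le> max 1 x * s" using assms by (intro mult_right_mono) auto
  then show ?thesis using True by (simp add: min_def max_def)
next
  case False
  then have "min 1 s = 1" by simp
  then show ?thesis using min.cobounded1[of 1 "x * s"] max.cobounded1[of 1 x] by linarith
qed

lemma integrable_min_mult_nu0:
  assumes "x \<ge> 0"
  shows "integrable lborel (\<lambda>s. min 1 (x * s) * nu0 s)"
  using assms by (intro integrable_nu0[where K = "max 1 x"]) (auto simp: min_mult_le)

lemma integrable_phi:
  assumes "x \<ge> 0"
  shows "integrable lborel (\<lambda>s. (1 - exp (- x * s)) * nu0 s)"
proof (rule integrable_nu0[where K = "max 1 x"])
  fix s :: real assume "s > 0"
  then show "\<bar>1 - exp (- x * s)\<bar> \<le> max 1 x * min 1 s"
    using order_trans[OF one_minus_exp_le_min[of "x * s"] min_mult_le[of x s]] assms by simp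
qed measurable

lemma phi_eq0: "x \<ge> 0 \<Longrightarrow> \<phi> x = (\<integral>s. (1 - exp (- x * s)) * nu0 s \<partial>lborel)"
  using phi_eq by (simp add: set_integral_nu)

lemma integral_min_le_phi:
  assumes "x \<ge> 0"
  shows "(\<integral>s. min 1 (x * s) * nu0 s \<partial>lborel) \<le> 2 * \<phi> x"
proof -
  have "(\<integral>s. min 1 (x * s) * nu0 s \<partial>lborel) \<le> (\<integral>s. 2 * ((1 - exp (- x * s)) * nu0 s) \<partial>lborel)"
  proof (intro integral_mono integrable_min_mult_nu0 assms)
    show "integrable lborel (\<lambda>s. 2 * ((1 - exp (- x * s)) * nu0 s))" using integrable_phi[OF assms] by simp
    fix s :: real
    show "min 1 (x * s) * nu0 s \<le> 2 * ((1 - exp (- x * s)) * nu0 s)"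
    proof (cases "s > 0")
      case True
      then have "min 1 (x * s) * nu0 s \<le> 2 * (1 - exp (- (x * s))) * nu0 s"
        using assms by (intro mult_right_mono min_one_le_one_minus_exp nu0_nonneg) auto
      then show ?thesis by (simp add: mult.assoc algebra_simps)
    qed (simp add: nu0_def)
  qed
  then show ?thesis using phi_eq0[OF assms] by simp
qed

lemma phi_nonneg:
  assumes "x \<ge> 0"
  shows "0 \<le> \<phi> x"
  unfolding phi_eq0[OF assms] using assms
  by (intro integral_nonneg_AE AE_I2) (auto simp: nu0_def indicator_def nu_nonneg)

lemma phi_mono:
  assumes "0 \<le> x" "x \<le> y"
  shows "\<phi> x \<le> \<phi> y"
proof -
  have "(\<integral>s. (1 - exp (- x * s)) * nu0 s \<partial>lborel) \<le> (\<integral>s. (1 - exp (- y * s)) * nu0 s \<partial>lborel)"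
  proof (intro integral_mono integrable_phi)
    fix s :: real
    show "(1 - exp (- x * s)) * nu0 s \<le> (1 - exp (- y * s)) * nu0 s"
      using assms by (cases "s > 0") (auto simp: nu0_def nu_nonneg intro!: mult_right_mono)
  qed (use assms in auto)
  then show ?thesis using assms by (simp add: phi_eq0)
qed

text \<open>Concavity together with \<open>\<phi> 0 = 0\<close>, read off pointwise from the
  integrand.\<close>

lemma phi_mult_le:
  assumes "x \<ge> 0" "c \<ge> 1"
  shows "\<phi> (c * x) \<le> c * \<phi> x"
proof -
  have "(\<integral>s. (1 - exp (- (c * x) * s)) * nu0 s \<partial>lborel) \<le> (\<integral>s. c * ((1 - exp (- x * s)) * nu0 s) \<partial>lborel)"
  proof (intro integral_mono integrable_phi)
    show "integrable lborel (\<lambda>s. c * ((1 - exp (- x * s)) * nu0 s))" using integrable_phi[OF assms(1)] by simp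
    fix s :: real
    show "(1 - exp (- (c * x) * s)) * nu0 s \<le> c * ((1 - exp (- x * s)) * nu0 s)"
    proof (cases "s > 0")
      case True
      then have "(1 - exp (- (c * (x * s)))) * nu0 s \<le> c * (1 - exp (- (x * s))) * nu0 s"
        using assms by (intro mult_right_mono one_minus_exp_mult_le nu0_nonneg) auto
      then show ?thesis by (simp add: mult.assoc)
    qed (simp add: nu0_def)
  qed (use assms in auto)
  then show ?thesis using assms by (simp add: phi_eq0)
qed

section \<open>Pointwise and integral bounds for the jump kernel\<close>

lemma jump_density_eq: "jump_density d \<nu> r = (\<integral>s. heat_kernel d s r * nu0 s \<partial>lborel)"
  unfolding jump_density_def set_integral_nu heat_kernel_def ..

lemma jump_density_measurable[measurable]: "jump_density d \<nu> \<in> borel_measurable borel"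
  unfolding jump_density_eq[abs_def] heat_kernel_def by measurable

lemma jump_density_nonneg: "0 \<le> jump_density d \<nu> r"
  unfolding jump_density_eq by (intro integral_nonneg_AE AE_I2 mult_nonneg_nonneg heat_kernel_nonneg nu0_nonneg)

lemma integrable_heat_kernel_nu0:
  assumes r: "r > 0"
  shows "integrable lborel (\<lambda>s. heat_kernel d s r * nu0 s)"
proof (rule integrable_nu0)
  show "(\<lambda>s. heat_kernel d s r) \<in> borel_measurable borel" unfolding heat_kernel_def by measurable
  fix s :: real assume s: "s > 0"
  have "heat_kernel d s r \<le> gauss_const (d + 2) * min 1 (s / r\<^sup>2) / r ^ d"
    by (rule heat_kernel_le_min[OF s r])
  also have "\<dots> \<le> gauss_const (d + 2) * (max 1 (1 / r\<^sup>2) * min 1 s) / r ^ d"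
    using min_mult_le[of "1 / r\<^sup>2" s] s r gauss_const_pos[of "d + 2"]
    by (intro divide_right_mono mult_left_mono) auto
  finally show "\<bar>heat_kernel d s r\<bar> \<le> gauss_const (d + 2) * max 1 (1 / r\<^sup>2) / r ^ d * min 1 s"
    by (simp add: heat_kernel_nonneg)
qed

text \<open>The jump density is a mixture of heat kernels, each at most a constant times
  \<open>min 1 (s / r\<^sup>2) / r ^ d\<close>; mixing turns the minimum into
  \<open>\<phi> (1 / r\<^sup>2)\<close>.\<close>

lemma jump_density_le:
  assumes r: "r > 0"
  shows "jump_density d \<nu> r \<le> 2 * gauss_const (d + 2) * \<phi> (1 / r\<^sup>2) / r ^ d"
proof -
  define K where "K = gauss_const (d + 2) / r ^ d"
  have K: "K > 0" using r gauss_const_pos by (simp add: K_def)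
  have "jump_density d \<nu> r \<le> (\<integral>s. K * (min 1 (1 / r\<^sup>2 * s) * nu0 s) \<partial>lborel)"
    unfolding jump_density_eq
  proof (intro integral_mono integrable_heat_kernel_nu0 r)
    show "integrable lborel (\<lambda>s. K * (min 1 (1 / r\<^sup>2 * s) * nu0 s))"
      by (intro integrable_mult_right integrable_min_mult_nu0) simp
    fix s :: real
    show "heat_kernel d s r * nu0 s \<le> K * (min 1 (1 / r\<^sup>2 * s) * nu0 s)"
    proof (cases "s > 0")
      case True
      have "heat_kernel d s r * nu0 s \<le> (gauss_const (d + 2) * min 1 (s / r\<^sup>2) / r ^ d) * nu0 s"
        using True r by (intro mult_right_mono heat_kernel_le_min nu0_nonneg) auto
      then show ?thesis by (simp add: K_def mult_ac)
    qed (simp add: nu0_def)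
  qed
  also have "\<dots> = K * (\<integral>s. min 1 (1 / r\<^sup>2 * s) * nu0 s \<partial>lborel)" by simp
  also have "\<dots> \<le> K * (2 * \<phi> (1 / r\<^sup>2))" using K by (intro mult_left_mono integral_min_le_phi) auto
  finally show ?thesis by (simp add: K_def mult_ac)
qed

text \<open>Tonelli reduces this truncated second moment to that of the heat kernels. The weight
  measures quadratic remainders for jumps shorter than \<open>r\<close> and counts the longer jumps,
  both at the cost \<open>\<phi> (1 / r\<^sup>2)\<close>.\<close>

lemma nn_integral_min_jump_density_le:
  assumes r: "r > 0"
  shows "(\<integral>\<^sup>+(z::'a::euclidean_space). ennreal (min 1 ((norm z)\<^sup>2 / r\<^sup>2) * jump_density DIM('a) \<nu> (norm z)) \<partial>lborel)
    \<le> ennreal (gauss_const (DIM('a) + 3) * measure lborel (ball 0 1 :: 'a set) * 2 ^ (DIM('a) + 3) * \<phi> (1 / r\<^sup>2))"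
proof -
  define d where "d = DIM('a)"
  define K where "K = gauss_const (d + 3) * measure lborel (ball 0 1 :: 'a set) * 2 ^ (d + 2)"
  have K: "K \<ge> 0" using gauss_const_pos[of "d + 3"] by (simp add: K_def)
  define m where "m z = min 1 ((norm z)\<^sup>2 / r\<^sup>2)" for z :: 'a
  have m0: "m z \<ge> 0" for z by (simp add: m_def)
  have [measurable]: "m \<in> borel_measurable borel" unfolding m_def by measurable
  \<comment> \<open>At \<open>z = 0\<close> the heat kernel may fail to be integrable against
    \<open>nu0\<close>, so that the jump density may be a default value; the weight \<open>m\<close>
    vanishes there.\<close>
  have eq: "ennreal (m z * jump_density d \<nu> (norm z)) = (\<integral>\<^sup>+s. ennreal (m z * heat_kernel d s (norm z) * nu0 s) \<partial>lborel)" for z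
  proof (cases "z = 0")
    case False
    have "(\<integral>\<^sup>+s. ennreal (m z * (heat_kernel d s (norm z) * nu0 s)) \<partial>lborel)
      = ennreal (\<integral>s. m z * (heat_kernel d s (norm z) * nu0 s) \<partial>lborel)"
      using False m0 by (intro nn_integral_eq_integral AE_I2 integrable_mult_right integrable_heat_kernel_nu0
        mult_nonneg_nonneg heat_kernel_nonneg nu0_nonneg) auto
    then show ?thesis by (simp add: jump_density_eq mult.assoc)
  qed (simp add: m_def)
  have "(\<integral>\<^sup>+z. ennreal (m z * jump_density d \<nu> (norm z)) \<partial>lborel)
    = (\<integral>\<^sup>+z. (\<integral>\<^sup>+s. ennreal (m z * heat_kernel d s (norm z) * nu0 s) \<partial>lborel) \<partial>lborel)"
    by (simp add: eq)
  also have "\<dots> = (\<integral>\<^sup>+s. (\<integral>\<^sup>+z. ennreal (m z * heat_kernel d s (norm z) * nu0 s) \<partial>lborel) \<partial>lborel)"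
    unfolding heat_kernel_def by (rule lborel_pair.Fubini') measurable
  also have "\<dots> \<le> (\<integral>\<^sup>+s. ennreal (K * (min 1 (1 / r\<^sup>2 * s) * nu0 s)) \<partial>lborel)"
  proof (rule nn_integral_mono)
    fix s :: real
    show "(\<integral>\<^sup>+z. ennreal (m z * heat_kernel d s (norm z) * nu0 s) \<partial>lborel)
      \<le> ennreal (K * (min 1 (1 / r\<^sup>2 * s) * nu0 s))"
    proof (cases "s > 0")
      case True
      have "(\<integral>\<^sup>+z. ennreal (m z * heat_kernel d s (norm z) * nu0 s) \<partial>lborel)
        = (\<integral>\<^sup>+z. ennreal (m z * heat_kernel d s (norm z)) * ennreal (nu0 s) \<partial>lborel)"
        using nu0_nonneg by (simp add: ennreal_mult'')
      also have "\<dots> = (\<integral>\<^sup>+z. ennreal (m z * heat_kernel d s (norm z)) \<partial>lborel) * ennreal (nu0 s)"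
        unfolding heat_kernel_def by (intro nn_integral_multc) measurable
      also have "\<dots> \<le> ennreal (K * min 1 (s / r\<^sup>2)) * ennreal (nu0 s)"
        unfolding K_def m_def d_def using True r
        by (intro mult_right_mono nn_integral_heat_kernel_le) auto
      also have "\<dots> = ennreal (K * min 1 (s / r\<^sup>2) * nu0 s)"
        using nu0_nonneg by (simp add: ennreal_mult'')
      finally show ?thesis by (simp add: mult.assoc)
    qed (simp add: nu0_def)
  qed
  also have "\<dots> = ennreal (\<integral>s. K * (min 1 (1 / r\<^sup>2 * s) * nu0 s) \<partial>lborel)"
  proof (rule nn_integral_eq_integral)
    show "integrable lborel (\<lambda>s. K * (min 1 (1 / r\<^sup>2 * s) * nu0 s))"
      by (intro integrable_mult_right integrable_min_mult_nu0) simp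
    show "AE s in lborel. 0 \<le> K * (min 1 (1 / r\<^sup>2 * s) * nu0 s)"
      using K by (intro AE_I2) (auto simp: nu0_def indicator_def nu_nonneg)
  qed
  also have "\<dots> \<le> ennreal (K * (2 * \<phi> (1 / r\<^sup>2)))"
    using K integral_min_le_phi[of "1 / r\<^sup>2"] by (intro ennreal_leI) (simp add: mult_left_mono)
  finally show ?thesis by (simp add: m_def d_def K_def mult_ac power_add)
qed

end

section \<open>The nonlinearity\<close>

locale nonlinearity =
  fixes f :: "real \<Rightarrow> real" and m M :: real
  assumes f_nonneg: "\<And>t. 0 \<le> f t" and f_mono: "mono f"
    and f_C1: "f C1_differentiable_on UNIV"
    and F_pos: "\<And>t. t > 0 \<Longrightarrow> F_prim f t > 0"
    and m_pos: "0 < m"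
    and f_deriv: "\<And>t. (1 + m) * f t \<le> t * deriv f t \<and> t * deriv f t \<le> (1 + M) * f t"
begin

lemma f_has_deriv: "(f has_real_derivative deriv f t) (at t)"
  using f_C1 by (auto simp: C1_differentiable_on_eq DERIV_deriv_iff_real_differentiable)

lemma f_cont: "continuous_on A f"
  using f_has_deriv by (meson DERIV_isCont continuous_at_imp_continuous_on)

lemma f_meas[measurable]: "f \<in> borel_measurable borel"
  by (rule borel_measurable_mono) (rule f_mono)

text \<open>A zero of \<open>f\<close> at \<open>t\<close> spreads to everything below
  \<open>t\<close> by monotonicity, which would make the primitive vanish at
  \<open>t\<close>.\<close>

lemma f_pos:
  assumes "t > 0"
  shows "f t > 0"
proof (rule ccontr)
  assume "\<not> f t > 0"
  then have "f t = 0" using f_nonneg[of t] by simp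
  then have "f s = 0" if "s \<le> t" for s
    using monoD[OF f_mono that] f_nonneg[of s] by simp
  then have "F_prim f t = (LBINT s:{0..t}. 0)"
    unfolding F_prim_def by (intro set_lebesgue_integral_cong) auto
  then show False using F_pos[OF assms] by (simp add: set_lebesgue_integral_def)
qed

text \<open>For \<open>p = 1 + m\<close> and \<open>p = 1 + M\<close> condition (1) fixes the sign
  of this derivative, so \<open>f s * s powr (- p)\<close> is monotone; this gives the two growth
  bounds that follow.\<close>

lemma powr_deriv_bounds:
  assumes t: "t > 0"
  shows "((\<lambda>s. f s * s powr (- p)) has_real_derivative (t * deriv f t - p * f t) * t powr (- p - 1)) (at t)"
proof -
  have "t powr (- p) = t * t powr (- p - 1)" using t by (simp add: powr_diff)
  then show ?thesis using t
    by (auto intro!: derivative_eq_intros f_has_deriv simp: algebra_simps)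
qed

lemma growth_lower:
  assumes "0 < s" "s \<le> t"
  shows "(t / s) powr (1 + m) * f s \<le> f t"
proof -
  have "f s * s powr (- (1 + m)) \<le> f t * t powr (- (1 + m))"
  proof (rule DERIV_nonneg_imp_nondecreasing[OF assms(2)])
    fix x assume "s \<le> x" "x \<le> t"
    then have "x > 0" using assms by simp
    moreover have "0 \<le> (x * deriv f x - (1 + m) * f x) * x powr (- (1 + m) - 1)"
      using f_deriv[of x] by (intro mult_nonneg_nonneg) auto
    ultimately show "\<exists>y. ((\<lambda>s. f s * s powr (- (1 + m))) has_real_derivative y) (at x) \<and> 0 \<le> y"
      using powr_deriv_bounds by blast
  qed
  then show ?thesis using assms unfolding powr_minus by (simp add: powr_divide field_simps)
qed

lemma growth_upper:
  assumes "0 < s" "s \<le> t"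
  shows "f t \<le> (t / s) powr (1 + M) * f s"
proof -
  have "f t * t powr (- (1 + M)) \<le> f s * s powr (- (1 + M))"
  proof (rule DERIV_nonpos_imp_nonincreasing[OF assms(2)])
    fix x assume "s \<le> x" "x \<le> t"
    then have "x > 0" using assms by simp
    moreover have "(x * deriv f x - (1 + M) * f x) * x powr (- (1 + M) - 1) \<le> 0"
      using f_deriv[of x] by (intro mult_nonpos_nonneg) auto
    ultimately show "\<exists>y. ((\<lambda>s. f s * s powr (- (1 + M))) has_real_derivative y) (at x) \<and> y \<le> 0"
      using powr_deriv_bounds by blast
  qed
  then show ?thesis using assms unfolding powr_minus by (simp add: powr_divide field_simps)
qed

section \<open>The ratio f(s)/s and its inverse\<close>

definition h :: "real \<Rightarrow> real" where "h s = f s / s"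

lemma h_pos: "s > 0 \<Longrightarrow> h s > 0"
  by (simp add: h_def f_pos)

lemma h_growth:
  assumes "0 < s" "s \<le> t"
  shows "(t / s) powr m * h s \<le> h t"
proof -
  define P where "P = (t / s) powr m"
  have "(t / s) powr (1 + m) = (t / s) * P" using assms by (simp add: powr_add P_def)
  then have "(t / s) * P * f s \<le> f t" using growth_lower[OF assms] by simp
  then show ?thesis using assms unfolding P_def[symmetric] h_def by (simp add: field_simps)
qed

lemma h_strict_mono:
  assumes "0 < s" "s < t"
  shows "h s < h t"
proof -
  have "1 < (t / s) powr m" using assms m_pos by (intro gr_one_powr) auto
  then have "1 * h s < (t / s) powr m * h s" using h_pos[OF assms(1)] by (intro mult_strict_right_mono) auto
  also have "\<dots> \<le> h t" using assms by (intro h_growth) auto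
  finally show ?thesis by simp
qed

lemma h_le_iff:
  assumes "0 < s" "0 < t"
  shows "h s \<le> h t \<longleftrightarrow> s \<le> t"
  using h_strict_mono[of s t] h_strict_mono[of t s] assms by (cases s t rule: linorder_cases) auto

lemma h_surj:
  assumes y: "y > 0"
  shows "\<exists>s>0. h s = y"
proof -
  \<comment> \<open>\<open>c powr m\<close> dominates both \<open>y / h 1\<close> and
    \<open>h 1 / y\<close>, so the power growth of \<open>h\<close> in both directions from 1 puts
    \<open>y\<close> between \<open>h (1 / c)\<close> and \<open>h c\<close>.\<close>
  define c where "c = max 1 (max (y / h 1) (h 1 / y)) powr (1 / m)"
  have h1: "h 1 > 0" by (rule h_pos) simp
  have c1: "c \<ge> 1" unfolding c_def using m_pos by (intro ge_one_powr_ge_zero) auto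
  have cm: "c powr m = max 1 (max (y / h 1) (h 1 / y))" using m_pos by (simp add: c_def powr_powr)
  have "y = y / h 1 * h 1" using h1 by simp
  also have "\<dots> \<le> c powr m * h 1" using h1 cm by (intro mult_right_mono) auto
  also have "\<dots> \<le> h c" using h_growth[of 1 c] c1 by simp
  finally have up: "y \<le> h c" .
  have "h 1 / y * h (1 / c) \<le> c powr m * h (1 / c)" using cm h_pos[of "1 / c"] c1 by (intro mult_right_mono) auto
  also have "\<dots> \<le> h 1" using h_growth[of "1 / c" 1] c1 by simp
  finally have lo: "h (1 / c) \<le> y" using h1 y by (simp add: field_simps)
  have "1 / c \<le> c" using c1 by (smt (verit) divide_le_eq_1_pos)
  moreover have "continuous_on {1 / c..c} h" unfolding h_def using c1
    by (intro continuous_intros f_cont) (auto simp: not_le)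
  ultimately obtain s where "1 / c \<le> s" "s \<le> c" "h s = y"
    using IVT'[of h "1 / c" y c] lo up by auto
  then show ?thesis using c1 by (intro exI[of _ s]) (auto intro: less_le_trans[of 0 "1 / c"])
qed

text \<open>Inverse of \<open>h\<close> on the positive half-line; the value 0 elsewhere makes
  \<open>H\<close> monotone on the whole line and thereby Borel measurable.\<close>

definition H :: "real \<Rightarrow> real" where
  "H y = (if y > 0 then SOME s. s > 0 \<and> h s = y else 0)"

lemma H_pos: "y > 0 \<Longrightarrow> H y > 0" and h_H: "y > 0 \<Longrightarrow> h (H y) = y"
  using someI_ex[OF h_surj[of y]] by (auto simp: H_def)

lemma H_mono: "mono H"
proof (rule monoI)
  fix x y :: real assume xy: "x \<le> y"
  show "H x \<le> H y"
  proof (cases "x > 0")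
    case True
    then show ?thesis using xy h_le_iff[of "H x" "H y"] by (simp add: H_pos h_H)
  next
    case False
    then show ?thesis using H_pos[of y] by (cases "y > 0") (auto simp: H_def[of x] H_def[of y] less_imp_le)
  qed
qed

text \<open>Growth of \<open>h\<close> of order at least \<open>m\<close> means growth of its
  inverse of order at most \<open>1 / m\<close>. This is the source of the doubling constant of the
  profile.\<close>

lemma H_mult_le:
  assumes y: "y > 0" and c: "c \<ge> 1"
  shows "H (c * y) \<le> c powr (1 / m) * H y"
proof -
  have c1: "c powr (1 / m) \<ge> 1" using c m_pos by (intro ge_one_powr_ge_zero) auto
  have le: "H y \<le> c powr (1 / m) * H y" using c1 H_pos[OF y] by (simp add: mult_le_cancel_right1)
  have "h (H (c * y)) = c * h (H y)" using y c by (simp add: h_H)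
  also have "\<dots> = (c powr (1 / m) * H y / H y) powr m * h (H y)"
    using H_pos[OF y] c m_pos by (simp add: powr_powr)
  also have "\<dots> \<le> h (c powr (1 / m) * H y)" by (intro h_growth H_pos y le)
  finally show ?thesis using H_pos[of "c * y"] H_pos[OF y] c1 c y by (subst (asm) h_le_iff) auto
qed

section \<open>The primitive of f and the function varphi\<close>

lemma f_int: "set_integrable lborel {a..b} f"
  by (rule borel_integrable_atLeastAtMost') (rule f_cont)

lemma const_int: "set_integrable lborel {a..b} (\<lambda>_. c :: real)" for a b :: real
  by (intro borel_integrable_atLeastAtMost' continuous_on_const)

lemma F_mono: "mono (F_prim f)"
proof (rule monoI)
  fix s t :: real assume "s \<le> t"
  then show "F_prim f s \<le> F_prim f t"
    unfolding F_prim_def set_lebesgue_integral_def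
    using f_int[of 0 s] f_int[of 0 t] f_nonneg unfolding set_integrable_def
    by (intro integral_mono) (auto simp: indicator_def)
qed

lemma F_meas[measurable]: "F_prim f \<in> borel_measurable borel"
  by (rule borel_measurable_mono) (rule F_mono)

lemma F_le:
  assumes t: "t > 0"
  shows "F_prim f t \<le> t * f t"
proof -
  have "F_prim f t \<le> (LBINT s:{0..t}. f t)"
    unfolding F_prim_def using monoD[OF f_mono]
    by (intro set_integral_mono f_int const_int) auto
  then show ?thesis using t by (simp add: set_lebesgue_integral_def)
qed

text \<open>Comes from keeping only the upper half \<open>{t/2..t}\<close> of the integral that
  defines \<open>F_prim\<close> and from
  \<open>f t \<le> 2 powr (1 + M) * f (t / 2)\<close>.\<close>

definition c1 :: real where "c1 = 1 / (2 * 2 powr (1 + M))"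

lemma c1_pos: "c1 > 0" by (simp add: c1_def)

lemma F_ge:
  assumes t: "t > 0"
  shows "c1 * (t * f t) \<le> F_prim f t"
proof -
  have "c1 * (t * f t) \<le> c1 * (t * ((t / (t / 2)) powr (1 + M) * f (t / 2)))"
    using t c1_pos growth_upper[of "t / 2" t] by (intro mult_left_mono) auto
  also have "\<dots> = t / 2 * f (t / 2)" using t by (simp add: c1_def)
  also have "\<dots> = (LBINT s:{t/2..t}. f (t / 2))" using t by (simp add: set_lebesgue_integral_def)
  also have "\<dots> \<le> (LBINT s:{t/2..t}. f s)"
    using monoD[OF f_mono] by (intro set_integral_mono f_int const_int) auto
  also have "\<dots> \<le> F_prim f t"
    unfolding F_prim_def set_lebesgue_integral_def
    using f_int[of "t/2" t] f_int[of 0 t] f_nonneg t unfolding set_integrable_def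
    by (intro integral_mono) (auto simp: indicator_def)
  finally show ?thesis .
qed

lemma nn_integral_powr_tail:
  assumes t: "t > 0"
  shows "(\<integral>\<^sup>+s. ennreal ((s / t) powr (- (1 + m / 2))) * indicator {t..} s \<partial>lborel) = ennreal (2 / m * t)"
proof -
  define E where "E = (\<lambda>s. - (2 / m) * t * (s / t) powr (- (m / 2)))"
  have "(\<integral>\<^sup>+s. ennreal ((s / t) powr (- (1 + m / 2))) * indicator {t..} s \<partial>lborel) = ennreal (0 - E t)"
  proof (rule nn_integral_FTC_atLeast)
    show "(\<lambda>s. (s / t) powr (- (1 + m / 2))) \<in> borel_measurable borel" by measurable
    fix x assume x: "t \<le> x"
    show "(E has_real_derivative (x / t) powr (- (1 + m / 2))) (at x)"
    proof -
      have d: "((\<lambda>s. s / t) has_real_derivative 1 / t) (at x)" using t by (auto intro!: derivative_eq_intros)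
      have e: "- (m / 2) - real 1 = - (1 + m / 2)" by simp
      have "x / t > 0" using x t by simp
      from DERIV_cmult[OF DERIV_fun_powr[OF d this, of "- (m / 2)"], of "- (2 / m) * t"]
      have "((\<lambda>s. - (2 / m) * t * (s / t) powr (- (m / 2))) has_real_derivative
        - (2 / m) * t * (- (m / 2) * (x / t) powr (- (1 + m / 2)) * (1 / t))) (at x)"
        unfolding e .
      moreover have "- (2 / m) * t * (- (m / 2) * (x / t) powr (- (1 + m / 2)) * (1 / t)) = (x / t) powr (- (1 + m / 2))"
        using t m_pos by simp
      ultimately show ?thesis unfolding E_def by (simp only:)
    qed
    show "0 \<le> (x / t) powr (- (1 + m / 2))" by simp
  next
    have "((\<lambda>s. (s / t) powr (- (m / 2))) \<longlongrightarrow> 0) at_top"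
    proof (rule tendsto_neg_powr)
      show "filterlim (\<lambda>s. s / t) at_top at_top"
        using filterlim_tendsto_pos_mult_at_top[OF tendsto_const _ filterlim_ident, of "1 / t"] t by simp
    qed (use m_pos in simp)
    from tendsto_mult_right_zero[OF this, of "- (2 / m) * t"]
    show "(E \<longlongrightarrow> 0) at_top" unfolding E_def .
  qed
  then show ?thesis using t by (simp add: E_def)
qed

text \<open>\<open>F_prim\<close> dominates a multiple of \<open>s * f s\<close>, which grows with
  exponent at least \<open>2 + m\<close>; the square root leaves \<open>1 + m / 2\<close>, which
  exceeds 1 and makes \<open>varphi\<close> converge.\<close>

lemma inverse_sqrt_F_le:
  assumes "0 < t" "t \<le> s"
  shows "1 / sqrt (F_prim f s) \<le> 1 / sqrt (c1 * (t * f t)) * (s / t) powr (- (1 + m / 2))"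
proof -
  have s: "s > 0" using assms by simp
  have pos: "c1 * (t * f t) > 0" using assms f_pos c1_pos by simp
  have "(s / t) powr (2 + m) = (s / t) * (s / t) powr (1 + m)"
    using assms s by (simp add: powr_add power2_eq_square)
  then have "c1 * (t * f t) * (s / t) powr (2 + m) = c1 * (s * ((s / t) powr (1 + m) * f t))"
    using assms by simp
  also have "\<dots> \<le> c1 * (s * f s)" using growth_lower[OF assms] c1_pos s by (intro mult_left_mono) auto
  also have "\<dots> \<le> F_prim f s" by (rule F_ge) fact
  finally have "sqrt (c1 * (t * f t) * (s / t) powr (2 + m)) \<le> sqrt (F_prim f s)" by simp
  also have "sqrt (c1 * (t * f t) * (s / t) powr (2 + m)) = sqrt (c1 * (t * f t)) * (s / t) powr (1 + m / 2)"
  proof -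
    have "sqrt ((s / t) powr (2 + m)) = ((s / t) powr (2 + m)) powr (1 / 2)"
      using assms s by (simp add: powr_half_sqrt)
    also have "\<dots> = (s / t) powr (1 + m / 2)" by (simp add: powr_powr add_divide_distrib)
    finally show ?thesis by (simp add: real_sqrt_mult)
  qed
  finally have "1 / sqrt (F_prim f s) \<le> 1 / (sqrt (c1 * (t * f t)) * (s / t) powr (1 + m / 2))"
    using pos assms s F_pos[OF s] by (intro divide_left_mono mult_pos_pos) auto
  then show ?thesis unfolding powr_minus_divide by simp
qed

text \<open>Integrability is recorded separately, since a divergent integral would give
  \<open>varphi\<close> the default value 0; the lower bound for \<open>varphi\<close> relies on it
  too.\<close>

lemma varphi_integrable_le:
  assumes t: "t > 0"
  shows "set_integrable lborel {t<..} (\<lambda>s. 1 / sqrt (F_prim f s))"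
    "varphi f t \<le> 2 / (m * sqrt c1) / sqrt (h t)"
proof -
  define k where "k = 1 / sqrt (c1 * (t * f t))"
  have k: "k \<ge> 0" using t c1_pos f_pos[OF t] by (simp add: k_def)
  have "(\<integral>\<^sup>+s. ennreal (indicator {t<..} s *\<^sub>R (1 / sqrt (F_prim f s))) \<partial>lborel)
    \<le> (\<integral>\<^sup>+s. ennreal k * (ennreal ((s / t) powr (- (1 + m / 2))) * indicator {t..} s) \<partial>lborel)"
  proof (rule nn_integral_mono)
    fix s :: real
    show "ennreal (indicator {t<..} s *\<^sub>R (1 / sqrt (F_prim f s)))
      \<le> ennreal k * (ennreal ((s / t) powr (- (1 + m / 2))) * indicator {t..} s)"
      using inverse_sqrt_F_le[OF t, of s] k
      by (cases "t < s") (auto simp: k_def ennreal_mult'[symmetric] intro!: ennreal_leI)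
  qed
  also have "\<dots> = ennreal k * ennreal (2 / m * t)"
    unfolding nn_integral_powr_tail[OF t, symmetric] by (intro nn_integral_cmult) measurable
  also have "\<dots> = ennreal (k * (2 / m * t))" by (rule ennreal_mult'[OF k, symmetric])
  finally have le: "(\<integral>\<^sup>+s. ennreal (indicator {t<..} s *\<^sub>R (1 / sqrt (F_prim f s))) \<partial>lborel) \<le> ennreal (k * (2 / m * t))" .
  have nn: "0 \<le> indicator {t<..} s *\<^sub>R (1 / sqrt (F_prim f s))" for s
    using F_pos[of s] t by (cases "t < s") auto
  show int: "set_integrable lborel {t<..} (\<lambda>s. 1 / sqrt (F_prim f s))"
    unfolding set_integrable_def
  proof (rule integrableI_nonneg)
    show "(\<integral>\<^sup>+s. ennreal (indicator {t<..} s *\<^sub>R (1 / sqrt (F_prim f s))) \<partial>lborel) < \<infinity>"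
      using le by (rule le_less_trans) simp
  qed (use nn in auto)
  have "ennreal (varphi f t) \<le> ennreal (k * (2 / m * t))"
    using le nn_integral_eq_integral[OF int[unfolded set_integrable_def]] nn
    by (simp add: varphi_def set_lebesgue_integral_def)
  then have "varphi f t \<le> k * (2 / m * t)" using k m_pos t by (subst (asm) ennreal_le_iff) auto
  also have "\<dots> = 2 / (m * sqrt c1) / sqrt (h t)"
    using t f_pos[OF t] m_pos c1_pos
    by (simp add: k_def h_def real_sqrt_mult real_sqrt_divide) (simp add: field_simps)
  finally show "varphi f t \<le> 2 / (m * sqrt c1) / sqrt (h t)" .
qed

text \<open>The interval from \<open>t\<close> to \<open>2 * t\<close> already contributes enough,
  as \<open>F_prim\<close> is at most \<open>t * f t / c1\<close> on it.\<close>

lemma varphi_ge: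
  assumes t: "t > 0"
  shows "sqrt c1 / sqrt (h t) \<le> varphi f t"
proof -
  have "2 * t * f (2 * t) \<le> 2 * t * (2 powr (1 + M) * f t)"
    using growth_upper[of t "2 * t"] t by (intro mult_left_mono) auto
  also have "\<dots> = t * f t / c1" by (simp add: c1_def)
  finally have F2: "F_prim f s \<le> t * f t / c1" if "s \<le> 2 * t" for s
    using monoD[OF F_mono that] F_le[of "2 * t"] t by simp
  have pos: "t * f t / c1 > 0" using t f_pos[OF t] c1_pos by simp
  have "sqrt c1 / sqrt (h t) = t * (1 / sqrt (t * f t / c1))"
    using t f_pos[OF t] c1_pos by (simp add: h_def real_sqrt_mult real_sqrt_divide) (simp add: field_simps)
  also have "\<dots> = (\<integral>s. indicator {t<..2*t} s *\<^sub>R (1 / sqrt (t * f t / c1)) \<partial>lborel)"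
    using t by simp
  also have "\<dots> \<le> (\<integral>s. indicator {t<..} s *\<^sub>R (1 / sqrt (F_prim f s)) \<partial>lborel)"
  proof (rule integral_mono)
    show "integrable lborel (\<lambda>s. indicator {t<..} s *\<^sub>R (1 / sqrt (F_prim f s)))"
      using varphi_integrable_le(1)[OF t] by (simp add: set_integrable_def)
    fix s :: real
    show "indicator {t<..2*t} s *\<^sub>R (1 / sqrt (t * f t / c1)) \<le> indicator {t<..} s *\<^sub>R (1 / sqrt (F_prim f s))"
    proof (cases "t < s \<and> s \<le> 2 * t")
      case True
      then have "1 / sqrt (t * f t / c1) \<le> 1 / sqrt (F_prim f s)"
        using F2[of s] F_pos[of s] t pos by (intro divide_left_mono mult_pos_pos) auto
      then show ?thesis using True by simp
    next
      case False
      then show ?thesis using F_pos[of s] t by (auto simp: indicator_def)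
    qed
    show "integrable lborel (\<lambda>s. indicator {t<..2*t} s *\<^sub>R (1 / sqrt (t * f t / c1)))"
      using t by (intro integrable_scaleR_left integrable_real_indicator) simp_all
  qed
  finally show ?thesis by (simp add: varphi_def set_lebesgue_integral_def)
qed

text \<open>The link between \<open>varphi\<close>, in terms of which (2) is stated, and
  \<open>h\<close>, by which the profile is defined.\<close>

lemma inverse_varphi_sq_bounds:
  obtains K k where "K > 0" "k > 0"
    "\<And>t. t > 0 \<Longrightarrow> k * h t \<le> 1 / (varphi f t)\<^sup>2" "\<And>t. t > 0 \<Longrightarrow> 1 / (varphi f t)\<^sup>2 \<le> K * h t"
proof (rule that[of "1 / c1" "(m * sqrt c1 / 2)\<^sup>2"])
  show "1 / c1 > 0" "(m * sqrt c1 / 2)\<^sup>2 > 0" using c1_pos m_pos by auto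
  fix t :: real assume t: "t > 0"
  have h: "h t > 0" by (rule h_pos) fact
  have lo: "0 < sqrt c1 / sqrt (h t)" using c1_pos h by simp
  have v: "varphi f t > 0" using varphi_ge[OF t] lo by simp
  have "(varphi f t)\<^sup>2 \<le> (2 / (m * sqrt c1) / sqrt (h t))\<^sup>2"
    using varphi_integrable_le(2)[OF t] v by (intro power_mono) auto
  then have "1 / (2 / (m * sqrt c1) / sqrt (h t))\<^sup>2 \<le> 1 / (varphi f t)\<^sup>2"
    using v by (intro divide_left_mono mult_pos_pos) (use m_pos c1_pos h in auto)
  then show "(m * sqrt c1 / 2)\<^sup>2 * h t \<le> 1 / (varphi f t)\<^sup>2"
    using h by (simp add: power_divide power_mult_distrib)
  have "(sqrt c1 / sqrt (h t))\<^sup>2 \<le> (varphi f t)\<^sup>2" using varphi_ge[OF t] lo by (intro power_mono) auto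
  then have "1 / (varphi f t)\<^sup>2 \<le> 1 / (sqrt c1 / sqrt (h t))\<^sup>2"
    using v lo by (intro divide_left_mono mult_pos_pos) auto
  then show "1 / (varphi f t)\<^sup>2 \<le> 1 / c1 * h t" using h c1_pos by (simp add: power_divide)
qed

end

section \<open>Renewal functions\<close>

text \<open>Square roots are a sufficient majorant: divided by \<open>1 + w\<^sup>2\<close> they
  leave the exponents -1/2 near 0 and -3/2 at infinity, both integrable.\<close>

lemma abs_ln_le:
  fixes x :: real
  assumes "x > 0"
  shows "\<bar>ln x\<bar> \<le> 2 * (sqrt x + 1 / sqrt x)"
proof -
  have *: "ln y \<le> 2 * sqrt y" if "y > 0" for y :: real
  proof -
    have "ln y = 2 * ln (sqrt y)" using that by (simp add: ln_sqrt)
    also have "\<dots> \<le> 2 * sqrt y" using that ln_bound[of "sqrt y"] by simp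
    finally show ?thesis .
  qed
  have "ln x \<le> 2 * sqrt x" "- ln x \<le> 2 * (1 / sqrt x)"
    using *[of x] *[of "1 / x"] assms by (auto simp: ln_div real_sqrt_divide)
  moreover have "0 \<le> sqrt x" "0 \<le> 1 / sqrt x" using assms by auto
  ultimately show ?thesis unfolding distrib_left abs_le_iff by (intro conjI) linarith+
qed

lemma integrable_abs_ln_div: "set_integrable lborel {0<..} (\<lambda>w::real. \<bar>ln w\<bar> / (1 + w\<^sup>2))"
proof -
  define g where "g w = 4 * w powr (- (1 / 2)) * indicator {0..1} w + 4 * w powr (- (3 / 2)) * indicator {1..} w" for w :: real
  have 1: "(\<integral>\<^sup>+w. ennreal (w powr (- (1 / 2))) * indicator {0..1} w \<partial>lborel) < \<infinity>"
  proof -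
    have "((\<lambda>x. x powr (- (1 / 2))) has_integral (1 powr (- (1 / 2) + 1) / (- (1 / 2) + 1))) {0..1::real}"
      by (rule has_integral_powr_from_0) auto
    then have "(\<integral>\<^sup>+w. ennreal (w powr (- (1 / 2))) * indicator {0..1} w \<partial>lborel) = ennreal (1 powr (- (1 / 2) + 1) / (- (1 / 2) + 1))"
      by (intro nn_integral_has_integral_lebesgue') auto
    then show ?thesis by simp
  qed
  have 2: "(\<integral>\<^sup>+w. ennreal (w powr (- (3 / 2))) * indicator {1..} w \<partial>lborel) < \<infinity>"
  proof -
    have "((\<lambda>x. x powr (- (3 / 2))) has_integral - (1 powr (- (3 / 2) + 1)) / (- (3 / 2) + 1)) {1::real..}"
      by (rule has_integral_powr_to_inf) auto
    then have "(\<integral>\<^sup>+w. ennreal (w powr (- (3 / 2))) * indicator {1..} w \<partial>lborel) = ennreal (- (1 powr (- (3 / 2) + 1)) / (- (3 / 2) + 1))"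
      by (intro nn_integral_has_integral_lebesgue') auto
    then show ?thesis by simp
  qed
  have "integrable lborel (\<lambda>w::real. w powr (- (1 / 2)) * indicator {0..1} w)"
    using 1 by (intro integrableI_nonneg) (auto simp: ennreal_mult'' ennreal_indicator)
  moreover have "integrable lborel (\<lambda>w::real. w powr (- (3 / 2)) * indicator {1..} w)"
    using 2 by (intro integrableI_nonneg) (auto simp: ennreal_mult'' ennreal_indicator)
  ultimately have g: "integrable lborel g"
    unfolding g_def mult.assoc by (intro Bochner_Integration.integrable_add integrable_mult_right)
  show ?thesis unfolding set_integrable_def
  proof (rule Bochner_Integration.integrable_bound[OF g])
    show "AE w in lborel. norm (indicator {0<..} w *\<^sub>R (\<bar>ln w\<bar> / (1 + w\<^sup>2))) \<le> norm (g w)"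
    proof (rule AE_I2)
      fix w :: real
      have g0: "0 \<le> g w" by (simp add: g_def)
      show "norm (indicator {0<..} w *\<^sub>R (\<bar>ln w\<bar> / (1 + w\<^sup>2))) \<le> norm (g w)"
      proof (cases "w > 0")
        case pos: True
        have "\<bar>ln w\<bar> / (1 + w\<^sup>2) \<le> g w"
        proof (cases "w \<le> 1")
          case True
          have "\<bar>ln w\<bar> / (1 + w\<^sup>2) \<le> (2 * (sqrt w + 1 / sqrt w)) / 1"
            using pos abs_ln_le[OF pos] by (intro frac_le) auto
          also have "\<dots> \<le> 4 * (1 / sqrt w)" using pos True by (simp add: field_simps)
          also have "\<dots> = 4 * w powr (- (1 / 2))" using pos by (simp add: powr_minus_divide powr_half_sqrt)
          also have "\<dots> \<le> g w" using pos True by (simp add: g_def)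
          finally show ?thesis .
        next
          case False
          have "\<bar>ln w\<bar> / (1 + w\<^sup>2) \<le> (2 * (sqrt w + 1 / sqrt w)) / w\<^sup>2"
            using pos abs_ln_le[OF pos] by (intro frac_le) auto
          also have "\<dots> \<le> (4 * sqrt w) / w\<^sup>2"
          proof -
            have "1 / sqrt w \<le> 1" "1 \<le> sqrt w" using False by auto
            then have "sqrt w + 1 / sqrt w \<le> 2 * sqrt w" by linarith
            then have "2 * (sqrt w + 1 / sqrt w) \<le> 2 * (2 * sqrt w)" by (intro mult_left_mono) auto
            then show ?thesis by (intro divide_right_mono) auto
          qed
          also have "\<dots> = 4 * w powr (- (3 / 2))"
          proof -
            have "w powr (- (3 / 2)) = w powr (1 / 2 - 2)" by simp
            also have "\<dots> = sqrt w / w\<^sup>2" using pos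
              by (subst powr_diff) (simp add: powr_half_sqrt powr_numeral)
            finally show ?thesis by simp
          qed
          also have "\<dots> \<le> g w" using False by (simp add: g_def)
          finally show ?thesis .
        qed
        then show ?thesis using pos g0 by simp
      qed (simp add: g0)
    qed
  qed measurable
qed

text \<open>The error made when the logarithm of the ladder exponent at \<open>z\<close> is replaced
  by half of \<open>ln (\<psi> (z\<^sup>2))\<close>. The factor 2 comes from the square in the
  argument \<open>z\<^sup>2 * w\<^sup>2\<close>.\<close>

definition ln_const :: real where
  "ln_const = 2 * (LBINT w:{0<..}. \<bar>ln w\<bar> / (1 + w\<^sup>2)) / pi"

text \<open>Shared by a Bernstein function and its conjugate.\<close>

locale moderate =
  fixes \<psi> :: "real \<Rightarrow> real"
  assumes pos: "\<And>x. x > 0 \<Longrightarrow> \<psi> x > 0"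
    and le_mult: "\<And>c x. c \<ge> 1 \<Longrightarrow> x > 0 \<Longrightarrow> \<psi> x \<le> \<psi> (c * x)"
    and mult_le: "\<And>c x. c \<ge> 1 \<Longrightarrow> x > 0 \<Longrightarrow> \<psi> (c * x) \<le> c * \<psi> x"
begin

lemma mono_pos:
  assumes "0 < x" "x \<le> y"
  shows "\<psi> x \<le> \<psi> y"
  using le_mult[of "y / x" x] assms by simp

text \<open>In logarithmic coordinates \<open>\<psi>\<close> is nondecreasing with slope at most
  1.\<close>

lemma abs_ln_ratio_le:
  assumes c: "c > 0" and x: "x > 0"
  shows "\<bar>ln (\<psi> (c * x)) - ln (\<psi> x)\<bar> \<le> \<bar>ln c\<bar>"
proof (cases "c \<ge> 1")
  case True
  have "ln (\<psi> x) \<le> ln (\<psi> (c * x))" using le_mult[OF True x] pos c x by simp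
  moreover have "ln (\<psi> (c * x)) \<le> ln (c * \<psi> x)"
    using mult_le[OF True x] pos c x by (subst ln_le_cancel_iff) auto
  ultimately show ?thesis using c True pos[OF x] by (simp add: ln_mult)
next
  case False
  have c1: "1 / c \<ge> 1" using c False by simp
  have cx: "c * x > 0" using c x by simp
  have "ln (\<psi> (c * x)) \<le> ln (\<psi> x)" using le_mult[OF c1 cx] pos[OF cx] pos[OF x] c by simp
  moreover have "ln (\<psi> x) \<le> ln (1 / c * \<psi> (c * x))"
    using mult_le[OF c1 cx] pos[OF cx] pos[OF x] c by (subst ln_le_cancel_iff) auto
  moreover have "ln (1 / c * \<psi> (c * x)) = - ln c + ln (\<psi> (c * x))"
    using c pos[OF cx] by (simp add: ln_div)
  ultimately show ?thesis using c False by (simp add: abs_le_iff)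
qed

lemma ln_measurable: "(\<lambda>w. indicator {0<..} w * ln (\<psi> (z\<^sup>2 * w\<^sup>2))) \<in> borel_measurable borel"
  if "z > 0" for z :: real
proof -
  have "mono_on {0<..} (\<lambda>w. ln (\<psi> (z\<^sup>2 * w\<^sup>2)))"
  proof (rule mono_onI)
    fix r s :: real assume rs: "r \<in> {0<..}" "s \<in> {0<..}" "r \<le> s"
    then have "\<psi> (z\<^sup>2 * r\<^sup>2) \<le> \<psi> (z\<^sup>2 * s\<^sup>2)"
      using that by (intro mono_pos mult_left_mono power_mono) auto
    then show "ln (\<psi> (z\<^sup>2 * r\<^sup>2)) \<le> ln (\<psi> (z\<^sup>2 * s\<^sup>2))"
      using rs that pos[of "z\<^sup>2 * r\<^sup>2"] pos[of "z\<^sup>2 * s\<^sup>2"] by simp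
  qed
  from borel_measurable_mono_on_fnc[OF this] show ?thesis
    by (subst (asm) borel_measurable_restrict_space_iff) auto
qed

text \<open>Split \<open>ln (\<psi> (z\<^sup>2 * w\<^sup>2))\<close> into its value \<open>a\<close>
  at \<open>w = 1\<close> and a remainder of size \<open>2 * \<bar>ln w\<bar>\<close>. As
  \<open>1 / (1 + w\<^sup>2)\<close> has integral \<open>pi / 2\<close>, the constant part
  contributes \<open>a / 2\<close>, which is the square root; the remainder costs at most
  \<open>ln_const\<close>.\<close>

lemma ladder_exponent_bounds:
  assumes z: "z > 0"
  shows "exp (- ln_const) * sqrt (\<psi> (z\<^sup>2)) \<le> ladder_exponent \<psi> z"
    "ladder_exponent \<psi> z \<le> exp ln_const * sqrt (\<psi> (z\<^sup>2))"
proof -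
  define a where "a = ln (\<psi> (z\<^sup>2))"
  define g where "g w = ln (\<psi> (z\<^sup>2 * w\<^sup>2)) - a" for w
  have p: "\<psi> (z\<^sup>2) > 0" using z by (intro pos) simp
  have gb: "\<bar>g w\<bar> \<le> 2 * \<bar>ln w\<bar>" if "w > 0" for w
    using abs_ln_ratio_le[of "w\<^sup>2" "z\<^sup>2"] that z by (simp add: g_def a_def mult.commute ln_realpow abs_mult)
  have ln2: "set_integrable lborel {0<..} (\<lambda>w::real. 2 * (\<bar>ln w\<bar> / (1 + w\<^sup>2)))"
    by (intro set_integrable_mult_right integrable_abs_ln_div)
  have g_int: "set_integrable lborel {0<..} (\<lambda>w. g w / (1 + w\<^sup>2))"
    unfolding set_integrable_def
  proof (rule Bochner_Integration.integrable_bound[OF ln2[unfolded set_integrable_def]])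
    have "(\<lambda>w. (indicator {0<..} w * ln (\<psi> (z\<^sup>2 * w\<^sup>2)) - indicator {0<..} w * a) / (1 + w\<^sup>2)) \<in> borel_measurable borel"
      using ln_measurable[OF z] by measurable
    then show "(\<lambda>w. indicator {0<..} w *\<^sub>R (g w / (1 + w\<^sup>2))) \<in> borel_measurable lborel"
      by (simp add: g_def right_diff_distrib)
    show "AE w in lborel. norm (indicator {0<..} w *\<^sub>R (g w / (1 + w\<^sup>2)))
      \<le> norm (indicator {0<..} w *\<^sub>R (2 * (\<bar>ln w\<bar> / (1 + w\<^sup>2))))"
    proof (rule AE_I2)
      fix w :: real
      have "\<bar>g w\<bar> / (1 + w\<^sup>2) \<le> 2 * \<bar>ln w\<bar> / (1 + w\<^sup>2)" if "w > 0"
        using gb[OF that] by (intro divide_right_mono) auto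
      then show "norm (indicator {0<..} w *\<^sub>R (g w / (1 + w\<^sup>2)))
        \<le> norm (indicator {0<..} w *\<^sub>R (2 * (\<bar>ln w\<bar> / (1 + w\<^sup>2))))"
        by (auto simp: indicator_def abs_mult)
    qed
  qed
  define I where "I = (LBINT w:{0<..}. g w / (1 + w\<^sup>2))"
  have "(LBINT w:{0<..}. ln (\<psi> (z\<^sup>2 * w\<^sup>2)) / (1 + w\<^sup>2))
    = (LBINT w:{0<..}. g w / (1 + w\<^sup>2) + a * (1 / (1 + w\<^sup>2)))"
    by (simp add: g_def add_divide_distrib[symmetric])
  also have "\<dots> = I + a * (pi / 2)"
  proof -
    have *: "set_integrable lborel {0<..} (\<lambda>w::real. 1 / (1 + w\<^sup>2))" "(LBINT w:{0<..}. 1 / (1 + w\<^sup>2)) = pi / 2"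
      using integrable_I0i_1_div_plus_square LBINT_I0i_1_div_plus_square
      by (simp_all only: interval_lebesgue_integral_0_infty)
    show ?thesis unfolding I_def
      by (subst set_integral_add(2)[OF g_int set_integrable_mult_right[OF *(1)]]) (simp only: set_integral_mult_right *(2))
  qed
  finally have "ladder_exponent \<psi> z = exp (I / pi + a / 2)"
    unfolding ladder_exponent_def by (simp add: add_divide_distrib)
  also have "\<dots> = exp (I / pi) * sqrt (\<psi> (z\<^sup>2))"
  proof -
    have "exp (a / 2) = sqrt (\<psi> (z\<^sup>2))"
      using p powr_half_sqrt[of "\<psi> (z\<^sup>2)"] by (simp add: a_def powr_def)
    then show ?thesis by (simp add: exp_add)
  qed
  finally have eq: "ladder_exponent \<psi> z = exp (I / pi) * sqrt (\<psi> (z\<^sup>2))" .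
  have "\<bar>I\<bar> \<le> 2 * (LBINT w:{0<..}. \<bar>ln w\<bar> / (1 + w\<^sup>2))"
  proof -
    have "\<bar>I\<bar> \<le> (LBINT w:{0<..}. norm (g w / (1 + w\<^sup>2)))"
      unfolding I_def real_norm_def[symmetric] by (rule set_integral_norm_bound) fact
    also have "\<dots> \<le> (LBINT w:{0<..}. 2 * (\<bar>ln w\<bar> / (1 + w\<^sup>2)))"
    proof (rule set_integral_mono)
      show "set_integrable lborel {0<..} (\<lambda>w. norm (g w / (1 + w\<^sup>2)))"
        using set_integrable_norm[OF g_int] .
      fix w :: real assume "w \<in> {0<..}"
      then have "\<bar>g w\<bar> / (1 + w\<^sup>2) \<le> 2 * \<bar>ln w\<bar> / (1 + w\<^sup>2)"
        using gb[of w] by (intro divide_right_mono) auto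
      then show "norm (g w / (1 + w\<^sup>2)) \<le> 2 * (\<bar>ln w\<bar> / (1 + w\<^sup>2))" by simp
    qed (rule ln2)
    also have "\<dots> = 2 * (LBINT w:{0<..}. \<bar>ln w\<bar> / (1 + w\<^sup>2))" by (rule set_integral_mult_right)
    finally show ?thesis .
  qed
  then have "\<bar>I / pi\<bar> \<le> ln_const" by (simp add: ln_const_def divide_right_mono)
  from abs_le_D1[OF this] abs_le_D2[OF this]
  have "exp (- ln_const) \<le> exp (I / pi)" "exp (I / pi) \<le> exp ln_const" by auto
  then show "exp (- ln_const) * sqrt (\<psi> (z\<^sup>2)) \<le> ladder_exponent \<psi> z"
    "ladder_exponent \<psi> z \<le> exp ln_const * sqrt (\<psi> (z\<^sup>2))"
    unfolding eq using p by (auto intro!: mult_right_mono)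
qed

text \<open>Quadrupling the argument of \<open>\<psi>\<close> costs a factor 2 after the square
  root, and each of the two comparisons with a square root costs
  \<open>exp ln_const\<close>.\<close>

lemma ladder_exponent_half:
  assumes z: "z > 0"
  shows "1 / ladder_exponent \<psi> (z / 2) \<le> 2 * exp (2 * ln_const) * (1 / ladder_exponent \<psi> z)"
proof -
  have p: "\<psi> (z\<^sup>2) > 0" "\<psi> ((z / 2)\<^sup>2) > 0" using z by (auto intro!: pos)
  have "\<psi> (z\<^sup>2) \<le> 4 * \<psi> ((z / 2)\<^sup>2)"
    using mult_le[of 4 "(z / 2)\<^sup>2"] z by (simp add: power_divide)
  then have "sqrt (\<psi> (z\<^sup>2)) \<le> sqrt (4 * \<psi> ((z / 2)\<^sup>2))" by (rule real_sqrt_le_mono)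
  then have s: "sqrt (\<psi> (z\<^sup>2)) \<le> 2 * sqrt (\<psi> ((z / 2)\<^sup>2))" by (simp add: real_sqrt_mult)
  have k: "ladder_exponent \<psi> z > 0" "ladder_exponent \<psi> (z / 2) > 0"
    by (auto simp: ladder_exponent_def)
  have "ladder_exponent \<psi> z \<le> exp ln_const * sqrt (\<psi> (z\<^sup>2))" by (rule ladder_exponent_bounds) fact
  also have "\<dots> \<le> exp ln_const * (2 * sqrt (\<psi> ((z / 2)\<^sup>2)))" using s by (intro mult_left_mono) auto
  also have "\<dots> = 2 * exp (2 * ln_const) * (exp (- ln_const) * sqrt (\<psi> ((z / 2)\<^sup>2)))"
    by (simp add: exp_add[symmetric] mult.assoc mult.left_commute)
  also have "\<dots> \<le> 2 * exp (2 * ln_const) * ladder_exponent \<psi> (z / 2)"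
    using z by (intro mult_left_mono ladder_exponent_bounds) auto
  finally show ?thesis using k by (simp add: field_simps)
qed

text \<open>For \<open>z = 1 / t\<close>, the mass of \<open>exp (- z s) dV(s)\<close> beyond \<open>A t\<close> is at most \<open>exp (- A / 2)\<close>
  times the transform at \<open>z / 2\<close>, hence negligible for large \<open>A\<close>.\<close>

lemma renewal_lower_bound:
  obtains A c where "A > 0" "c > 0"
    "\<And>V t. renewal_function \<psi> V \<Longrightarrow> t > 0 \<Longrightarrow> c / sqrt (\<psi> (1 / t\<^sup>2)) \<le> V (A * t)"
proof -
  define q where "q = 2 * exp (2 * ln_const)"
  \<comment> \<open>Chosen so that \<open>exp (- A / 2) * q = 1 / 2\<close>: the tail is then at
    most half of the transform at \<open>z\<close> and is absorbed.\<close>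
  define A where "A = 2 * ln (2 * q)"
  have q: "q \<ge> 1"
  proof -
    have "ln_const \<ge> 0" unfolding ln_const_def set_lebesgue_integral_def
      by (intro divide_nonneg_pos mult_nonneg_nonneg integral_nonneg_AE AE_I2) auto
    then have "exp (2 * ln_const) \<ge> 1" by simp
    then show ?thesis unfolding q_def by linarith
  qed
  have A: "A > 0" unfolding A_def using q by simp
  have eA: "exp (- A / 2) * q = 1 / 2" using q by (simp add: A_def exp_minus field_simps)
  show ?thesis
  proof (rule that[OF A, of "exp (- ln_const) / 2"])
    fix V t assume V: "renewal_function \<psi> V" and t: "(t::real) > 0"
    have mono: "\<And>x y. x \<le> y \<Longrightarrow> V x \<le> V y" and rc: "\<And>a. continuous (at_right a) V"
      and V0: "\<And>t. t < 0 \<Longrightarrow> V t = 0"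
      and lap: "\<And>z. z > 0 \<Longrightarrow> (\<integral>\<^sup>+t\<in>{0..}. ennreal (exp (- z * t)) \<partial>interval_measure V)
              = ennreal (1 / ladder_exponent \<psi> z)"
      using V by (auto simp: renewal_function_def mono_def)
    define z where "z = 1 / t"
    have z: "z > 0" using t by (simp add: z_def)
    define k where "k = 1 / ladder_exponent \<psi> z"
    have k: "k > 0" by (simp add: k_def ladder_exponent_def)
    have At: "A * t > 0" using A t by simp
    then have VA: "V (A * t) \<ge> 0" using mono[of "-1" "A * t"] V0[of "-1"] by simp
    have "ennreal k = (\<integral>\<^sup>+s\<in>{0..}. ennreal (exp (- z * s)) \<partial>interval_measure V)"
      using lap[OF z] by (simp add: k_def)
    also have "\<dots> \<le> (\<integral>\<^sup>+s. indicator {-1<..A * t} s + ennreal (exp (- A / 2)) * (ennreal (exp (- (z / 2) * s)) * indicator {0..} s) \<partial>interval_measure V)"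
    proof (rule nn_integral_mono)
      fix s :: real
      show "ennreal (exp (- z * s)) * indicator {0..} s
        \<le> indicator {-1<..A * t} s + ennreal (exp (- A / 2)) * (ennreal (exp (- (z / 2) * s)) * indicator {0..} s)"
      proof (cases "s < 0")
        case False
        show ?thesis
        proof (cases "s \<le> A * t")
          case True
          have "ennreal (exp (- z * s)) \<le> 1" using False z by simp
          then show ?thesis using True False by (simp add: add_increasing2)
        next
          case gt: False
          have "A / 2 \<le> z / 2 * s" using gt t by (simp add: z_def field_simps)
          then have "exp (- z * s) \<le> exp (- A / 2) * exp (- (z / 2) * s)"
            by (simp flip: exp_add)
          then show ?thesis using False gt
            by (simp add: ennreal_mult'[symmetric] ennreal_leI)
        qed
      qed simp
    qed
    also have "\<dots> = emeasure (interval_measure V) {-1<..A * t}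
      + ennreal (exp (- A / 2)) * (\<integral>\<^sup>+s\<in>{0..}. ennreal (exp (- (z / 2) * s)) \<partial>interval_measure V)"
      by (subst nn_integral_add) (auto simp: nn_integral_cmult)
    \<comment> \<open>Starting the interval at \<open>-1\<close>, where \<open>V\<close> vanishes,
      includes a possible atom of \<open>dV\<close> at 0.\<close>
    also have "emeasure (interval_measure V) {-1<..A * t} = ennreal (V (A * t))"
      using emeasure_interval_measure_Ioc[of "-1" "A * t" V] mono rc V0[of "-1"] At
      by simp
    also have "(\<integral>\<^sup>+s\<in>{0..}. ennreal (exp (- (z / 2) * s)) \<partial>interval_measure V) = ennreal (1 / ladder_exponent \<psi> (z / 2))"
      using z by (intro lap) simp
    also have "\<dots> \<le> ennreal (q * k)"
      using ladder_exponent_half[OF z] by (intro ennreal_leI) (simp add: q_def k_def)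
    finally have "ennreal k \<le> ennreal (V (A * t)) + ennreal (exp (- A / 2)) * ennreal (q * k)"
      by (simp add: mult_left_mono)
    also have "\<dots> = ennreal (V (A * t) + exp (- A / 2) * q * k)"
      using VA q k by (simp add: ennreal_mult'[symmetric] ennreal_plus[symmetric] mult.assoc del: ennreal_plus)
    finally have "k \<le> V (A * t) + exp (- A / 2) * q * k"
      using VA q k by (subst (asm) ennreal_le_iff) (auto intro!: add_nonneg_nonneg)
    then have "k / 2 \<le> V (A * t)" unfolding eA by simp
    moreover have "exp (- ln_const) / sqrt (\<psi> (1 / t\<^sup>2)) \<le> k"
    proof -
      have p: "\<psi> (1 / t\<^sup>2) > 0" using t by (intro pos) simp
      have "ladder_exponent \<psi> z \<le> exp ln_const * sqrt (\<psi> (1 / t\<^sup>2))"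
        using ladder_exponent_bounds(2)[OF z] by (simp add: z_def power_divide)
      then have "1 / (exp ln_const * sqrt (\<psi> (1 / t\<^sup>2))) \<le> k"
        unfolding k_def using p by (intro divide_left_mono mult_pos_pos) (auto simp: ladder_exponent_def)
      then show ?thesis by (simp add: exp_minus divide_inverse)
    qed
    ultimately show "exp (- ln_const) / 2 / sqrt (\<psi> (1 / t\<^sup>2)) \<le> V (A * t)" by simp
  qed simp
qed

end

section \<open>Regularization in Whitney balls\<close>

definition bump_base :: "'a::real_inner \<Rightarrow> real" where
  "bump_base z = max 0 (1 - (norm z)\<^sup>2)"

text \<open>Squaring the Lipschitz cutoff \<open>bump_base\<close> yields a Lipschitz gradient,
  which is what quadratic Taylor remainders require, and keeps all formulas polynomial.\<close>

definition bump :: "'a::real_inner \<Rightarrow> real" where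
  "bump z = (bump_base z)\<^sup>2"

definition bump_grad :: "'a::real_inner \<Rightarrow> 'a" where
  "bump_grad z = (- 4 * bump_base z) *\<^sub>R z"

lemma bump_base_bounds: "0 \<le> bump_base z" "bump_base z \<le> 1"
  by (auto simp: bump_base_def)

lemma bump_base_eq: "norm z \<le> 1 \<Longrightarrow> bump_base z = 1 - (norm z)\<^sup>2"
  by (simp add: bump_base_def power_le_one)

lemma bump_base_eq_0: "1 \<le> norm z \<Longrightarrow> bump_base z = 0"
  by (simp add: bump_base_def one_le_power)

text \<open>Inside the unit ball a difference of squares factors, with sum of norms at most 2; if
  only \<open>w\<close> is outside, the same factorization is used with 1 in place of its
  norm.\<close>

lemma bump_base_diff_le:
  fixes z w :: "'a::real_inner"
  shows "bump_base z - bump_base w \<le> 2 * norm (z - w)"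
proof (cases "norm z \<le> 1")
  case z: True
  have tri: "norm w - norm z \<le> norm (z - w)" using norm_triangle_ineq2[of w z] by (simp add: norm_minus_commute)
  show ?thesis
  proof (cases "norm w \<le> 1")
    case True
    have "(norm w + norm z) * (norm w - norm z) \<le> 2 * norm (z - w)"
    proof (cases "norm w \<ge> norm z")
      case le: True
      have "(norm w + norm z) * (norm w - norm z) \<le> 2 * (norm w - norm z)"
        using le z True by (intro mult_right_mono) auto
      also have "\<dots> \<le> 2 * norm (z - w)" using tri by simp
      finally show ?thesis .
    next
      case False
      then have "(norm w + norm z) * (norm w - norm z) \<le> 0"
        by (intro mult_nonneg_nonpos) auto
      then show ?thesis by (smt (verit) norm_ge_zero)
    qed
    then show ?thesis using z True by (simp add: bump_base_eq power2_eq_square algebra_simps)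
  next
    case False
    have "(1 + norm z) * (1 - norm z) \<le> 2 * (1 - norm z)" using z by (intro mult_right_mono) auto
    then show ?thesis using z False tri
      by (simp add: bump_base_eq bump_base_eq_0 power2_eq_square algebra_simps)
  qed
next
  case False
  then have "bump_base z = 0" by (simp add: bump_base_eq_0)
  then show ?thesis using bump_base_bounds(1)[of w] norm_ge_zero[of "z - w"] by linarith
qed

lemma bump_base_lipschitz:
  fixes z w :: "'a::real_inner"
  shows "\<bar>bump_base z - bump_base w\<bar> \<le> 2 * norm (z - w)"
  using bump_base_diff_le[of z w] bump_base_diff_le[of w z] by (simp add: norm_minus_commute abs_le_iff)

text \<open>Product rule for differences: \<open>12 = 4 * (1 + 2)\<close>, with 1 from the size of
  \<open>bump_base\<close> and 2 from its Lipschitz constant. The product estimate wants one point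
  in the unit ball; if neither is there, both gradients vanish.\<close>

lemma bump_grad_lipschitz:
  fixes z w :: "'a::real_inner"
  shows "norm (bump_grad w - bump_grad z) \<le> 12 * norm (w - z)"
proof -
  have aux: "norm (bump_base z *\<^sub>R z - bump_base w *\<^sub>R w) \<le> 3 * norm (z - w)" if "norm w \<le> 1" for z w :: 'a
  proof -
    have "bump_base z *\<^sub>R z - bump_base w *\<^sub>R w = bump_base z *\<^sub>R (z - w) + (bump_base z - bump_base w) *\<^sub>R w"
      by (simp add: algebra_simps)
    also have "norm \<dots> \<le> bump_base z * norm (z - w) + \<bar>bump_base z - bump_base w\<bar> * norm w"
      by (rule norm_triangle_le) (simp add: bump_base_bounds)
    also have "\<dots> \<le> 1 * norm (z - w) + (2 * norm (z - w)) * 1"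
      using that by (intro add_mono mult_mono bump_base_lipschitz) (auto simp: bump_base_bounds)
    finally show ?thesis by simp
  qed
  have "norm (bump_base z *\<^sub>R z - bump_base w *\<^sub>R w) \<le> 3 * norm (z - w)"
  proof (cases "norm w \<le> 1")
    case False
    show ?thesis
    proof (cases "norm z \<le> 1")
      case True
      then show ?thesis using aux[of z w] by (simp add: norm_minus_commute)
    qed (use False in \<open>simp add: bump_base_eq_0\<close>)
  qed (rule aux)
  moreover have "bump_grad w - bump_grad z = 4 *\<^sub>R (bump_base z *\<^sub>R z - bump_base w *\<^sub>R w)"
    by (simp add: bump_grad_def algebra_simps)
  ultimately show ?thesis by (simp add: norm_minus_commute)
qed

text \<open>Three positions relative to the unit sphere. If \<open>z\<close> is outside, value and
  gradient vanish at \<open>z\<close> and \<open>b \<le> 2 * N\<close>. If both points are inside,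
  the remainder is the polynomial \<open>(b - a)\<^sup>2 - 2 * a * N\<^sup>2\<close>. If only
  \<open>w\<close> is outside, \<open>a\<close> itself is at most \<open>2 * N\<close>, and
  \<open>a \<le> E\<close> controls the sign.\<close>

lemma bump_remainder:
  fixes z w :: "'a::real_inner"
  shows "\<bar>bump w - bump z - bump_grad z \<bullet> (w - z)\<bar> \<le> 10 * (norm (w - z))\<^sup>2"
proof -
  define a b N E where "a = bump_base z" and "b = bump_base w" and "N = norm (w - z)"
    and "E = (norm w)\<^sup>2 - (norm z)\<^sup>2"
  have ab: "0 \<le> a" "a \<le> 1" "0 \<le> b" "b \<le> 1" by (auto simp: a_def b_def bump_base_bounds)
  have N0: "N \<ge> 0" by (simp add: N_def)
  have lip: "\<bar>b - a\<bar> \<le> 2 * N" using bump_base_lipschitz[of w z] by (simp add: a_def b_def N_def)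
  have E: "E = 2 * (z \<bullet> (w - z)) + N\<^sup>2"
    unfolding E_def N_def power2_norm_eq_inner by (simp add: inner_diff inner_commute)
  have "bump w - bump z - bump_grad z \<bullet> (w - z) = b\<^sup>2 - a\<^sup>2 + 2 * a * (2 * (z \<bullet> (w - z)))"
    by (simp add: bump_def bump_grad_def a_def b_def)
  also have "2 * (z \<bullet> (w - z)) = E - N\<^sup>2" using E by simp
  finally have rem: "bump w - bump z - bump_grad z \<bullet> (w - z) = b\<^sup>2 - a\<^sup>2 + 2 * a * E - 2 * a * N\<^sup>2"
    by (simp add: right_diff_distrib)
  have sq: "(b - a)\<^sup>2 \<le> 4 * N\<^sup>2"
    using power_mono[OF lip, of 2] by (simp add: power_mult_distrib)
  have aN: "0 \<le> a * N\<^sup>2" "a * N\<^sup>2 \<le> N\<^sup>2" using ab by (auto simp: mult_left_le_one_le)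
  consider "1 \<le> norm z" | "norm z \<le> 1" "norm w \<le> 1" | "norm z \<le> 1" "1 \<le> norm w" by linarith
  then show ?thesis
  proof cases
    case 1
    then have "a = 0" by (simp add: a_def bump_base_eq_0)
    then have "bump w - bump z - bump_grad z \<bullet> (w - z) = b\<^sup>2" "b\<^sup>2 \<le> 4 * N\<^sup>2" using rem sq by auto
    then show ?thesis using zero_le_power2[of N] zero_le_power2[of b] unfolding N_def[symmetric] by linarith
  next
    case 2
    then have "E = a - b" by (simp add: a_def b_def E_def bump_base_eq)
    then have "bump w - bump z - bump_grad z \<bullet> (w - z) = b\<^sup>2 - a\<^sup>2 + 2 * a * (a - b) - 2 * a * N\<^sup>2"
      using rem by simp
    also have "\<dots> = (b - a)\<^sup>2 - 2 * (a * N\<^sup>2)"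
      by (simp add: power2_eq_square algebra_simps)
    finally show ?thesis unfolding N_def[symmetric] using sq aN zero_le_power2[of "b - a"] by linarith
  next
    case 3
    then have b: "b = 0" and a: "a = 1 - (norm z)\<^sup>2" by (auto simp: a_def b_def bump_base_eq bump_base_eq_0)
    have Ea: "a \<le> E" using 3 a one_le_power[of "norm w" 2] by (simp add: E_def)
    have aN2: "a \<le> 2 * N" using lip b by simp
    have "z \<bullet> (w - z) \<le> norm z * N" unfolding N_def by (rule norm_cauchy_schwarz)
    also have "\<dots> \<le> 1 * N" using 3 N0 by (intro mult_right_mono) auto
    finally have "E \<le> 2 * N + N\<^sup>2" using E by simp
    then have "a * E \<le> a * (2 * N + N\<^sup>2)" using ab by (intro mult_left_mono) auto
    also have "\<dots> \<le> 4 * N\<^sup>2 + a * N\<^sup>2"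
      using mult_right_mono[OF aN2 N0] by (simp add: algebra_simps power2_eq_square)
    finally have up: "a * E \<le> 4 * N\<^sup>2 + a * N\<^sup>2" .
    have lo: "a\<^sup>2 \<le> a * E" using Ea ab by (simp add: power2_eq_square mult_left_mono)
    have "bump w - bump z - bump_grad z \<bullet> (w - z) = 2 * (a * E) - a\<^sup>2 - 2 * (a * N\<^sup>2)"
      using rem b by simp
    then show ?thesis unfolding N_def[symmetric] using up lo aN zero_le_power2[of a] by linarith
  qed
qed

lemma bump_eq_0: "1 \<le> norm z \<Longrightarrow> bump z = 0"
  by (simp add: bump_def bump_base_eq_0)

lemma bump_grad_eq_0: "1 \<le> norm z \<Longrightarrow> bump_grad z = 0"
  by (simp add: bump_grad_def bump_base_eq_0)

lemma bump_bounds: "0 \<le> bump z" "bump z \<le> 1"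
  using bump_base_bounds[of z] by (auto simp: bump_def power_le_one)

lemma bump_ge_half:
  assumes "norm z \<le> 1 / 2"
  shows "1 / 2 \<le> bump z"
proof -
  have "(norm z)\<^sup>2 \<le> (1 / 2)\<^sup>2" using assms by (intro power_mono) auto
  then have "3 / 4 \<le> bump_base z" using assms by (simp add: bump_base_def power2_eq_square)
  then have "(3 / 4)\<^sup>2 \<le> bump z" unfolding bump_def by (intro power_mono) auto
  then show ?thesis by (simp add: power2_eq_square)
qed

lemma norm_bump_grad_le: "norm (bump_grad z) \<le> 4"
proof (cases "norm z \<le> 1")
  case True
  have "bump_base z * norm z \<le> 1 * 1" using True bump_base_bounds by (intro mult_mono) auto
  then show ?thesis by (simp add: bump_grad_def bump_base_bounds)
qed (simp add: bump_grad_eq_0)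

lemma bump_measurable[measurable]: "(bump :: 'a::euclidean_space \<Rightarrow> real) \<in> borel_measurable borel"
  unfolding bump_def bump_base_def by measurable

lemma bump_grad_measurable[measurable]: "(bump_grad :: 'a::euclidean_space \<Rightarrow> 'a) \<in> borel_measurable borel"
  unfolding bump_grad_def bump_base_def by measurable

section \<open>The weighted average of bumps: size, gradient and regularity\<close>

lemma integral_ball_bound:
  fixes g :: "'a::euclidean_space \<Rightarrow> 'b::{banach, second_countable_topology}"
  assumes [measurable]: "g \<in> borel_measurable borel" and R: "R \<ge> 0"
    and g: "\<And>p. norm (g p) \<le> c * indicator (ball x R) p"
  shows "integrable lborel g" "norm (\<integral>p. g p \<partial>lborel) \<le> c * (measure lborel (ball 0 1 :: 'a set) * R ^ DIM('a))"
proof -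
  have int: "integrable lborel (\<lambda>p. c * indicator (ball x R) p)"
    using emeasure_lborel_ball_finite[of x R] by (intro integrable_mult_right integrable_real_indicator) auto
  then show 1: "integrable lborel g"
    by (rule Bochner_Integration.integrable_bound) (use g in \<open>auto intro!: AE_I2 intro: order_trans[OF _ abs_ge_self]\<close>)
  have "norm (\<integral>p. g p \<partial>lborel) \<le> (\<integral>p. c * indicator (ball x R) p \<partial>lborel)"
    by (rule Bochner_Integration.integral_norm_bound_integral[OF 1 int g])
  also have "\<dots> = c * measure lborel (ball x R)" by simp
  also have "measure lborel (ball x R) = R ^ DIM('a) * measure lborel (ball 0 1 :: 'a set)"
    using R by (rule content_ball_conv_unit_ball)
  finally show "norm (\<integral>p. g p \<partial>lborel) \<le> c * (measure lborel (ball 0 1 :: 'a set) * R ^ DIM('a))"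
    by (simp add: mult_ac)
qed

lemma infdist_frontier_le_dist:
  fixes p x :: "'a::real_normed_vector"
  assumes "p \<in> \<Omega>" "x \<notin> \<Omega>"
  shows "infdist p (frontier \<Omega>) \<le> dist p x"
proof -
  have "closed_segment p x \<inter> frontier \<Omega> \<noteq> {}"
    using assms by (intro connected_Int_frontier) auto
  then obtain w where w: "w \<in> closed_segment p x" "w \<in> frontier \<Omega>" by auto
  have "infdist p (frontier \<Omega>) \<le> dist p w" by (rule infdist_le) fact
  also have "\<dots> \<le> dist p x" using segment_bound(1)[OF w(1)] by (simp add: dist_norm norm_minus_commute)
  finally show ?thesis .
qed

text \<open>An abstract decreasing profile \<open>U\<close> with doubling constant \<open>D\<close>;
  doubling makes \<open>U (\<delta> p)\<close> comparable to \<open>U (\<delta> x)\<close> whenever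
  the bump at \<open>p\<close> reaches \<open>x\<close>.\<close>

locale whitney =
  fixes \<Omega> :: "'a::euclidean_space set" and U :: "real \<Rightarrow> real" and D :: real
  assumes opn: "open \<Omega>" and frontier_ne: "frontier \<Omega> \<noteq> {}"
    and U_meas[measurable]: "U \<in> borel_measurable borel"
    and U_pos: "\<And>t. t > 0 \<Longrightarrow> U t > 0"
    and U_anti: "\<And>s t. 0 < s \<Longrightarrow> s \<le> t \<Longrightarrow> U t \<le> U s"
    and U_half: "\<And>t. t > 0 \<Longrightarrow> U (t / 2) \<le> D * U t"
begin

abbreviation \<delta> :: "'a \<Rightarrow> real" where "\<delta> \<equiv> bdist \<Omega>"

abbreviation zoom :: "'a \<Rightarrow> 'a \<Rightarrow> 'a" where "zoom p x \<equiv> (4 / \<delta> p) *\<^sub>R (x - p)"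

text \<open>The centres \<open>p\<close> whose bump reaches \<open>x\<close> fill a volume of order
  \<open>\<delta> x ^ DIM('a)\<close>; dividing by this power keeps the average of order
  \<open>U (\<delta> x)\<close>.\<close>

definition W :: "'a \<Rightarrow> real" where
  "W p = indicator \<Omega> p * U (\<delta> p) / \<delta> p ^ DIM('a)"

abbreviation uk :: "'a \<Rightarrow> 'a \<Rightarrow> real" where "uk p x \<equiv> W p * bump (zoom p x)"

abbreviation Gk :: "'a \<Rightarrow> 'a \<Rightarrow> 'a" where
  "Gk p x \<equiv> (W p * (4 / \<delta> p)) *\<^sub>R bump_grad (zoom p x)"

definition u :: "'a \<Rightarrow> real" where
  "u x = (\<integral>p. uk p x \<partial>lborel)"

text \<open>The average differentiated formally under the integral. It is identified as the gradient
  through the quadratic remainder estimate, without exchanging a limit with the integral.\<close>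

definition G :: "'a \<Rightarrow> 'a" where
  "G x = (\<integral>p. Gk p x \<partial>lborel)"

definition B :: real where "B = measure lborel (ball 0 1 :: 'a set)"

lemma B_pos: "B > 0" by (simp add: B_def)

lemma \<delta>_pos: "p \<in> \<Omega> \<Longrightarrow> \<delta> p > 0"
  using frontier_ne opn by (intro infdist_pos_not_in_closed) (auto simp: frontier_def interior_open)

lemma \<delta>_lip: "\<delta> p \<le> \<delta> x + dist p x"
  by (rule infdist_triangle)

lemma ball_subset: "p \<in> \<Omega> \<Longrightarrow> dist p x < \<delta> p \<Longrightarrow> x \<in> \<Omega>"
  using infdist_frontier_le_dist[of p \<Omega> x] by force

lemma D_pos: "D > 0"
  using U_half[of 1] U_pos[of 1] U_pos[of "1/2"] by (smt (verit) mult_nonpos_nonneg half_gt_zero)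

lemma \<delta>_meas[measurable]: "\<delta> \<in> borel_measurable borel"
  by (intro borel_measurable_continuous_onI continuous_intros)

lemma W_meas[measurable]: "W \<in> borel_measurable borel"
proof -
  have [measurable]: "\<Omega> \<in> sets borel" using opn by simp
  show ?thesis unfolding W_def by measurable
qed

lemma W_nonneg: "0 \<le> W p"
  using U_pos[OF \<delta>_pos] \<delta>_pos by (auto simp: W_def indicator_def less_imp_le)

lemma W_outside: "p \<notin> \<Omega> \<Longrightarrow> W p = 0" by (simp add: W_def)

lemma W_le:
  assumes "x \<in> \<Omega>" "\<delta> x / 2 \<le> \<delta> p"
  shows "W p \<le> U (\<delta> x / 2) / (\<delta> x / 2) ^ DIM('a)"
proof (cases "p \<in> \<Omega>")
  case True
  have "\<delta> x / 2 > 0" using \<delta>_pos[OF assms(1)] by simp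
  then have "U (\<delta> p) / \<delta> p ^ DIM('a) \<le> U (\<delta> x / 2) / (\<delta> x / 2) ^ DIM('a)"
    using assms(2) U_pos[of "\<delta> x / 2"] by (intro frac_le U_anti power_mono zero_less_power) auto
  then show ?thesis using True by (simp add: W_def)
next
  case False
  then show ?thesis using \<delta>_pos[OF assms(1)] U_pos[of "\<delta> x / 2"] by (simp add: W_def)
qed

text \<open>The bump has radius \<open>\<delta> p / 4\<close> and the distance function is
  1-Lipschitz, whence \<open>\<delta> x \<le> 5 / 4 * \<delta> p\<close> and
  \<open>\<delta> p \<le> 4 / 3 * \<delta> x\<close>.\<close>

lemma support:
  assumes "p \<in> \<Omega>" "norm (zoom p x) < 1"
  shows "x \<in> \<Omega>" "4 / 5 * \<delta> x \<le> \<delta> p" "dist x p < \<delta> x / 3"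
proof -
  have \<delta>: "\<delta> p > 0" by (rule \<delta>_pos) fact
  have "4 / \<delta> p * norm (x - p) < 1" using assms(2) \<delta> by simp
  then have d: "dist x p < \<delta> p / 4" using \<delta> by (simp add: dist_norm field_simps)
  then show "x \<in> \<Omega>" using \<delta> by (intro ball_subset[OF assms(1)]) (simp add: dist_commute)
  show "4 / 5 * \<delta> x \<le> \<delta> p" using d \<delta>_lip[of x p] by linarith
  show "dist x p < \<delta> x / 3" using d \<delta>_lip[of p x] by (simp add: dist_commute)
qed

lemma u_outside:
  assumes "x \<notin> \<Omega>"
  shows "u x = 0"
proof -
  have "uk p x = 0" for p
  proof (cases "p \<in> \<Omega>")
    case True
    then have "1 \<le> norm (zoom p x)" using support(1)[of p x] assms by force
    then show ?thesis by (simp add: bump_eq_0)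
  qed (simp add: W_outside)
  then show ?thesis unfolding u_def by (simp only: Bochner_Integration.integral_zero)
qed

lemma u_measurable[measurable]: "u \<in> borel_measurable borel"
  unfolding u_def[abs_def] by measurable

text \<open>Bound for \<open>W p\<close> over all \<open>p\<close> with
  \<open>\<delta> p \<ge> \<delta> x / 2\<close>; these include the centres of all bumps that reach
  \<open>x\<close> or a point within \<open>\<delta> x / 4\<close> of it.\<close>

definition c0 :: "'a \<Rightarrow> real" where "c0 x = U (\<delta> x / 2) / (\<delta> x / 2) ^ DIM('a)"

lemma c0_nonneg: "x \<in> \<Omega> \<Longrightarrow> 0 \<le> c0 x"
  using \<delta>_pos[of x] U_pos[of "\<delta> x / 2"] by (simp add: c0_def)

lemma c0_volume:
  assumes "x \<in> \<Omega>"
  shows "c0 x * (B * \<delta> x ^ DIM('a)) \<le> B * 2 ^ DIM('a) * D * U (\<delta> x)"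
proof -
  have "c0 x * (B * \<delta> x ^ DIM('a)) = B * 2 ^ DIM('a) * U (\<delta> x / 2)"
    using \<delta>_pos[OF assms] by (simp add: c0_def power_divide)
  also have "\<dots> \<le> B * 2 ^ DIM('a) * (D * U (\<delta> x))"
    using B_pos \<delta>_pos[OF assms] by (intro mult_left_mono U_half) auto
  finally show ?thesis by simp
qed

text \<open>A bump centred at \<open>p\<close> meets \<open>x\<close>, or a
  point \<open>y\<close> near \<open>x\<close>, only if \<open>\<delta> p\<close> is comparable to \<open>\<delta> x\<close>.\<close>

lemma integral_W_bound:
  fixes g :: "'a \<Rightarrow> 'b::{banach, second_countable_topology}"
  assumes x: "x \<in> \<Omega>" and y: "dist y x \<le> \<delta> x / 4" and [measurable]: "g \<in> borel_measurable borel"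
    and g0: "\<And>p. p \<in> \<Omega> \<Longrightarrow> 1 \<le> norm (zoom p x) \<Longrightarrow> 1 \<le> norm (zoom p y) \<Longrightarrow> g p = 0"
    and g: "\<And>p. p \<in> \<Omega> \<Longrightarrow> \<delta> x / 2 \<le> \<delta> p \<Longrightarrow> norm (g p) \<le> W p * k"
    and out: "\<And>p. p \<notin> \<Omega> \<Longrightarrow> g p = 0" and k: "k \<ge> 0"
  shows "integrable lborel g" "norm (\<integral>p. g p \<partial>lborel) \<le> B * 2 ^ DIM('a) * D * U (\<delta> x) * k"
proof -
  have pw: "norm (g p) \<le> (c0 x * k) * indicator (ball x (\<delta> x)) p" for p
  proof (cases "g p = 0")
    case True
    then show ?thesis using c0_nonneg[OF x] k by simp
  next
    case False
    then have p: "p \<in> \<Omega>" using out by auto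
    have dx: "\<delta> x > 0" by (rule \<delta>_pos) fact
    have "norm (zoom p x) < 1 \<or> norm (zoom p y) < 1"
      using False g0[OF p] by force
    then have "\<delta> x / 2 \<le> \<delta> p \<and> dist x p < \<delta> x"
    proof
      assume "norm (zoom p x) < 1"
      from support(2,3)[OF p this] dx show ?thesis by linarith
    next
      assume "norm (zoom p y) < 1"
      note s = support(2,3)[OF p this]
      \<comment> \<open>Here \<open>\<delta> y\<close> is between 3/4 and 5/4 of
        \<open>\<delta> x\<close>, so \<open>\<delta> p\<close> is at least 3/5 of
        \<open>\<delta> x\<close> and \<open>dist x p\<close> is at most 2/3 of it.\<close>
      have "\<delta> x - dist y x \<le> \<delta> y" "\<delta> y \<le> \<delta> x + dist y x"
        using \<delta>_lip[of x y] \<delta>_lip[of y x] by (auto simp: dist_commute)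
      moreover have "dist x p \<le> dist y x + dist y p" using dist_triangle3[of x p y] by simp
      ultimately show ?thesis using s y dx by linarith
    qed
    moreover from this have "norm (g p) \<le> c0 x * k"
      using g[OF p] W_le[OF x, of p] k unfolding c0_def by (meson mult_right_mono order_trans)
    ultimately show ?thesis by (simp add: indicator_def)
  qed
  have dx: "0 \<le> \<delta> x" by (rule infdist_nonneg)
  show "integrable lborel g" by (rule integral_ball_bound(1)[OF _ dx pw]) measurable
  have "norm (\<integral>p. g p \<partial>lborel) \<le> c0 x * k * (B * \<delta> x ^ DIM('a))"
    unfolding B_def by (rule integral_ball_bound(2)[OF _ dx pw]) measurable
  also have "\<dots> = c0 x * (B * \<delta> x ^ DIM('a)) * k" by simp
  also have "\<dots> \<le> B * 2 ^ DIM('a) * D * U (\<delta> x) * k"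
    using k by (intro mult_right_mono c0_volume x)
  finally show "norm (\<integral>p. g p \<partial>lborel) \<le> B * 2 ^ DIM('a) * D * U (\<delta> x) * k" .
qed

definition C :: real where "C = B * 2 ^ DIM('a) * D"

lemma C_pos: "C > 0" using B_pos D_pos by (simp add: C_def)

lemma u_integrable_upper:
  assumes x: "x \<in> \<Omega>"
  shows "integrable lborel (\<lambda>p. uk p x)" "u x \<le> C * U (\<delta> x)"
proof -
  have "norm (uk p x) \<le> W p * 1" for p
    using W_nonneg[of p] bump_bounds[of "zoom p x"] by (simp add: abs_mult mult_left_le)
  note * = integral_W_bound[of x x "\<lambda>p. uk p x" 1, OF x _ _ _ this]
  show "integrable lborel (\<lambda>p. uk p x)"
    by (rule *(1)) (auto simp: bump_eq_0 W_outside infdist_nonneg)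
  have "norm (u x) \<le> B * 2 ^ DIM('a) * D * U (\<delta> x) * 1"
    unfolding u_def by (rule *(2)) (auto simp: bump_eq_0 W_outside infdist_nonneg)
  then show "u x \<le> C * U (\<delta> x)" by (simp add: C_def)
qed

text \<open>The factor 32 is the scale bound \<open>4 / \<delta> p \<le> 8 / \<delta> x\<close>
  times the bound 4 for the gradient of a bump.\<close>

lemma G_integrable_bound:
  assumes x: "x \<in> \<Omega>"
  shows "integrable lborel (\<lambda>p. Gk p x)"
    "norm (G x) \<le> C * 32 * U (\<delta> x) / \<delta> x"
proof -
  have dx: "\<delta> x > 0" by (rule \<delta>_pos) fact
  have "norm (Gk p x) \<le> W p * (32 / \<delta> x)"
    if "\<delta> x / 2 \<le> \<delta> p" for p
  proof -
    have "4 / \<delta> p \<le> 8 / \<delta> x" using that dx by (simp add: field_simps)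
    moreover have "0 \<le> 4 / \<delta> p" using infdist_nonneg[of p] by simp
    ultimately have "(4 / \<delta> p) * norm (bump_grad (zoom p x)) \<le> (8 / \<delta> x) * 4"
      using dx norm_bump_grad_le by (intro mult_mono) auto
    then show ?thesis using W_nonneg[of p] infdist_nonneg[of p "frontier \<Omega>"]
      by (simp add: abs_mult mult.assoc mult_left_mono del: times_divide_eq_left times_divide_eq_right)
  qed
  note * = integral_W_bound[of x x "\<lambda>p. Gk p x" "32 / \<delta> x", OF x _ _ _ this]
  show "integrable lborel (\<lambda>p. Gk p x)"
    by (rule *(1)) (auto simp: bump_grad_eq_0 W_outside infdist_nonneg)
  have "norm (G x) \<le> B * 2 ^ DIM('a) * D * U (\<delta> x) * (32 / \<delta> x)"
    unfolding G_def by (rule *(2)) (auto simp: bump_grad_eq_0 W_outside infdist_nonneg)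
  then show "norm (G x) \<le> C * 32 * U (\<delta> x) / \<delta> x" by (simp add: C_def mult_ac)
qed

text \<open>Centres within \<open>\<delta> x / 10\<close> of \<open>x\<close> have \<open>x\<close>
  in the inner half of their bump, the zoomed distance being at most 4/9. For them
  \<open>\<delta> p \<le> 2 * \<delta> x\<close>, which bounds \<open>W p\<close> from below;
  \<open>20 = 2 * 10\<close> collects both factors.\<close>

lemma u_lower:
  assumes x: "x \<in> \<Omega>"
  shows "B / (2 * 20 ^ DIM('a) * D) * U (\<delta> x) \<le> u x"
proof -
  have dx: "\<delta> x > 0" by (rule \<delta>_pos) fact
  define c where "c = U (2 * \<delta> x) / (2 * \<delta> x) ^ DIM('a) / 2"
  have c0: "c \<ge> 0" using dx U_pos[of "2 * \<delta> x"] by (simp add: c_def)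
  have pw: "c * indicator (ball x (\<delta> x / 10)) p \<le> uk p x" for p
  proof (cases "dist x p < \<delta> x / 10")
    case True
    have p: "p \<in> \<Omega>" using True dx by (intro ball_subset[OF x]) auto
    have dp: "9 / 10 * \<delta> x \<le> \<delta> p" "\<delta> p \<le> 11 / 10 * \<delta> x"
      using \<delta>_lip[of x p] \<delta>_lip[of p x] True by (auto simp: dist_commute)
    then have dp0: "\<delta> p > 0" using dx by linarith
    have "norm (zoom p x) = 4 * dist x p / \<delta> p" using dp0 by (simp add: dist_norm)
    also have "\<dots> \<le> 1 / 2" using True dp dp0 by (simp add: field_simps)
    finally have b: "1 / 2 \<le> bump (zoom p x)" by (rule bump_ge_half)
    have "U (2 * \<delta> x) / (2 * \<delta> x) ^ DIM('a) \<le> U (\<delta> p) / \<delta> p ^ DIM('a)"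
      using dp dp0 dx U_pos[OF dp0] by (intro frac_le U_anti power_mono zero_less_power) auto
    then have "U (2 * \<delta> x) / (2 * \<delta> x) ^ DIM('a) \<le> W p" using p by (simp add: W_def)
    then have "U (2 * \<delta> x) / (2 * \<delta> x) ^ DIM('a) * (1 / 2) \<le> uk p x"
      using b W_nonneg[of p] by (intro mult_mono) auto
    then show ?thesis using True by (simp add: c_def)
  next
    case False
    have "0 \<le> uk p x" by (intro mult_nonneg_nonneg W_nonneg bump_bounds)
    then show ?thesis using False by simp
  qed
  have "U (\<delta> x) \<le> D * U (2 * \<delta> x)" using U_half[of "2 * \<delta> x"] dx by simp
  then have "B / (2 * 20 ^ DIM('a) * D) * U (\<delta> x) \<le> B / (2 * 20 ^ DIM('a) * D) * (D * U (2 * \<delta> x))"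
    using B_pos D_pos by (intro mult_left_mono) auto
  also have "\<dots> = c * (B * (\<delta> x / 10) ^ DIM('a))"
  proof -
    have "(20 :: real) ^ DIM('a) = 2 ^ DIM('a) * 10 ^ DIM('a)" by (simp flip: power_mult_distrib)
    then show ?thesis using dx D_pos by (simp add: c_def power_divide power_mult_distrib mult_ac)
  qed
  also have "\<dots> = (\<integral>p. c * indicator (ball x (\<delta> x / 10)) p \<partial>lborel)"
  proof -
    have "measure lborel (ball x (\<delta> x / 10)) = (\<delta> x / 10) ^ DIM('a) * B"
      unfolding B_def using dx by (intro content_ball_conv_unit_ball) simp
    then show ?thesis by simp
  qed
  also have "\<dots> \<le> u x"
    unfolding u_def using emeasure_lborel_ball_finite[of x "\<delta> x / 10"]
    by (intro integral_mono u_integrable_upper x pw integrable_mult_right integrable_real_indicator) auto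
  finally show ?thesis .
qed

lemma near_in_\<Omega>:
  assumes "x \<in> \<Omega>" "dist y x \<le> \<delta> x / 4"
  shows "y \<in> \<Omega>"
  using assms \<delta>_pos[OF assms(1)] by (intro ball_subset[OF assms(1)]) (auto simp: dist_commute)

lemma scale_le:
  assumes "x \<in> \<Omega>" "\<delta> x / 2 \<le> \<delta> p"
  shows "(4 / \<delta> p)\<^sup>2 \<le> 64 / (\<delta> x)\<^sup>2"
proof -
  have dx: "\<delta> x > 0" by (rule \<delta>_pos) fact
  then have "4 / \<delta> p \<le> 8 / \<delta> x" using assms by (simp add: field_simps)
  then have "(4 / \<delta> p)\<^sup>2 \<le> (8 / \<delta> x)\<^sup>2" by (intro power_mono) (auto simp: infdist_nonneg)
  then show ?thesis by (simp add: power_divide)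
qed

text \<open>The remainder estimate of a single bump is applied in zoomed coordinates under the
  integral; \<open>640 = 10 * 64\<close>, where 64 bounds
  \<open>(4 / \<delta> p)\<^sup>2 * (\<delta> x)\<^sup>2\<close>.\<close>

lemma u_remainder:
  assumes x: "x \<in> \<Omega>" and y: "dist y x \<le> \<delta> x / 4"
  shows "\<bar>u y - u x - G x \<bullet> (y - x)\<bar> \<le> C * 640 * U (\<delta> x) / (\<delta> x)\<^sup>2 * (norm (y - x))\<^sup>2"
proof -
  define g where "g p = uk p y - uk p x
    - (Gk p x) \<bullet> (y - x)" for p
  have g_eq: "g p = W p * (bump (zoom p y) - bump (zoom p x)
    - bump_grad (zoom p x) \<bullet> (zoom p y - zoom p x))" for p
  proof -
    have "zoom p y - zoom p x = (4 / \<delta> p) *\<^sub>R (y - x)"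
      by (simp flip: scaleR_diff_right)
    then show ?thesis by (simp add: g_def algebra_simps)
  qed
  have "u y - u x - G x \<bullet> (y - x) = (\<integral>p. g p \<partial>lborel)"
    unfolding g_def u_def G_def
    using u_integrable_upper(1)[OF x] u_integrable_upper(1)[OF near_in_\<Omega>[OF x y]] G_integrable_bound(1)[OF x]
    by (simp only: Bochner_Integration.integral_diff Bochner_Integration.integrable_diff
      integral_inner_left[symmetric] integrable_inner_left)
  moreover have "norm (\<integral>p. g p \<partial>lborel) \<le> B * 2 ^ DIM('a) * D * U (\<delta> x) * (640 / (\<delta> x)\<^sup>2 * (norm (y - x))\<^sup>2)"
  proof (rule integral_W_bound(2)[OF x y])
    show "g \<in> borel_measurable borel" unfolding g_def by measurable
    show "g p = 0" if "1 \<le> norm (zoom p x)" "1 \<le> norm (zoom p y)" for p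
      unfolding g_def using that by (simp add: bump_eq_0 bump_grad_eq_0)
    show "g p = 0" if "p \<notin> \<Omega>" for p unfolding g_def using that by (simp add: W_outside)
    show "norm (g p) \<le> W p * (640 / (\<delta> x)\<^sup>2 * (norm (y - x))\<^sup>2)" if "\<delta> x / 2 \<le> \<delta> p" for p
    proof -
      have "norm (g p) \<le> W p * (10 * (norm (zoom p y - zoom p x))\<^sup>2)"
        unfolding g_eq real_norm_def abs_mult abs_of_nonneg[OF W_nonneg]
        by (intro mult_left_mono bump_remainder W_nonneg)
      also have "norm (zoom p y - zoom p x) = 4 / \<delta> p * norm (y - x)"
        by (simp add: infdist_nonneg flip: scaleR_diff_right)
      also have "10 * (4 / \<delta> p * norm (y - x))\<^sup>2 = 10 * (4 / \<delta> p)\<^sup>2 * (norm (y - x))\<^sup>2"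
        by (simp only: power_mult_distrib mult.assoc)
      also have "W p * \<dots> \<le> W p * (10 * (64 / (\<delta> x)\<^sup>2) * (norm (y - x))\<^sup>2)"
        using scale_le[OF x that] by (intro mult_left_mono mult_right_mono W_nonneg) auto
      finally show ?thesis by simp
    qed
  qed simp
  ultimately show ?thesis by (simp add: C_def mult_ac)
qed

lemma G_lipschitz:
  assumes x: "x \<in> \<Omega>" and y: "dist y x \<le> \<delta> x / 4"
  shows "norm (G y - G x) \<le> C * 768 * U (\<delta> x) / (\<delta> x)\<^sup>2 * norm (y - x)"
proof -
  define g where "g p = Gk p y
    - Gk p x" for p
  have "G y - G x = (\<integral>p. g p \<partial>lborel)"
    unfolding g_def G_def
    using G_integrable_bound(1)[OF near_in_\<Omega>[OF x y]] G_integrable_bound(1)[OF x]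
    by (simp add: Bochner_Integration.integral_diff)
  moreover have "norm (\<integral>p. g p \<partial>lborel) \<le> B * 2 ^ DIM('a) * D * U (\<delta> x) * (768 / (\<delta> x)\<^sup>2 * norm (y - x))"
  proof (rule integral_W_bound(2)[OF x y])
    show "g \<in> borel_measurable borel" unfolding g_def by measurable
    show "g p = 0" if "1 \<le> norm (zoom p x)" "1 \<le> norm (zoom p y)" for p
      unfolding g_def using that by (simp add: bump_grad_eq_0)
    show "g p = 0" if "p \<notin> \<Omega>" for p unfolding g_def using that by (simp add: W_outside)
    show "norm (g p) \<le> W p * (768 / (\<delta> x)\<^sup>2 * norm (y - x))" if "\<delta> x / 2 \<le> \<delta> p" for p
    proof -
      have "norm (g p) = W p * (4 / \<delta> p * norm (bump_grad (zoom p y) - bump_grad (zoom p x)))"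
        unfolding g_def scaleR_diff_right[symmetric] norm_scaleR abs_mult abs_of_nonneg[OF W_nonneg]
        by (simp add: infdist_nonneg)
      also have "\<dots> \<le> W p * (4 / \<delta> p * (12 * norm (zoom p y - zoom p x)))"
        by (intro mult_left_mono bump_grad_lipschitz W_nonneg) (simp add: infdist_nonneg)
      also have "norm (zoom p y - zoom p x) = 4 / \<delta> p * norm (y - x)"
        by (simp add: infdist_nonneg flip: scaleR_diff_right)
      also have "4 / \<delta> p * (12 * (4 / \<delta> p * norm (y - x))) = 12 * (4 / \<delta> p)\<^sup>2 * norm (y - x)"
        by (simp add: power2_eq_square)
      also have "W p * \<dots> \<le> W p * (12 * (64 / (\<delta> x)\<^sup>2) * norm (y - x))"
        using scale_le[OF x that] by (intro mult_left_mono mult_right_mono W_nonneg) auto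
      finally show ?thesis by simp
    qed
  qed simp
  ultimately show ?thesis by (simp add: C_def mult_ac)
qed

lemma gderiv_u:
  assumes x: "x \<in> \<Omega>"
  shows "GDERIV u x :> G x"
proof -
  have dx: "\<delta> x > 0" by (rule \<delta>_pos) fact
  define K where "K = C * 640 * U (\<delta> x) / (\<delta> x)\<^sup>2"
  have K: "K \<ge> 0" using C_pos U_pos[OF dx] by (simp add: K_def)
  show ?thesis unfolding gderiv_def has_derivative_at'
  proof (intro conjI allI impI)
    show "bounded_linear (\<lambda>h. h \<bullet> G x)" by (rule bounded_linear_inner_left)
    fix e :: real assume e: "e > 0"
    show "\<exists>d>0. \<forall>x'. 0 < norm (x' - x) \<and> norm (x' - x) < d \<longrightarrow>
      norm (u x' - u x - (x' - x) \<bullet> G x) / norm (x' - x) < e"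
    proof (intro exI[of _ "min (\<delta> x / 4) (e / (K + 1))"] conjI allI impI)
      show "0 < min (\<delta> x / 4) (e / (K + 1))" using dx e K by simp
      fix y assume y: "0 < norm (y - x) \<and> norm (y - x) < min (\<delta> x / 4) (e / (K + 1))"
      have "\<bar>u y - u x - G x \<bullet> (y - x)\<bar> \<le> K * (norm (y - x))\<^sup>2"
        unfolding K_def using y by (intro u_remainder x) (simp add: dist_norm)
      then have "norm (u y - u x - (y - x) \<bullet> G x) / norm (y - x) \<le> K * norm (y - x)"
        using y by (simp add: inner_commute power2_eq_square pos_divide_le_eq mult.assoc)
      also have "\<dots> \<le> (K + 1) * norm (y - x)" by (intro mult_right_mono) auto
      also have "\<dots> < e" using y K by (simp add: field_simps)
      finally show "norm (u y - u x - (y - x) \<bullet> G x) / norm (y - x) < e" .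
    qed
  qed
qed

lemma u_locally_C11: "locally_C11_on \<Omega> u"
  unfolding locally_C11_on_def
proof (intro exI[of _ G] conjI ballI allI impI gderiv_u)
  fix K assume K: "compact K \<and> K \<subseteq> \<Omega>"
  show "\<exists>L. L-lipschitz_on K G"
  proof (cases "K = {}")
    case False
    obtain x0 where x0: "x0 \<in> K" "\<And>x. x \<in> K \<Longrightarrow> \<delta> x0 \<le> \<delta> x"
      using continuous_attains_inf[of K \<delta>] K False continuous_on_infdist[OF continuous_on_id, of K "frontier \<Omega>"]
      by auto
    define d where "d = \<delta> x0"
    have d: "d > 0" unfolding d_def using x0 K by (intro \<delta>_pos) auto
    define L1 where "L1 = C * 768 * U d / d\<^sup>2"
    \<comment> \<open>\<open>L2\<close> serves pairs farther apart than \<open>d / 4\<close>, for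
      which the uniform bound of \<open>G\<close> on \<open>K\<close>, divided by the distance,
      replaces the local estimate.\<close>
    define L2 where "L2 = C * 256 * U d / d\<^sup>2"
    have L: "L1 \<ge> 0" "L2 \<ge> 0" using C_pos U_pos[OF d] by (auto simp: L1_def L2_def)
    have Gb: "norm (G x) \<le> C * 32 * U d / d" if "x \<in> K" for x
    proof -
      have x: "x \<in> \<Omega>" "d \<le> \<delta> x" using that K x0 by (auto simp: d_def)
      have "norm (G x) \<le> C * 32 * U (\<delta> x) / \<delta> x" by (rule G_integrable_bound) fact
      also have "\<dots> \<le> C * 32 * U d / d"
        using C_pos d x U_pos[OF d] by (intro frac_le mult_left_mono U_anti mult_nonneg_nonneg) auto
      finally show ?thesis .
    qed
    have "dist (G x) (G y) \<le> (L1 + L2) * dist x y" if xy: "x \<in> K" "y \<in> K" for x y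
    proof (cases "dist x y \<le> d / 4")
      case True
      have x: "x \<in> \<Omega>" "d \<le> \<delta> x" using xy K x0 by (auto simp: d_def)
      have "dist (G x) (G y) = norm (G y - G x)" by (simp add: dist_norm norm_minus_commute)
      also have "\<dots> \<le> C * 768 * U (\<delta> x) / (\<delta> x)\<^sup>2 * norm (y - x)"
        using True x by (intro G_lipschitz) (auto simp: dist_commute)
      also have "\<dots> \<le> L1 * norm (y - x)" unfolding L1_def
        using C_pos d x U_pos[OF d] by (intro mult_right_mono frac_le mult_left_mono U_anti mult_nonneg_nonneg power_mono) auto
      also have "\<dots> \<le> (L1 + L2) * norm (y - x)" using L by (intro mult_right_mono) auto
      finally show ?thesis by (simp add: dist_norm norm_minus_commute)
    next
      case False
      have "dist (G x) (G y) \<le> norm (G x) + norm (G y)" unfolding dist_norm by (rule norm_triangle_ineq4)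
      also have "\<dots> \<le> 2 * (C * 32 * U d / d)" using Gb[OF xy(1)] Gb[OF xy(2)] by simp
      also have "\<dots> = L2 * (d / 4)" using d by (simp add: L2_def power2_eq_square)
      also have "\<dots> \<le> L2 * dist x y" using False L by (intro mult_left_mono) auto
      also have "\<dots> \<le> (L1 + L2) * dist x y" using L by (intro mult_right_mono) auto
      finally show ?thesis .
    qed
    then have "(L1 + L2)-lipschitz_on K G" using L by (intro lipschitz_onI) auto
    then show ?thesis by blast
  qed auto
qed

end

section \<open>Estimates for the operator\<close>

lemma nn_integral_lborel_translate:
  fixes g :: "'a::euclidean_space \<Rightarrow> ennreal"
  assumes [measurable]: "g \<in> borel_measurable borel"
  shows "(\<integral>\<^sup>+y. g (y - x) \<partial>lborel) = (\<integral>\<^sup>+z. g z \<partial>lborel)"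
proof -
  have "(\<integral>\<^sup>+z. g z \<partial>lborel) = (\<integral>\<^sup>+z. g z \<partial>(distr lborel borel ((+) (- x))))"
    by (simp add: lborel_distr_plus)
  also have "\<dots> = (\<integral>\<^sup>+y. g (- x + y) \<partial>lborel)" by (subst nn_integral_distr) auto
  finally show ?thesis by simp
qed

lemma integral_odd_eq_0:
  fixes q :: "'a::euclidean_space \<Rightarrow> real"
  assumes q[measurable]: "q \<in> borel_measurable borel" and odd: "\<And>y. q (2 *\<^sub>R x - y) = - q y"
  shows "(\<integral>y. q y \<partial>lborel) = 0"
proof -
  have "lborel = distr lborel borel (\<lambda>y. 2 *\<^sub>R x - y)"
    using lborel_affine[of "-1" "2 *\<^sub>R x"] by (simp add: density_1)
  then have "(\<integral>y. q y \<partial>lborel) = (\<integral>y. q y \<partial>(distr lborel borel (\<lambda>y. 2 *\<^sub>R x - y)))" by simp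
  also have "\<dots> = (\<integral>y. q (2 *\<^sub>R x - y) \<partial>lborel)" by (subst integral_distr) auto
  also have "\<dots> = - (\<integral>y. q y \<partial>lborel)" by (simp add: odd)
  finally show ?thesis by simp
qed

lemma has_L_cmult:
  assumes "has_L \<nu> u x l"
  shows "has_L \<nu> (\<lambda>y. c * u y) x (c * l)"
proof -
  have eq: "(c * u y - c * u x) * jump_density DIM('a) \<nu> (dist y x) = c * ((u y - u x) * jump_density DIM('a) \<nu> (dist y x))"
    for y :: 'a by (simp add: algebra_simps)
  show ?thesis using assms unfolding has_L_def eq
    by (auto intro!: tendsto_mult_left set_integrable_mult_right simp del: set_integrable_mult_right_iff)
qed

text \<open>Two inputs meet: \<open>layer\<close> carries the geometry of the boundary, and
  \<open>dyadic\<close> is the discrete Keller-Osserman condition, in which \<open>1 / 2 ^ k\<close>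
  stands for the relative thickness of a layer.\<close>

locale barrier = levy_density \<phi> \<nu> + whitney \<Omega> U D
  for \<phi> \<nu> U :: "real \<Rightarrow> real" and \<Omega> :: "'a::euclidean_space set" and D :: real +
  fixes Cm r0 Cs :: real
  assumes bounded: "bounded \<Omega>"
    and Cm_pos: "Cm > 0"
    and layer: "\<And>x t \<rho>. 0 < t \<Longrightarrow> t \<le> \<rho> \<Longrightarrow>
      measure lborel {y \<in> \<Omega>. bdist \<Omega> y < t \<and> dist x y < \<rho>} \<le> Cm * t * \<rho> ^ (DIM('a) - 1)"
    and r0_pos: "r0 > 0"
    and dyadic: "\<And>r n. 0 < r \<Longrightarrow> r \<le> r0 \<Longrightarrow> (\<Sum>k<n. (U (r / 2 ^ Suc k) - U (r / 2 ^ k)) / 2 ^ k) \<le> Cs * U r"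
begin

abbreviation kernel :: "'a \<Rightarrow> 'a \<Rightarrow> real" where "kernel x y \<equiv> jump_density DIM('a) \<nu> (dist y x)"

lemma \<Omega>_meas[measurable]: "\<Omega> \<in> sets borel"
  using opn by simp

definition Cj :: real where
  "Cj = gauss_const (DIM('a) + 3) * measure lborel (ball 0 1 :: 'a set) * 2 ^ (DIM('a) + 3)"

definition Ck :: real where "Ck = 2 * gauss_const (DIM('a) + 2)"

lemma Cj_nonneg: "Cj \<ge> 0" and Ck_pos: "Ck > 0"
  using gauss_const_pos[of "DIM('a) + 3"] gauss_const_pos[of "DIM('a) + 2"] by (auto simp: Cj_def Ck_def)

lemma Cs_nonneg: "Cs \<ge> 0"
proof -
  have "U (r0 / 2 ^ 0) \<le> U (r0 / 2 ^ Suc 0)" using r0_pos by (intro U_anti) auto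
  then have "0 \<le> Cs * U r0" using dyadic[of r0 1] r0_pos by simp
  then show ?thesis using U_pos[OF r0_pos] by (simp add: zero_le_mult_iff)
qed

lemma nn_integral_min_j:
  fixes x :: 'a
  assumes r: "r > 0"
  shows "(\<integral>\<^sup>+y. ennreal (min 1 ((dist y x)\<^sup>2 / r\<^sup>2) * kernel x y) \<partial>lborel) \<le> ennreal (Cj * \<phi> (1 / r\<^sup>2))"
proof -
  have "(\<integral>\<^sup>+y. ennreal (min 1 ((dist y x)\<^sup>2 / r\<^sup>2) * kernel x y) \<partial>lborel)
    = (\<integral>\<^sup>+(z::'a). ennreal (min 1 ((norm z)\<^sup>2 / r\<^sup>2) * jump_density DIM('a) \<nu> (norm z)) \<partial>lborel)"
    unfolding dist_norm
    by (rule nn_integral_lborel_translate[of "\<lambda>z. ennreal (min 1 ((norm z)\<^sup>2 / r\<^sup>2) * jump_density DIM('a) \<nu> (norm z))"]) measurable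
  also have "\<dots> \<le> ennreal (Cj * \<phi> (1 / r\<^sup>2))"
    unfolding Cj_def by (rule nn_integral_min_jump_density_le[OF r])
  finally show ?thesis .
qed

text \<open>Beyond distance \<open>r\<close> the kernel is at most
  \<open>Ck * \<phi> (1 / r\<^sup>2) / dist x y ^ DIM('a)\<close>, and the mass of the layer in
  balls grows one power slower; this yields the factor \<open>t / r\<close>.\<close>

lemma nn_integral_layer_j:
  assumes r: "r > 0" and t: "0 < t" "t \<le> r"
  shows "(\<integral>\<^sup>+y. indicator {y \<in> \<Omega>. \<delta> y < t \<and> r \<le> dist x y} y * ennreal (kernel x y) \<partial>lborel)
    \<le> ennreal (Ck * \<phi> (1 / r\<^sup>2) * (2 ^ DIM('a) * (Cm * t) / r))"
proof -
  define S where "S = {y \<in> \<Omega>. \<delta> y < t}"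
  have [measurable]: "S \<in> sets borel" unfolding S_def by measurable
  define K where "K = Ck * \<phi> (1 / r\<^sup>2)"
  have K: "K \<ge> 0" using Ck_pos phi_nonneg[of "1 / r\<^sup>2"] by (simp add: K_def)
  have "(\<integral>\<^sup>+y. indicator {y \<in> \<Omega>. \<delta> y < t \<and> r \<le> dist x y} y * ennreal (kernel x y) \<partial>lborel)
    \<le> (\<integral>\<^sup>+y. ennreal K * (indicator {y \<in> S. r \<le> dist x y} y * ennreal (1 / dist x y ^ DIM('a))) \<partial>lborel)"
  proof (rule nn_integral_mono)
    fix y
    show "indicator {y \<in> \<Omega>. \<delta> y < t \<and> r \<le> dist x y} y * ennreal (kernel x y)
      \<le> ennreal K * (indicator {y \<in> S. r \<le> dist x y} y * ennreal (1 / dist x y ^ DIM('a)))"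
    proof (cases "y \<in> S \<and> r \<le> dist x y")
      case True
      define \<rho> where "\<rho> = dist x y"
      have \<rho>: "\<rho> \<ge> r" "\<rho> > 0" using True r by (auto simp: \<rho>_def)
      have "r\<^sup>2 \<le> \<rho>\<^sup>2" using \<rho> r by (intro power_mono) auto
      then have "1 / \<rho>\<^sup>2 \<le> 1 / r\<^sup>2" using \<rho> r by (intro divide_left_mono) auto
      then have "Ck * \<phi> (1 / \<rho>\<^sup>2) \<le> K" unfolding K_def using Ck_pos by (intro mult_left_mono phi_mono) auto
      then have "jump_density DIM('a) \<nu> \<rho> \<le> K / \<rho> ^ DIM('a)"
        using jump_density_le[OF \<rho>(2), of "DIM('a)"] \<rho> unfolding Ck_def
        by (elim order_trans) (intro divide_right_mono, auto)
      then show ?thesis using True K by (simp add: S_def \<rho>_def dist_commute ennreal_mult'[symmetric] ennreal_leI)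
    next
      case False
      then show ?thesis by (auto simp: S_def)
    qed
  qed
  also have "\<dots> = ennreal K * (\<integral>\<^sup>+y. indicator {y \<in> S. r \<le> dist x y} y * ennreal (1 / dist x y ^ DIM('a)) \<partial>lborel)"
    by (intro nn_integral_cmult) measurable
  also have "\<dots> \<le> ennreal K * ennreal (2 ^ DIM('a) * (Cm * t) / r)"
  proof (intro mult_left_mono nn_integral_inverse_dist_power_le r)
    fix \<rho> assume \<rho>: "\<rho> \<ge> r"
    have "bounded {y \<in> S. dist x y < \<rho>}" using bounded by (rule bounded_subset) (auto simp: S_def)
    then have "emeasure lborel {y \<in> S. dist x y < \<rho>} = ennreal (measure lborel {y \<in> S. dist x y < \<rho>})"
      by (intro emeasure_eq_ennreal_measure) (use emeasure_bounded_finite[OF \<open>bounded _\<close>] in \<open>simp add: less_top\<close>)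
    also have "\<dots> \<le> ennreal (Cm * t * \<rho> ^ (DIM('a) - 1))"
      using layer[of t \<rho> x] t \<rho> by (intro ennreal_leI) (simp add: S_def)
    finally show "emeasure lborel {y \<in> S. dist x y < \<rho>} \<le> ennreal (Cm * t * \<rho> ^ (DIM('a) - 1))" .
  qed (use Cm_pos t in auto)
  also have "\<dots> = ennreal (K * (2 ^ DIM('a) * (Cm * t) / r))" by (rule ennreal_mult'[OF K, symmetric])
  finally show ?thesis by (simp add: K_def)
qed

text \<open>Telescoping up to the first \<open>n\<close> with
  \<open>r / 2 ^ n \<le> \<delta> y\<close>; every increment used belongs to a layer that contains
  \<open>y\<close>.\<close>

lemma U_le_dyadic_sum:
  assumes r: "r > 0" and y: "y \<in> \<Omega>"
  shows "ennreal (U (\<delta> y)) \<le> ennreal (U r) +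
    (\<Sum>k. ennreal (U (r / 2 ^ Suc k) - U (r / 2 ^ k)) * indicator {y. \<delta> y < r / 2 ^ k} y)"
proof -
  define a where "a k = U (r / 2 ^ k)" for k :: nat
  have a_mono: "a k \<le> a (Suc k)" for k unfolding a_def
    using r by (intro U_anti) (auto simp: field_simps)
  obtain n0 where "r / \<delta> y < 2 ^ n0" using real_arch_pow[of 2 "r / \<delta> y"] by auto
  then have n0: "r / 2 ^ n0 \<le> \<delta> y" using \<delta>_pos[OF y] by (simp add: field_simps)
  define n where "n = (LEAST n. r / 2 ^ n \<le> \<delta> y)"
  have n: "r / 2 ^ n \<le> \<delta> y" unfolding n_def by (rule LeastI) (rule n0)
  have less: "\<delta> y < r / 2 ^ k" if "k < n" for k
    using not_less_Least[of k "\<lambda>n. r / 2 ^ n \<le> \<delta> y"] that by (simp add: n_def)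
  have "U (\<delta> y) \<le> a n" unfolding a_def using n r by (intro U_anti) auto
  also have "\<dots> = a 0 + (\<Sum>k<n. a (Suc k) - a k)" by (simp add: sum_lessThan_telescope)
  finally have "ennreal (U (\<delta> y)) \<le> ennreal (a 0 + (\<Sum>k<n. a (Suc k) - a k))" by (rule ennreal_leI)
  also have "\<dots> = ennreal (a 0) + ennreal (\<Sum>k<n. a (Suc k) - a k)"
    using a_mono U_pos[OF r] by (intro ennreal_plus sum_nonneg) (auto simp: a_def)
  also have "ennreal (\<Sum>k<n. a (Suc k) - a k) = (\<Sum>k<n. ennreal (a (Suc k) - a k))"
    using a_mono by (intro sum_ennreal[symmetric]) auto
  also have "\<dots> = (\<Sum>k<n. ennreal (a (Suc k) - a k) * indicator {y. \<delta> y < r / 2 ^ k} y)"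
    using less by (intro sum.cong) auto
  also have "\<dots> \<le> (\<Sum>k. ennreal (a (Suc k) - a k) * indicator {y. \<delta> y < r / 2 ^ k} y)"
    by (intro sum_le_suminf) auto
  finally show ?thesis by (simp add: a_def add_left_mono)
qed

definition Cf :: real where "Cf = Cj + Ck * 2 ^ DIM('a) * Cm * Cs"

lemma Cf_nonneg: "Cf \<ge> 0"
  using Cj_nonneg Ck_pos Cm_pos Cs_nonneg by (simp add: Cf_def)

text \<open>The constant part \<open>U r\<close> is charged to all jumps beyond \<open>r\<close>,
  and the \<open>k\<close>-th increment to its layer, whose kernel mass carries the factor
  \<open>1 / 2 ^ k\<close>; \<open>dyadic\<close> sums the weighted increments.\<close>

lemma nn_integral_U_j:
  assumes r: "0 < r" "r \<le> r0"
  shows "(\<integral>\<^sup>+y. indicator {y \<in> \<Omega>. r \<le> dist x y} y * ennreal (U (\<delta> y) * kernel x y) \<partial>lborel)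
    \<le> ennreal (Cf * U r * \<phi> (1 / r\<^sup>2))"
proof -
  define b where "b k = U (r / 2 ^ Suc k) - U (r / 2 ^ k)" for k :: nat
  have b0: "b k \<ge> 0" for k unfolding b_def using r U_anti[of "r / 2 ^ Suc k" "r / 2 ^ k"] by (simp add: field_simps)
  define \<Phi> where "\<Phi> = \<phi> (1 / r\<^sup>2)"
  have \<Phi>: "\<Phi> \<ge> 0" unfolding \<Phi>_def by (intro phi_nonneg) simp
  have Ur: "U r > 0" using r by (intro U_pos)
  define Q where "Q k y = indicator {y \<in> \<Omega>. \<delta> y < r / 2 ^ k \<and> r \<le> dist x y} y * ennreal (kernel x y)" for k :: nat and y
  have [measurable]: "Q k \<in> borel_measurable borel" for k unfolding Q_def by measurable
  have "(\<integral>\<^sup>+y. indicator {y \<in> \<Omega>. r \<le> dist x y} y * ennreal (U (\<delta> y) * kernel x y) \<partial>lborel)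
    \<le> (\<integral>\<^sup>+y. ennreal (U r) * ennreal (min 1 ((dist y x)\<^sup>2 / r\<^sup>2) * kernel x y) + (\<Sum>k. ennreal (b k) * Q k y) \<partial>lborel)"
  proof (rule nn_integral_mono)
    fix y
    show "indicator {y \<in> \<Omega>. r \<le> dist x y} y * ennreal (U (\<delta> y) * kernel x y)
      \<le> ennreal (U r) * ennreal (min 1 ((dist y x)\<^sup>2 / r\<^sup>2) * kernel x y) + (\<Sum>k. ennreal (b k) * Q k y)"
    proof (cases "y \<in> \<Omega> \<and> r \<le> dist x y")
      case True
      have "r\<^sup>2 \<le> (dist y x)\<^sup>2" using True r by (intro power_mono) (auto simp: dist_commute)
      then have m1: "min 1 ((dist y x)\<^sup>2 / r\<^sup>2) = 1" using r by simp
      have "ennreal (U (\<delta> y) * kernel x y) = ennreal (U (\<delta> y)) * ennreal (kernel x y)"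
        using jump_density_nonneg by (simp add: ennreal_mult'')
      also have "\<dots> \<le> (ennreal (U r) + (\<Sum>k. ennreal (b k) * indicator {y. \<delta> y < r / 2 ^ k} y)) * ennreal (kernel x y)"
        unfolding b_def using True r by (intro mult_right_mono U_le_dyadic_sum) auto
      also have "\<dots> = ennreal (U r) * ennreal (kernel x y) + (\<Sum>k. ennreal (b k) * indicator {y. \<delta> y < r / 2 ^ k} y * ennreal (kernel x y))"
        by (simp add: distrib_right)
      also have "(\<lambda>k. ennreal (b k) * indicator {y. \<delta> y < r / 2 ^ k} y * ennreal (kernel x y)) = (\<lambda>k. ennreal (b k) * Q k y)"
        using True by (auto simp: Q_def mult.assoc indicator_def)
      finally show ?thesis using True unfolding m1 by simp
    qed simp
  qed
  also have "\<dots> = (\<integral>\<^sup>+y. ennreal (U r) * ennreal (min 1 ((dist y x)\<^sup>2 / r\<^sup>2) * kernel x y) \<partial>lborel)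
      + (\<integral>\<^sup>+y. (\<Sum>k. ennreal (b k) * Q k y) \<partial>lborel)"
    by (intro nn_integral_add) measurable
  also have "(\<integral>\<^sup>+y. (\<Sum>k. ennreal (b k) * Q k y) \<partial>lborel) = (\<Sum>k. \<integral>\<^sup>+y. ennreal (b k) * Q k y \<partial>lborel)"
    by (intro nn_integral_suminf) measurable
  also have "\<dots> \<le> ennreal (Ck * 2 ^ DIM('a) * Cm * Cs * U r * \<Phi>)"
  proof (rule suminf_le_const)
    fix n
    have "(\<Sum>k<n. \<integral>\<^sup>+y. ennreal (b k) * Q k y \<partial>lborel) \<le> (\<Sum>k<n. ennreal (Ck * 2 ^ DIM('a) * Cm * \<Phi> * (b k / 2 ^ k)))"
    proof (rule sum_mono)
      fix k
      have "r / 2 ^ k \<le> r" using r by (simp add: field_simps)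
      then have "(\<integral>\<^sup>+y. Q k y \<partial>lborel) \<le> ennreal (Ck * \<phi> (1 / r\<^sup>2) * (2 ^ DIM('a) * (Cm * (r / 2 ^ k)) / r))"
        unfolding Q_def using r by (intro nn_integral_layer_j) auto
      then have "ennreal (b k) * (\<integral>\<^sup>+y. Q k y \<partial>lborel)
        \<le> ennreal (b k) * ennreal (Ck * \<phi> (1 / r\<^sup>2) * (2 ^ DIM('a) * (Cm * (r / 2 ^ k)) / r))"
        by (rule mult_left_mono) simp
      also have "\<dots> = ennreal (b k * (Ck * \<phi> (1 / r\<^sup>2) * (2 ^ DIM('a) * (Cm * (r / 2 ^ k)) / r)))"
        by (rule ennreal_mult'[OF b0, symmetric])
      also have "b k * (Ck * \<phi> (1 / r\<^sup>2) * (2 ^ DIM('a) * (Cm * (r / 2 ^ k)) / r)) = Ck * 2 ^ DIM('a) * Cm * \<Phi> * (b k / 2 ^ k)"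
        using r by (simp add: \<Phi>_def)
      finally show "(\<integral>\<^sup>+y. ennreal (b k) * Q k y \<partial>lborel) \<le> ennreal (Ck * 2 ^ DIM('a) * Cm * \<Phi> * (b k / 2 ^ k))"
        by (subst nn_integral_cmult) auto
    qed
    also have "\<dots> = ennreal (Ck * 2 ^ DIM('a) * Cm * \<Phi> * (\<Sum>k<n. b k / 2 ^ k))"
      using b0 \<Phi> Ck_pos Cm_pos by (subst sum_ennreal) (auto simp: sum_distrib_left)
    also have "\<dots> \<le> ennreal (Ck * 2 ^ DIM('a) * Cm * \<Phi> * (Cs * U r))"
      using dyadic[OF r, of n] \<Phi> Ck_pos Cm_pos unfolding b_def by (intro ennreal_leI mult_left_mono) auto
    finally show "(\<Sum>k<n. \<integral>\<^sup>+y. ennreal (b k) * Q k y \<partial>lborel) \<le> ennreal (Ck * 2 ^ DIM('a) * Cm * Cs * U r * \<Phi>)"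
      by (simp add: mult_ac)
  qed simp
  also have "(\<integral>\<^sup>+y. ennreal (U r) * ennreal (min 1 ((dist y x)\<^sup>2 / r\<^sup>2) * kernel x y) \<partial>lborel)
    = ennreal (U r) * (\<integral>\<^sup>+y. ennreal (min 1 ((dist y x)\<^sup>2 / r\<^sup>2) * kernel x y) \<partial>lborel)"
    by (intro nn_integral_cmult) measurable
  also have "\<dots> \<le> ennreal (U r) * ennreal (Cj * \<Phi>)"
    unfolding \<Phi>_def using r by (intro mult_left_mono nn_integral_min_j) auto
  also have "\<dots> = ennreal (U r * (Cj * \<Phi>))" using Ur by (intro ennreal_mult'[symmetric]) simp
  finally have "(\<integral>\<^sup>+y. indicator {y \<in> \<Omega>. r \<le> dist x y} y * ennreal (U (\<delta> y) * kernel x y) \<partial>lborel)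
    \<le> ennreal (U r * (Cj * \<Phi>)) + ennreal (Ck * 2 ^ DIM('a) * Cm * Cs * U r * \<Phi>)"
    by (simp add: add_mono)
  also have "\<dots> = ennreal (U r * (Cj * \<Phi>) + Ck * 2 ^ DIM('a) * Cm * Cs * U r * \<Phi>)"
    using Ur Cj_nonneg Ck_pos Cm_pos Cs_nonneg \<Phi> by (intro ennreal_plus[symmetric]) auto
  also have "U r * (Cj * \<Phi>) + Ck * 2 ^ DIM('a) * Cm * Cs * U r * \<Phi> = Cf * U r * \<Phi>"
    by (simp add: Cf_def algebra_simps)
  finally show ?thesis by (simp add: \<Phi>_def)
qed

end

section \<open>Existence and upper bound of the principal value\<close>

context barrier
begin

lemma u_nonneg: "0 \<le> u y"
proof (cases "y \<in> \<Omega>")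
  case True
  have "0 \<le> B / (2 * 20 ^ DIM('a) * D) * U (\<delta> y)"
    using B_pos D_pos U_pos[OF \<delta>_pos[OF True]] by simp
  then show ?thesis using u_lower[OF True] by simp
qed (simp add: u_outside)

text \<open>Away from the centre the kernel is bounded, so truncated integrals of the linear Taylor
  term converge absolutely.\<close>

lemma jump_density_bounded:
  assumes "0 < \<epsilon>" "\<epsilon> \<le> \<rho>"
  shows "jump_density DIM('a) \<nu> \<rho> \<le> Ck * \<phi> (1 / \<epsilon>\<^sup>2) / \<epsilon> ^ DIM('a)"
proof -
  have \<rho>: "\<rho> > 0" using assms by simp
  have "\<epsilon>\<^sup>2 \<le> \<rho>\<^sup>2" using assms by (intro power_mono) auto
  then have "1 / \<rho>\<^sup>2 \<le> 1 / \<epsilon>\<^sup>2" using assms \<rho> by (intro divide_left_mono) auto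
  then have "Ck * \<phi> (1 / \<rho>\<^sup>2) \<le> Ck * \<phi> (1 / \<epsilon>\<^sup>2)" using Ck_pos by (intro mult_left_mono phi_mono) auto
  moreover have "0 \<le> Ck * \<phi> (1 / \<epsilon>\<^sup>2)" using Ck_pos phi_nonneg by simp
  ultimately have "Ck * \<phi> (1 / \<rho>\<^sup>2) / \<rho> ^ DIM('a) \<le> Ck * \<phi> (1 / \<epsilon>\<^sup>2) / \<epsilon> ^ DIM('a)"
    using assms by (intro frac_le power_mono zero_less_power) auto
  then show ?thesis using jump_density_le[OF \<rho>, of "DIM('a)"] by (simp add: Ck_def)
qed

text \<open>Subtracting the linear Taylor term inside the ball of radius \<open>r\<close> leaves an
  absolutely integrable \<open>P\<close>. The subtracted part is odd about \<open>x\<close> and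
  integrates to 0 over each truncation, so the principal value is the integral of \<open>P\<close>.
  In the upper bound the negative term \<open>- u x\<close> outside the ball is dropped.\<close>

lemma has_L_u:
  assumes x: "x \<in> \<Omega>" and r: "0 < r" "r \<le> \<delta> x / 4" "r \<le> r0"
  obtains l where "has_L \<nu> u x l"
    "l \<le> (C * 640 * U (\<delta> x) / (\<delta> x)\<^sup>2 * r\<^sup>2 * Cj + C * Cf * U r) * \<phi> (1 / r\<^sup>2)"
proof -
  define \<Phi> where "\<Phi> = \<phi> (1 / r\<^sup>2)"
  have \<Phi>: "\<Phi> \<ge> 0" unfolding \<Phi>_def by (intro phi_nonneg) simp
  define J where "J y = kernel x y" for y
  have J0: "J y \<ge> 0" for y by (simp add: J_def jump_density_nonneg)
  have [measurable]: "J \<in> borel_measurable borel" unfolding J_def by measurable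
  define K where "K = C * 640 * U (\<delta> x) / (\<delta> x)\<^sup>2"
  have dx: "\<delta> x > 0" by (rule \<delta>_pos) fact
  have K: "K \<ge> 0" using C_pos U_pos[OF dx] by (simp add: K_def)
  have Ur: "U r > 0" using r by (intro U_pos)
  define g where "g y = (if dist y x < r then G x \<bullet> (y - x) else 0)" for y
  have [measurable]: "g \<in> borel_measurable borel" unfolding g_def by measurable
  define P where "P y = (u y - u x - g y) * J y" for y
  have [measurable]: "P \<in> borel_measurable borel" unfolding P_def by measurable
  define m where "m y = min 1 ((dist y x)\<^sup>2 / r\<^sup>2)" for y
  have [measurable]: "m \<in> borel_measurable borel" unfolding m_def by measurable
  have m0: "m y \<ge> 0" for y by (simp add: m_def)
  have m_near: "m y = (dist y x)\<^sup>2 / r\<^sup>2" if "dist y x < r" for y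
  proof -
    have "(dist y x)\<^sup>2 \<le> r\<^sup>2" using that by (intro power_mono) auto
    then show ?thesis using r by (simp add: m_def)
  qed
  have m_far: "m y = 1" if "\<not> dist y x < r" for y
  proof -
    have "r\<^sup>2 \<le> (dist y x)\<^sup>2" using that r by (intro power_mono) auto
    then show ?thesis using r by (simp add: m_def)
  qed
  define far where "far y = indicator {y \<in> \<Omega>. r \<le> dist x y} y * (U (\<delta> y) * J y)" for y
  have [measurable]: "far \<in> borel_measurable borel" unfolding far_def by measurable
  have far0: "far y \<ge> 0" for y
    using U_pos[OF \<delta>_pos] J0 by (auto simp: far_def indicator_def less_imp_le)
  have nn_m: "(\<integral>\<^sup>+y. ennreal (m y * J y) \<partial>lborel) \<le> ennreal (Cj * \<Phi>)"
    unfolding m_def J_def \<Phi>_def by (rule nn_integral_min_j) (rule r)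
  have "(\<integral>\<^sup>+y. ennreal (far y) \<partial>lborel) = (\<integral>\<^sup>+y. indicator {y \<in> \<Omega>. r \<le> dist x y} y * ennreal (U (\<delta> y) * J y) \<partial>lborel)"
    by (intro nn_integral_cong) (simp add: far_def indicator_def)
  then have nn_far: "(\<integral>\<^sup>+y. ennreal (far y) \<partial>lborel) \<le> ennreal (Cf * U r * \<Phi>)"
    using nn_integral_U_j[OF r(1,3), of x] by (simp add: J_def \<Phi>_def)
  have bound: "integrable lborel h \<and> (\<integral>y. h y \<partial>lborel) \<le> b"
    if [measurable]: "h \<in> borel_measurable borel" and h: "\<And>y. 0 \<le> h y" and b: "b \<ge> 0"
      and le: "(\<integral>\<^sup>+y. ennreal (h y) \<partial>lborel) \<le> ennreal b" for h :: "'a \<Rightarrow> real" and b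
  proof
    show int: "integrable lborel h"
      using h le_less_trans[OF le, of \<infinity>] by (intro integrableI_nonneg) auto
    have "ennreal (\<integral>y. h y \<partial>lborel) \<le> ennreal b"
      using le h nn_integral_eq_integral[OF int] by simp
    then show "(\<integral>y. h y \<partial>lborel) \<le> b" using b by simp
  qed
  have mJ: "integrable lborel (\<lambda>y. m y * J y)" "(\<integral>y. m y * J y \<partial>lborel) \<le> Cj * \<Phi>"
    using bound[of "\<lambda>y. m y * J y" "Cj * \<Phi>"] nn_m m0 J0 Cj_nonneg \<Phi> by auto
  have farI: "integrable lborel far" "(\<integral>y. far y \<partial>lborel) \<le> Cf * U r * \<Phi>"
    using bound[of far "Cf * U r * \<Phi>"] nn_far far0 Cf_nonneg Ur \<Phi> by auto
  \<comment> \<open>\<open>A\<close> bounds \<open>P\<close> from above only; for integrability the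
    lower bound costs the extra term \<open>u x * (m y * J y)\<close>.\<close>
  define A where "A y = K * r\<^sup>2 * (m y * J y) + C * far y" for y
  have A_int: "integrable lborel A" unfolding A_def
    by (intro Bochner_Integration.integrable_add integrable_mult_right mJ farI)
  have PA: "P y \<le> A y \<and> - P y \<le> A y + u x * (m y * J y)" for y
  proof (cases "dist y x < r")
    case True
    have "\<bar>u y - u x - g y\<bar> \<le> K * (norm (y - x))\<^sup>2"
      using u_remainder[OF x, of y] True r by (simp add: g_def K_def)
    also have "\<dots> = K * r\<^sup>2 * m y" using r by (simp add: m_near[OF True] dist_norm)
    finally have "\<bar>u y - u x - g y\<bar> * J y \<le> K * r\<^sup>2 * m y * J y" using J0 by (intro mult_right_mono) auto
    then have "\<bar>P y\<bar> \<le> K * r\<^sup>2 * (m y * J y)" using J0[of y] by (simp add: P_def abs_mult mult.assoc)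
    moreover have "0 \<le> C * far y" "0 \<le> u x * (m y * J y)"
      using C_pos far0[of y] u_nonneg m0 J0 by simp_all
    ultimately show ?thesis unfolding A_def by linarith
  next
    case False
    have uy: "u y * J y \<le> C * far y"
    proof (cases "y \<in> \<Omega>")
      case True
      have "u y * J y \<le> C * U (\<delta> y) * J y" using u_integrable_upper(2)[OF True] J0 by (intro mult_right_mono) auto
      then show ?thesis using True False by (simp add: far_def dist_commute mult.assoc)
    qed (simp add: u_outside far_def)
    have P: "P y = u y * J y - u x * J y" using False by (simp add: P_def g_def algebra_simps)
    have "0 \<le> u x * J y" "0 \<le> u y * J y" "0 \<le> K * r\<^sup>2 * J y" "0 \<le> C * far y"
      using u_nonneg J0 K C_pos far0[of y] by simp_all
    then show ?thesis unfolding A_def m_far[OF False] P using uy by simp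
  qed
  have P_int: "integrable lborel P"
  proof (rule Bochner_Integration.integrable_bound)
    show "integrable lborel (\<lambda>y. A y + u x * (m y * J y))"
      by (intro Bochner_Integration.integrable_add A_int integrable_mult_right mJ)
    show "AE y in lborel. norm (P y) \<le> norm (A y + u x * (m y * J y))"
    proof (rule AE_I2)
      fix y
      have "0 \<le> u x * (m y * J y)" using u_nonneg m0 J0 by simp
      then have "\<bar>P y\<bar> \<le> A y + u x * (m y * J y)" using PA[of y] by (intro abs_leI) linarith+
      then show "norm (P y) \<le> norm (A y + u x * (m y * J y))" by simp
    qed
  qed measurable
  define l where "l = (\<integral>y. P y \<partial>lborel)"
  have "l \<le> (\<integral>y. A y \<partial>lborel)" unfolding l_def using PA by (intro integral_mono P_int A_int) auto
  also have "\<dots> = K * r\<^sup>2 * (\<integral>y. m y * J y \<partial>lborel) + C * (\<integral>y. far y \<partial>lborel)"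
    unfolding A_def using mJ(1) farI(1) by (subst Bochner_Integration.integral_add) auto
  also have "\<dots> \<le> K * r\<^sup>2 * (Cj * \<Phi>) + C * (Cf * U r * \<Phi>)"
    using mJ(2) farI(2) K C_pos by (intro add_mono mult_left_mono) auto
  finally have l_le: "l \<le> (K * r\<^sup>2 * Cj + C * Cf * U r) * \<Phi>" by (simp add: algebra_simps)
  have annulus: "set_integrable lborel {y. \<epsilon> < dist y x} (\<lambda>y. (u y - u x) * J y) \<and>
    (LINT y:{y. \<epsilon> < dist y x}|lborel. (u y - u x) * J y) = (\<integral>y. indicator {y. \<epsilon> < dist y x} y *\<^sub>R P y \<partial>lborel)"
    if \<epsilon>: "\<epsilon> > 0" for \<epsilon>
  proof -
    define S where "S = {y. \<epsilon> < dist y x}"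
    have [measurable]: "S \<in> sets borel" unfolding S_def by measurable
    define q where "q y = indicator S y * (g y * J y)" for y
    have [measurable]: "q \<in> borel_measurable borel" unfolding q_def by measurable
    have "norm (q y) \<le> (norm (G x) * r * (Ck * \<phi> (1 / \<epsilon>\<^sup>2) / \<epsilon> ^ DIM('a))) * indicator (ball x r) y" for y
    proof (cases "y \<in> S \<and> dist y x < r")
      case True
      have "\<bar>g y\<bar> \<le> norm (G x) * norm (y - x)" using True Cauchy_Schwarz_ineq2[of "G x" "y - x"] by (simp add: g_def)
      also have "\<dots> \<le> norm (G x) * r" using True by (intro mult_left_mono) (auto simp: dist_norm)
      finally have "\<bar>g y\<bar> * J y \<le> norm (G x) * r * (Ck * \<phi> (1 / \<epsilon>\<^sup>2) / \<epsilon> ^ DIM('a))"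
        using jump_density_bounded[OF \<epsilon>, of "dist y x"] J0[of y] r True
        by (intro mult_mono) (auto simp: J_def S_def)
      then show ?thesis using True J0[of y] by (simp add: q_def abs_mult dist_commute)
    next
      case False
      then show ?thesis using Ck_pos phi_nonneg[of "1 / \<epsilon>\<^sup>2"] r \<epsilon> by (auto simp: q_def g_def)
    qed
    from integral_ball_bound(1)[OF _ _ this] have q_int: "integrable lborel q" using r by simp
    have "(\<integral>y. q y \<partial>lborel) = 0"
    proof (rule integral_odd_eq_0)
      fix y
      have eq: "2 *\<^sub>R x - y - x = - (y - x)" by (simp add: scaleR_2)
      have "dist (2 *\<^sub>R x - y) x = dist y x" unfolding dist_norm eq by (rule norm_minus_cancel)
      moreover from this have "g (2 *\<^sub>R x - y) = - g y"
        by (simp add: g_def eq inner_minus_right del: minus_diff_eq)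
      ultimately show "q (2 *\<^sub>R x - y) = - q y"
        by (simp add: q_def S_def J_def indicator_def)
    qed measurable
    moreover have SP: "integrable lborel (\<lambda>y. indicator S y *\<^sub>R P y)"
      by (rule integrable_mult_indicator) (auto simp: P_int)
    moreover have eq: "indicator S y *\<^sub>R ((u y - u x) * J y) = indicator S y *\<^sub>R P y + q y" for y
      by (simp add: P_def q_def indicator_def algebra_simps)
    ultimately show ?thesis
      unfolding S_def[symmetric] set_integrable_def set_lebesgue_integral_def eq
      using q_int by simp
  qed
  have lim: "((\<lambda>\<epsilon>. \<integral>y. indicator {y. \<epsilon> < dist y x} y *\<^sub>R P y \<partial>lborel) \<longlongrightarrow> l) (at_right 0)"
    unfolding tendsto_at_iff_sequentially
  proof (intro allI impI)
    fix X :: "nat \<Rightarrow> real" assume X: "\<forall>i. X i \<in> {0<..} - {0}" "X \<longlonglongrightarrow> 0"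
    show "((\<lambda>\<epsilon>. \<integral>y. indicator {y. \<epsilon> < dist y x} y *\<^sub>R P y \<partial>lborel) \<circ> X) \<longlonglongrightarrow> l"
      unfolding comp_def l_def
    proof (rule integral_dominated_convergence[where w = "\<lambda>y. norm (P y)"])
      show "AE y in lborel. (\<lambda>i. indicator {y. X i < dist y x} y *\<^sub>R P y) \<longlonglongrightarrow> P y"
      proof (rule AE_I2)
        fix y
        show "(\<lambda>i. indicator {y. X i < dist y x} y *\<^sub>R P y) \<longlonglongrightarrow> P y"
        proof (cases "y = x")
          case True
          \<comment> \<open>At the centre the indicators stay 0, so convergence there rests on
            \<open>P x = 0\<close>.\<close>
          then have "P y = 0" using r by (simp add: P_def g_def)
          then show ?thesis by simp
        next
          case False
          then have "\<forall>\<^sub>F i in sequentially. X i < dist y x"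
            using X(2) by (intro order_tendstoD) auto
          then have "\<forall>\<^sub>F i in sequentially. indicator {y. X i < dist y x} y *\<^sub>R P y = P y"
            by eventually_elim simp
          then show ?thesis by (rule tendsto_eventually)
        qed
      qed
      show "integrable lborel (\<lambda>y. norm (P y))" using P_int by simp
      show "AE y in lborel. norm (indicator {y. X i < dist y x} y *\<^sub>R P y) \<le> norm (P y)" for i
        by (simp add: indicator_def)
    qed measurable
  qed
  have "has_L \<nu> u x l"
    unfolding has_L_def J_def[symmetric]
  proof (intro conjI allI impI)
    show "((\<lambda>\<epsilon>. LINT y:{y. \<epsilon> < dist y x}|lborel. (u y - u x) * J y) \<longlongrightarrow> l) (at_right 0)"
    proof (rule Lim_transform_eventually[OF lim])
      show "\<forall>\<^sub>F \<epsilon> in at_right 0. (\<integral>y. indicator {y. \<epsilon> < dist y x} y *\<^sub>R P y \<partial>lborel)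
        = (LINT y:{y. \<epsilon> < dist y x}|lborel. (u y - u x) * J y)"
        using annulus by (intro eventually_at_right_less[THEN eventually_mono]) auto
    qed
  qed (use annulus in auto)
  then show ?thesis using l_le by (intro that[of l]) (simp_all add: K_def \<Phi>_def)
qed

text \<open>The local bound asks for a radius below both \<open>\<delta> x / 4\<close> and
  \<open>r0\<close>. As \<open>\<Omega>\<close> is bounded, one ratio \<open>N\<close> between
  \<open>\<delta> x\<close> and the radius works for all \<open>x\<close>; being a power of 2, it
  lets doubling be iterated to return from \<open>U r\<close> to
  \<open>U (\<delta> x)\<close>.\<close>

lemma L_u_bound:
  obtains K where "\<And>x. x \<in> \<Omega> \<Longrightarrow> \<exists>l. has_L \<nu> u x l \<and> l \<le> K * (U (\<delta> x) * \<phi> (1 / (\<delta> x)\<^sup>2))"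
proof -
  obtain w where w: "w \<in> frontier \<Omega>" using frontier_ne by auto
  obtain e where e: "\<And>x. x \<in> \<Omega> \<Longrightarrow> dist w x \<le> e" using bounded bounded_any_center[of \<Omega> w] by auto
  obtain N0 where N0: "max 4 (e / r0) < 2 ^ N0" using real_arch_pow[of 2 "max 4 (e / r0)"] by auto
  define N where "N = (2 :: real) ^ N0"
  have N: "N > 4" "e \<le> r0 * N" "N > 0" using N0 r0_pos by (auto simp: N_def field_simps)
  have U_iter: "U (t / 2 ^ n) \<le> D ^ n * U t" if "t > 0" for t n
  proof (induction n)
    case (Suc n)
    have "U (t / 2 ^ Suc n) \<le> D * U (t / 2 ^ n)"
      using U_half[of "t / 2 ^ n"] that by (simp add: field_simps)
    also have "\<dots> \<le> D * (D ^ n * U t)" using Suc D_pos by (intro mult_left_mono) auto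
    finally show ?case by simp
  qed simp
  define K where "K = (C * 640 * Cj + C * Cf * D ^ N0) * N\<^sup>2"
  have "\<exists>l. has_L \<nu> u x l \<and> l \<le> K * (U (\<delta> x) * \<phi> (1 / (\<delta> x)\<^sup>2))" if x: "x \<in> \<Omega>" for x
  proof -
    have dx: "\<delta> x > 0" by (rule \<delta>_pos) fact
    define r where "r = \<delta> x / N"
    have r: "r > 0" "r \<le> \<delta> x / 4" unfolding r_def using dx N by (simp, intro divide_left_mono) auto
    have "\<delta> x \<le> e" using infdist_le[OF w, of x] e[OF x] by (simp add: dist_commute)
    then have "r \<le> r0" using N unfolding r_def by (simp add: pos_divide_le_eq)
    from has_L_u[OF x r this] obtain l where l: "has_L \<nu> u x l"
      "l \<le> (C * 640 * U (\<delta> x) / (\<delta> x)\<^sup>2 * r\<^sup>2 * Cj + C * Cf * U r) * \<phi> (1 / r\<^sup>2)" by blast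
    note l(2)
    also have "(C * 640 * U (\<delta> x) / (\<delta> x)\<^sup>2 * r\<^sup>2 * Cj + C * Cf * U r) * \<phi> (1 / r\<^sup>2)
      \<le> (C * 640 * U (\<delta> x) * Cj + C * Cf * (D ^ N0 * U (\<delta> x))) * (N\<^sup>2 * \<phi> (1 / (\<delta> x)\<^sup>2))"
    proof -
      have "r\<^sup>2 \<le> (\<delta> x)\<^sup>2" using r dx by (intro power_mono) auto
      then have "C * 640 * U (\<delta> x) * (r\<^sup>2 / (\<delta> x)\<^sup>2) \<le> C * 640 * U (\<delta> x) * 1"
        using dx C_pos U_pos[OF dx] by (intro mult_left_mono) auto
      then have 1: "C * 640 * U (\<delta> x) / (\<delta> x)\<^sup>2 * r\<^sup>2 \<le> C * 640 * U (\<delta> x)" by simp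
      have 2: "U r \<le> D ^ N0 * U (\<delta> x)" unfolding r_def N_def by (rule U_iter) (rule dx)
      have "1 / r\<^sup>2 = N\<^sup>2 * (1 / (\<delta> x)\<^sup>2)" by (simp add: r_def power_divide)
      moreover have "1 \<le> N\<^sup>2" using N by (intro one_le_power) auto
      ultimately have 3: "\<phi> (1 / r\<^sup>2) \<le> N\<^sup>2 * \<phi> (1 / (\<delta> x)\<^sup>2)" by (simp only:) (rule phi_mult_le, auto)
      have 4: "0 \<le> C * Cf" using C_pos Cf_nonneg by simp
      have 5: "0 \<le> C * 640 * U (\<delta> x) * Cj + C * Cf * (D ^ N0 * U (\<delta> x))"
        using C_pos Cj_nonneg Cf_nonneg D_pos U_pos[OF dx] by simp
      show ?thesis
        by (rule mult_mono[OF add_mono[OF mult_right_mono[OF 1 Cj_nonneg] mult_left_mono[OF 2 4]] 3 5])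
          (simp add: phi_nonneg)
    qed
    also have "\<dots> = K * (U (\<delta> x) * \<phi> (1 / (\<delta> x)\<^sup>2))" by (simp add: K_def algebra_simps)
    finally show ?thesis using l(1) by blast
  qed
  then show ?thesis by (rule that)
qed

end

section \<open>The boundary profile\<close>

locale scaled_levy_density = levy_density +
  assumes scaling: "scaling_condition \<phi>"
begin

lemma phi_pos:
  assumes "x > 0"
  shows "\<phi> x > 0"
proof -
  have ge1: "\<phi> t > 0" if t: "t \<ge> 1" for t
  proof -
    obtain a \<delta> where "a > 0" and "\<And>x t. x \<ge> 1 \<Longrightarrow> t \<ge> 1 \<Longrightarrow> a * x powr \<delta> \<le> \<phi> (x * t) / \<phi> t"
      using scaling unfolding scaling_condition_def by blast
    \<comment> \<open>Scaling with ratio 1; it excludes \<open>\<phi> t = 0\<close>, because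
      division by 0 gives 0.\<close>
    from this(1) this(2)[of 1 t] t have "0 < \<phi> t / \<phi> t" by simp
    then have "\<phi> t \<noteq> 0" by auto
    then show ?thesis using phi_nonneg[of t] t by simp
  qed
  show ?thesis
  proof (cases "x \<ge> 1")
    case False
    have "\<phi> (1 / x * x) \<le> 1 / x * \<phi> x" using assms False by (intro phi_mult_le) auto
    then have "0 < 1 / x * \<phi> x" using ge1[of 1] assms by simp
    then show ?thesis using assms by (simp add: zero_less_divide_iff)
  qed (rule ge1)
qed

text \<open>A factor outside \<open>\<phi>\<close> is traded for a dilation of its argument. In this
  form constants pass through the inverses of \<open>\<phi>\<close> and of the renewal
  function.\<close>

lemma lower_scaling:
  assumes A: "A \<ge> 1"
  obtains c where "c \<ge> 1" "\<And>x. x \<ge> 1 \<Longrightarrow> A * \<phi> x \<le> \<phi> (c * x)"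
proof -
  obtain a \<delta> where a: "a > 0" "\<delta> > 0" and s: "\<And>x t. x \<ge> 1 \<Longrightarrow> t \<ge> 1 \<Longrightarrow> a * x powr \<delta> \<le> \<phi> (x * t) / \<phi> t"
    using scaling unfolding scaling_condition_def by blast
  define c where "c = max 1 (A / a) powr (1 / \<delta>)"
  have c: "c \<ge> 1" unfolding c_def using a by (intro ge_one_powr_ge_zero) auto
  have cd: "c powr \<delta> = max 1 (A / a)" unfolding c_def using a by (simp add: powr_powr)
  show ?thesis
  proof (rule that[OF c])
    fix x :: real assume x: "x \<ge> 1"
    have "A = a * (A / a)" using a by simp
    also have "\<dots> \<le> a * c powr \<delta>" unfolding cd using a by (intro mult_left_mono) auto
    also have "\<dots> \<le> \<phi> (c * x) / \<phi> x" by (rule s) fact+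
    finally show "A * \<phi> x \<le> \<phi> (c * x)" using phi_pos[of x] x by (simp add: pos_le_divide_eq)
  qed
qed

text \<open>Concavity again, as \<open>\<phi> y \<le> y / x * \<phi> x\<close> and
  \<open>\<phi> x \<le> x * \<phi> 1\<close>. The purpose is continuity, for the intermediate value
  argument that follows.\<close>

lemma phi_lipschitz: "(\<phi> 1)-lipschitz_on {1..} \<phi>"
proof (rule lipschitz_onI)
  have le: "\<phi> y - \<phi> x \<le> \<phi> 1 * (y - x)" if xy: "1 \<le> x" "x \<le> y" for x y
  proof -
    have "\<phi> (y / x * x) \<le> y / x * \<phi> x" using xy by (intro phi_mult_le) auto
    then have "\<phi> y - \<phi> x \<le> (y / x - 1) * \<phi> x" using xy by (simp add: algebra_simps)
    also have "\<dots> \<le> (y / x - 1) * (x * \<phi> 1)"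
      using xy phi_mult_le[of 1 x] by (intro mult_left_mono) auto
    also have "\<dots> = \<phi> 1 * (y - x)" using xy by (simp add: field_simps)
    finally show ?thesis .
  qed
  fix x y :: real assume "x \<in> {1..}" "y \<in> {1..}"
  then show "dist (\<phi> x) (\<phi> y) \<le> \<phi> 1 * dist x y"
    using le[of x y] le[of y x] phi_mono[of x y] phi_mono[of y x]
    by (cases "x \<le> y") (auto simp: dist_real_def)
qed (rule phi_nonneg, simp)

text \<open>From \<open>\<phi> 1\<close> on every value is attained, as \<open>\<phi>\<close> is
  continuous and unbounded there; hence \<open>inv_into\<close> returns a genuine preimage and not
  an unspecified value. It is nonzero because \<open>\<phi> 0 = 0\<close>.\<close>

lemma inv_phi:
  assumes y: "y \<ge> \<phi> 1"
  shows "inv_into {0..} \<phi> y > 0" "\<phi> (inv_into {0..} \<phi> y) = y"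
proof -
  have p1: "\<phi> 1 > 0" by (rule phi_pos) simp
  obtain c where c: "c \<ge> 1" "max 1 (y / \<phi> 1) * \<phi> 1 \<le> \<phi> (c * 1)"
    using lower_scaling[of "max 1 (y / \<phi> 1)"] by (metis max.cobounded1 order_refl)
  have "y = y / \<phi> 1 * \<phi> 1" using p1 by simp
  also have "\<dots> \<le> max 1 (y / \<phi> 1) * \<phi> 1" using p1 by (intro mult_right_mono) auto
  finally have "y \<le> \<phi> c" using c by simp
  moreover have "continuous_on {1..c} \<phi>"
    by (rule continuous_on_subset[OF lipschitz_on_continuous_on[OF phi_lipschitz]]) auto
  ultimately obtain x where "x \<ge> 1" "\<phi> x = y" using IVT'[of \<phi> 1 y c] y c by auto
  then have in_img: "y \<in> \<phi> ` {0..}" by (auto intro!: image_eqI[of _ _ x])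
  then show eq: "\<phi> (inv_into {0..} \<phi> y) = y" by (rule f_inv_into_f)
  have "inv_into {0..} \<phi> y \<in> {0..}" using in_img by (rule inv_into_into)
  moreover have "\<phi> 0 = 0" by (simp add: phi_eq0)
  then have "inv_into {0..} \<phi> y \<noteq> 0" using eq y p1 by auto
  ultimately show "inv_into {0..} \<phi> y > 0" by simp
qed

lemma moderate_phi: "moderate \<phi>"
proof
  fix c x :: real assume cx: "c \<ge> 1" "x > 0"
  then show "\<phi> x \<le> \<phi> (c * x)" by (intro phi_mono) (auto simp: mult_le_cancel_right1)
  show "\<phi> (c * x) \<le> c * \<phi> x" using cx by (intro phi_mult_le) auto
qed (rule phi_pos)

text \<open>The two properties swap roles: at most linear growth of \<open>\<phi>\<close> makes
  \<open>s / \<phi> s\<close> nondecreasing, and monotonicity of \<open>\<phi>\<close> makes its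
  growth at most linear.\<close>

lemma moderate_conjugate: "moderate (conjugate_bernstein \<phi>)"
proof
  fix x :: real assume "x > 0"
  then show "conjugate_bernstein \<phi> x > 0" using phi_pos by (simp add: conjugate_bernstein_def)
next
  fix c x :: real assume cx: "c \<ge> 1" "x > 0"
  interpret moderate \<phi> by (rule moderate_phi)
  have p: "\<phi> x > 0" "\<phi> (c * x) > 0" using cx by (auto intro!: phi_pos)
  have "x * \<phi> (c * x) \<le> x * (c * \<phi> x)" using mult_le[OF cx] cx by (intro mult_left_mono) auto
  then show "conjugate_bernstein \<phi> x \<le> conjugate_bernstein \<phi> (c * x)"
    using p by (simp add: conjugate_bernstein_def field_simps)
  have "c * x / \<phi> (c * x) \<le> c * x / \<phi> x" using le_mult[OF cx] cx p by (intro divide_left_mono) auto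
  then show "conjugate_bernstein \<phi> (c * x) \<le> c * conjugate_bernstein \<phi> x"
    by (simp add: conjugate_bernstein_def)
qed

end

section \<open>The profile: doubling, dyadic sums and blow-up\<close>

locale profile = scaled_levy_density \<phi> \<nu> + nonlinearity f m M
  for \<phi> \<nu> f :: "real \<Rightarrow> real" and m M :: real
begin

definition U :: "real \<Rightarrow> real" where "U t = H (\<phi> (1 / t\<^sup>2))"

lemma phi_t_pos: "t > 0 \<Longrightarrow> \<phi> (1 / t\<^sup>2) > 0"
  by (intro phi_pos) simp

lemma U_pos: "t > 0 \<Longrightarrow> U t > 0"
  unfolding U_def by (intro H_pos phi_t_pos)

lemma h_U: "t > 0 \<Longrightarrow> h (U t) = \<phi> (1 / t\<^sup>2)"
  unfolding U_def by (intro h_H phi_t_pos)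

lemma U_anti:
  assumes "0 < s" "s \<le> t"
  shows "U t \<le> U s"
proof -
  have "s\<^sup>2 \<le> t\<^sup>2" using assms by (intro power_mono) auto
  then have "1 / t\<^sup>2 \<le> 1 / s\<^sup>2" using assms by (intro divide_left_mono) auto
  then show ?thesis unfolding U_def by (intro monoD[OF H_mono] phi_mono) auto
qed

lemma U_meas: "U \<in> borel_measurable borel"
proof -
  have "(\<lambda>t. \<phi> (1 / t\<^sup>2)) = (\<lambda>t. \<integral>s. (1 - exp (- (1 / t\<^sup>2) * s)) * nu0 s \<partial>lborel)"
    by (intro ext phi_eq0) simp
  also have "\<dots> \<in> borel_measurable borel" by measurable
  finally have [measurable]: "(\<lambda>t. \<phi> (1 / t\<^sup>2)) \<in> borel_measurable borel" .
  have [measurable]: "H \<in> borel_measurable borel" by (rule borel_measurable_mono[OF H_mono])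
  show ?thesis unfolding U_def[abs_def] by measurable
qed

text \<open>Halving \<open>t\<close> multiplies the argument of \<open>\<phi>\<close> by 4, hence
  \<open>\<phi>\<close> by at most 4 and \<open>H\<close> by at most
  \<open>4 powr (1 / m)\<close>.\<close>

lemma U_half:
  assumes t: "t > 0"
  shows "U (t / 2) \<le> 4 powr (1 / m) * U t"
proof -
  have "\<phi> (1 / (t / 2)\<^sup>2) \<le> 4 * \<phi> (1 / t\<^sup>2)"
    using phi_mult_le[of "1 / t\<^sup>2" 4] by (simp add: power_divide)
  then have "U (t / 2) \<le> H (4 * \<phi> (1 / t\<^sup>2))" unfolding U_def by (rule monoD[OF H_mono])
  also have "\<dots> \<le> 4 powr (1 / m) * U t" unfolding U_def by (intro H_mult_le phi_t_pos t) simp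
  finally show ?thesis .
qed

lemma U_large:
  obtains t0 where "t0 > 0" "\<And>t. 0 < t \<Longrightarrow> t \<le> t0 \<Longrightarrow> Z \<le> U t"
proof -
  define z where "z = max 1 Z"
  have z: "z > 0" by (simp add: z_def)
  define y where "y = max (\<phi> 1) (h z)"
  define x where "x = inv_into {0..} \<phi> y"
  have x: "x > 0" "\<phi> x = y" unfolding x_def by (rule inv_phi; simp add: y_def)+
  show ?thesis
  proof (rule that[of "1 / sqrt x"])
    fix t assume t: "0 < t" "t \<le> 1 / sqrt x"
    then have "t\<^sup>2 \<le> (1 / sqrt x)\<^sup>2" by (intro power_mono) auto
    then have "x \<le> 1 / t\<^sup>2" using t x by (simp add: power_divide field_simps)
    then have "h z \<le> h (U t)" using x phi_mono[of x "1 / t\<^sup>2"] h_U[OF t(1)] by (simp add: y_def)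
    then have "z \<le> U t" using z U_pos[OF t(1)] by (simp add: h_le_iff)
    then show "Z \<le> U t" by (simp add: z_def)
  qed (use x in simp)
qed

text \<open>With \<open>T\<close> the integrand of the Keller--Osserman condition, \<open>T\<close> is comparable to the inverse
  of \<open>U\<close>, so the dyadic sum is a lower Riemann sum for the integral of \<open>T\<close> over \<open>[U(r), \<infinity>)\<close>.\<close>

lemma dyadic_sum_le:
  assumes R: "R > 0" and C\<^sub>1: "C\<^sub>1 > 0"
    and KO: "\<And>r. r \<ge> R \<Longrightarrow>
      set_integrable lborel {r..} (\<lambda>t. 1 / sqrt (inv_into {0..} \<phi> (1 / (varphi f t)\<^sup>2))) \<and>
      (LBINT t:{r..}. 1 / sqrt (inv_into {0..} \<phi> (1 / (varphi f t)\<^sup>2)))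
        \<le> C\<^sub>1 * (r / sqrt (inv_into {0..} \<phi> (1 / (varphi f r)\<^sup>2)))"
  obtains r0 Cs where "r0 > 0"
    "\<And>r n. 0 < r \<Longrightarrow> r \<le> r0 \<Longrightarrow> (\<Sum>k<n. (U (r / 2 ^ Suc k) - U (r / 2 ^ k)) / 2 ^ k) \<le> Cs * U r"
proof -
  obtain K k where K: "K > 0" "k > 0"
    and vlo: "\<And>t. t > 0 \<Longrightarrow> k * h t \<le> 1 / (varphi f t)\<^sup>2"
    and vup: "\<And>t. t > 0 \<Longrightarrow> 1 / (varphi f t)\<^sup>2 \<le> K * h t"
    using inverse_varphi_sq_bounds by blast
  \<comment> \<open>The factors 2 in \<open>2 / k\<close> here and in \<open>2 * K\<close> below
    make the comparisons of values of \<open>\<phi>\<close> strict, so that monotonicity can be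
    inverted by contraposition.\<close>
  obtain c where c: "c \<ge> 1" and sc: "\<And>x. x \<ge> 1 \<Longrightarrow> max 1 (2 / k) * \<phi> x \<le> \<phi> (c * x)"
    using lower_scaling[of "max 1 (2 / k)"] by auto
  obtain c' where c': "c' \<ge> 1" and sc': "\<And>x. x \<ge> 1 \<Longrightarrow> max 1 (2 * K) * \<phi> x \<le> \<phi> (c' * x)"
    using lower_scaling[of "max 1 (2 * K)"] by auto
  obtain t0 where t0: "t0 > 0" "\<And>t. 0 < t \<Longrightarrow> t \<le> t0 \<Longrightarrow> R \<le> U t" using U_large[of R] by blast
  \<comment> \<open>Below \<open>t0\<close> the profile is in the range where (2) holds; below
    \<open>1 / sqrt c\<close> the argument \<open>1 / (c * t\<^sup>2)\<close> is at least 1, where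
    scaling holds.\<close>
  define r0 where "r0 = min t0 (1 / sqrt c)"
  have r0: "r0 > 0" using t0 c by (simp add: r0_def)
  define y where "y s = 1 / (varphi f s)\<^sup>2" for s
  define T where "T s = 1 / sqrt (inv_into {0..} \<phi> (y s))" for s
  have small: "1 \<le> 1 / (c * t\<^sup>2)" "R \<le> U t" "1 \<le> 1 / t\<^sup>2" if t: "0 < t" "t \<le> r0" for t
  proof -
    show "R \<le> U t" using t t0 by (simp add: r0_def)
    have "t\<^sup>2 \<le> (1 / sqrt c)\<^sup>2" using t by (intro power_mono) (auto simp: r0_def)
    then have "c * t\<^sup>2 \<le> 1" using c by (simp add: power_divide field_simps)
    moreover have "1 * t\<^sup>2 \<le> c * t\<^sup>2" using c by (intro mult_right_mono) auto
    moreover have "0 < c * t\<^sup>2" using c t by simp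
    ultimately have "c * t\<^sup>2 \<le> 1" "t\<^sup>2 \<le> 1" "0 < c * t\<^sup>2" by linarith+
    then show "1 \<le> 1 / (c * t\<^sup>2)" "1 \<le> 1 / t\<^sup>2" using t by simp_all
  qed
  have y_gt: "\<phi> (1 / (c * t\<^sup>2)) < y (U t)" "\<phi> 1 \<le> y (U t)" if t: "0 < t" "t \<le> r0" for t
  proof -
    define x where "x = 1 / (c * t\<^sup>2)"
    have x: "x \<ge> 1" using small[OF t] by (simp add: x_def)
    have p: "\<phi> x > 0" using x by (intro phi_pos) simp
    have cx: "c * x = 1 / t\<^sup>2" using c by (simp add: x_def)
    have "2 / k * \<phi> x \<le> max 1 (2 / k) * \<phi> x" using p by (intro mult_right_mono) auto
    also have "\<dots> \<le> h (U t)" using sc[OF x] unfolding cx h_U[OF t(1)] .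
    finally have "2 * \<phi> x \<le> k * h (U t)" using K by (simp add: field_simps)
    also have "\<dots> \<le> y (U t)" unfolding y_def by (rule vlo[OF U_pos[OF t(1)]])
    finally show "\<phi> (1 / (c * t\<^sup>2)) < y (U t)" using p by (simp add: x_def)
    then show "\<phi> 1 \<le> y (U t)" using phi_mono[of 1 x] x by (simp add: x_def)
  qed
  have T_le: "T (U t) \<le> sqrt c * t" if t: "0 < t" "t \<le> r0" for t
  proof -
    define w where "w = inv_into {0..} \<phi> (y (U t))"
    have w: "w > 0" "\<phi> w = y (U t)" unfolding w_def by (rule inv_phi[OF y_gt(2)[OF t]])+
    have "\<not> w \<le> 1 / (c * t\<^sup>2)" using phi_mono[of w "1 / (c * t\<^sup>2)"] w y_gt(1)[OF t] by auto
    then have "sqrt (1 / (c * t\<^sup>2)) \<le> sqrt w" by simp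
    then have "1 / sqrt w \<le> 1 / sqrt (1 / (c * t\<^sup>2))"
      using c t w by (intro divide_left_mono mult_pos_pos) auto
    also have "\<dots> = sqrt c * t" using t by (simp add: real_sqrt_divide real_sqrt_mult)
    finally show ?thesis by (simp add: T_def w_def)
  qed
  have T_ge: "t / sqrt c' \<le> T s" if t: "0 < t" "t \<le> r" and r: "r \<le> r0" and s: "U r \<le> s" "s \<le> U t" for t r s
  proof -
    have r': "0 < r" using t by simp
    have s0: "s > 0" using s U_pos[OF r'] by simp
    define x where "x = 1 / t\<^sup>2"
    have x: "x \<ge> 1" using small(3)[of t] t r by (simp add: x_def)
    have p: "\<phi> x > 0" using x by (intro phi_pos) simp
    have "y s \<le> K * h s" unfolding y_def by (rule vup[OF s0])
    also have "\<dots> \<le> K * h (U t)" using K s s0 by (intro mult_left_mono) (auto simp: h_le_iff U_pos t)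
    also have "\<dots> < 2 * K * \<phi> x" using p K h_U[OF t(1)] by (simp add: x_def)
    also have "\<dots> \<le> max 1 (2 * K) * \<phi> x" using p by (intro mult_right_mono) auto
    also have "\<dots> \<le> \<phi> (c' * x)" by (rule sc'[OF x])
    finally have up: "y s < \<phi> (c' * x)" .
    have "c * (1 / (c * r\<^sup>2)) = 1 / r\<^sup>2" using c by simp
    then have "max 1 (2 / k) * \<phi> (1 / (c * r\<^sup>2)) \<le> h (U r)"
      using sc[OF small(1)[OF r' r]] h_U[OF r'] by simp
    moreover have "2 / k * \<phi> 1 \<le> max 1 (2 / k) * \<phi> (1 / (c * r\<^sup>2))"
      using small(1)[OF r' r] K phi_nonneg[of 1] by (intro mult_mono phi_mono) auto
    moreover have "h (U r) \<le> h s" using s s0 by (simp add: h_le_iff U_pos r')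
    ultimately have "2 / k * \<phi> 1 \<le> h s" by linarith
    then have "2 * \<phi> 1 \<le> k * h s" using K by (simp add: field_simps)
    also have "\<dots> \<le> y s" unfolding y_def by (rule vlo[OF s0])
    finally have lo: "\<phi> 1 \<le> y s" using phi_nonneg[of 1] by simp
    define w where "w = inv_into {0..} \<phi> (y s)"
    have w: "w > 0" "\<phi> w = y s" unfolding w_def by (rule inv_phi[OF lo])+
    have "\<not> c' * x \<le> w" using phi_mono[of "c' * x" w] w up c' x by auto
    then have "sqrt w \<le> sqrt (c' * x)" by simp
    then have "1 / sqrt (c' * x) \<le> 1 / sqrt w" using w c' x by (intro divide_left_mono mult_pos_pos) auto
    moreover have "1 / sqrt (c' * x) = t / sqrt c'" using t by (simp add: x_def real_sqrt_mult real_sqrt_divide)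
    ultimately show ?thesis by (simp add: T_def w_def)
  qed
  show ?thesis
  proof (rule that[OF r0, of "2 * sqrt c' * (C\<^sub>1 * sqrt c)"])
    fix r n assume r: "(0::real) < r" "r \<le> r0"
    define a where "a k = U (r / 2 ^ k)" for k :: nat
    have a_mono: "a i \<le> a j" if "i \<le> j" for i j
    proof -
      have "(2::real) ^ i \<le> 2 ^ j" using that by (intro power_increasing) auto
      then show ?thesis unfolding a_def using r by (intro U_anti divide_left_mono) auto
    qed
    have a0: "a 0 = U r" by (simp add: a_def)
    have aR: "R \<le> a k" for k using small(2)[OF r] a_mono[of 0 k] a0 by simp
    have int: "set_integrable lborel {a k..} T" for k
      using KO[OF aR[of k]] by (simp add: T_def[abs_def] y_def)
    \<comment> \<open>Between consecutive profile values \<open>T\<close> is bounded below by its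
      bound at the right end; the remaining tail of the integral is carried through the
      induction.\<close>
    have part: "(\<Sum>k<n. (a (Suc k) - a k) * (r / 2 ^ Suc k / sqrt c')) + (LBINT s:{a n..}. T s) \<le> (LBINT s:{a 0..}. T s)" for n
    proof (induction n)
      case (Suc n)
      have le: "a n \<le> a (Suc n)" by (rule a_mono) simp
      have sub: "set_integrable lborel {a n..<a (Suc n)} T" by (rule set_integrable_subset[OF int[of n]]) auto
      have "{a n..} = {a n..<a (Suc n)} \<union> {a (Suc n)..}" using le by auto
      then have "(LBINT s:{a n..}. T s) = (LBINT s:{a n..<a (Suc n)}. T s) + (LBINT s:{a (Suc n)..}. T s)"
        using sub int[of "Suc n"] by (simp only:) (rule set_integral_Un, auto)
      moreover have "(a (Suc n) - a n) * (r / 2 ^ Suc n / sqrt c') \<le> (LBINT s:{a n..<a (Suc n)}. T s)"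
      proof -
        have "(a (Suc n) - a n) * (r / 2 ^ Suc n / sqrt c') = (LBINT s:{a n..<a (Suc n)}. r / 2 ^ Suc n / sqrt c')"
          using le by (simp add: set_lebesgue_integral_def)
        also have "\<dots> \<le> (LBINT s:{a n..<a (Suc n)}. T s)"
        proof (rule set_integral_mono[OF _ sub])
          show "set_integrable lborel {a n..<a (Suc n)} (\<lambda>s. r / 2 ^ Suc n / sqrt c')"
            unfolding set_integrable_def using le by (intro integrable_scaleR_left integrable_real_indicator) auto
          fix s assume "s \<in> {a n..<a (Suc n)}"
          then have s: "U r \<le> s" "s \<le> U (r / 2 ^ Suc n)" using a_mono[of 0 n] a0 by (auto simp: a_def)
          have "r / 2 ^ Suc n \<le> r / 1" using r by (intro divide_left_mono one_le_power) auto
          then show "r / 2 ^ Suc n / sqrt c' \<le> T s" using r s by (intro T_ge[of _ r]) auto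
        qed
        finally show ?thesis .
      qed
      ultimately show ?case using Suc by simp
    qed simp
    \<comment> \<open>The sign of \<open>T\<close> is not automatic, as \<open>sqrt\<close> is
      negative on negative numbers. It follows from the lower bound for \<open>T\<close> at a radius
      so small that its profile value exceeds \<open>s\<close>.\<close>
    have T0: "0 \<le> T s" if "s \<ge> a n" for s
    proof -
      obtain t1 where t1: "t1 > 0" "\<And>t. 0 < t \<Longrightarrow> t \<le> t1 \<Longrightarrow> s \<le> U t" using U_large[of s] by blast
      have "U r \<le> s" using that a_mono[of 0 n] a0 by simp
      then have "min t1 r / sqrt c' \<le> T s" using t1 r by (intro T_ge[of _ r]) auto
      moreover have "0 \<le> min t1 r / sqrt c'" using t1 r c' by simp
      ultimately show ?thesis by linarith
    qed
    have "(\<Sum>k<n. (a (Suc k) - a k) * (r / 2 ^ Suc k / sqrt c')) \<le> (LBINT s:{a 0..}. T s)"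
    proof -
      have "0 \<le> (LBINT s:{a n..}. T s)" unfolding set_lebesgue_integral_def
        using T0 by (intro integral_nonneg_AE AE_I2) (auto simp: indicator_def)
      then show ?thesis using part[of n] by linarith
    qed
    also have "\<dots> \<le> C\<^sub>1 * (a 0 * T (a 0))"
      using KO[OF aR[of 0]] by (simp add: T_def y_def)
    also have "\<dots> \<le> C\<^sub>1 * (a 0 * (sqrt c * r))"
      using C\<^sub>1 T_le[OF r] U_pos[OF r(1)] by (intro mult_left_mono) (auto simp: a0)
    also have "(\<Sum>k<n. (a (Suc k) - a k) * (r / 2 ^ Suc k / sqrt c')) = (\<Sum>k<n. (a (Suc k) - a k) / 2 ^ k) * (r / (2 * sqrt c'))"
      unfolding sum_distrib_right by (intro sum.cong) (auto simp: mult_ac)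
    finally have "(\<Sum>k<n. (a (Suc k) - a k) / 2 ^ k) * (r / (2 * sqrt c')) \<le> C\<^sub>1 * (a 0 * (sqrt c * r))" .
    then have "(\<Sum>k<n. (a (Suc k) - a k) / 2 ^ k) \<le> C\<^sub>1 * (a 0 * (sqrt c * r)) / (r / (2 * sqrt c'))"
      using r c' by (subst pos_le_divide_eq) auto
    also have "\<dots> = 2 * sqrt c' * (C\<^sub>1 * sqrt c) * U r" using r by (simp add: a0)
    finally show "(\<Sum>k<n. (U (r / 2 ^ Suc k) - U (r / 2 ^ k)) / 2 ^ k) \<le> 2 * sqrt c' * (C\<^sub>1 * sqrt c) * U r"
      by (simp add: a_def)
  qed
qed

text \<open>At \<open>s = U t\<close> the equation of the profile gives
  \<open>s / f s = 1 / \<phi> (1 / t\<^sup>2)\<close>. By the lower bound for \<open>V\<close>, its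
  inverse at the square root of this is at most \<open>E * t\<close>, while
  \<open>sqrt (s * f s) = U t * sqrt (\<phi> (1 / t\<^sup>2))\<close>. The lower bound for
  \<open>Vs\<close> dominates the product by a multiple of \<open>Vs t * U t\<close>.\<close>

lemma boundary_blow_up:
  assumes V: "renewal_function \<phi> V" "continuous_on {0..} V" "strict_mono_on {0..} V" "V 0 = 0"
    and Vs: "renewal_function (conjugate_bernstein \<phi>) Vs"
    and lim: "filterlim (\<lambda>s. inv_into {0..} V (sqrt (s / f s)) * sqrt (s * f s)) at_top at_top"
  obtains t0 where "t0 > 0" "\<And>t. 0 < t \<Longrightarrow> t \<le> t0 \<Longrightarrow> Z \<le> Vs t * U t"
proof -
  obtain A c where A: "A > 0" "c > 0" and V_ge: "\<And>t. t > 0 \<Longrightarrow> c / sqrt (\<phi> (1 / t\<^sup>2)) \<le> V (A * t)"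
    using moderate.renewal_lower_bound[OF moderate_phi] V(1) by metis
  obtain A' c' where A': "A' > 0" "c' > 0"
    and Vs_ge: "\<And>t. t > 0 \<Longrightarrow> c' / sqrt (conjugate_bernstein \<phi> (1 / t\<^sup>2)) \<le> Vs (A' * t)"
    using moderate.renewal_lower_bound[OF moderate_conjugate] Vs by metis
  \<comment> \<open>The renewal bound holds at the dilated point \<open>A' * t\<close>; applying it
    at \<open>\<tau> = t / a\<close> and using monotonicity of \<open>Vs\<close> and
    \<open>\<phi>\<close> removes the dilation.\<close>
  define a where "a = max 1 A'"
  have a: "a \<ge> 1" "A' \<le> a" by (auto simp: a_def)
  have Vs_mono: "Vs s \<le> Vs t" if "s \<le> t" for s t
    using Vs that by (auto simp: renewal_function_def mono_def)
  have Vs_lower: "c' / a * (t * sqrt (\<phi> (1 / t\<^sup>2))) \<le> Vs t" if t: "t > 0" for t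
  proof -
    define \<tau> where "\<tau> = t / a"
    have \<tau>: "\<tau> > 0" "\<tau> \<le> t" using t a by (auto simp: \<tau>_def divide_le_eq)
    have "\<tau>\<^sup>2 \<le> t\<^sup>2" using \<tau> by (intro power_mono) auto
    then have le: "\<phi> (1 / t\<^sup>2) \<le> \<phi> (1 / \<tau>\<^sup>2)" using \<tau> t by (intro phi_mono divide_left_mono) auto
    have "c' / a * (t * sqrt (\<phi> (1 / t\<^sup>2))) = c' * (\<tau> * sqrt (\<phi> (1 / t\<^sup>2)))" by (simp add: \<tau>_def)
    also have "\<dots> \<le> c' * (\<tau> * sqrt (\<phi> (1 / \<tau>\<^sup>2)))"
      using le A' \<tau> by (intro mult_left_mono) auto
    also have "\<dots> = c' / sqrt (conjugate_bernstein \<phi> (1 / \<tau>\<^sup>2))"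
      using \<tau> by (simp add: conjugate_bernstein_def real_sqrt_divide real_sqrt_mult)
    also have "\<dots> \<le> Vs (A' * \<tau>)" by (rule Vs_ge[OF \<tau>(1)])
    also have "\<dots> \<le> Vs t"
    proof (rule Vs_mono)
      have "A' * \<tau> \<le> a * \<tau>" using a \<tau> by (intro mult_right_mono) auto
      then show "A' * \<tau> \<le> t" using a by (simp add: \<tau>_def)
    qed
    finally show ?thesis .
  qed
  \<comment> \<open>The constant \<open>c\<close> of the bound for \<open>V\<close> is moved into
    the argument of \<open>\<phi>\<close>; hence the factor \<open>sqrt b\<close> in
    \<open>E\<close> and the restriction \<open>t \<le> 1 / sqrt b\<close>.\<close>
  obtain b where b: "b \<ge> 1" and sc: "\<And>x. x \<ge> 1 \<Longrightarrow> max 1 (1 / c\<^sup>2) * \<phi> x \<le> \<phi> (b * x)"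
    using lower_scaling[of "max 1 (1 / c\<^sup>2)"] by auto
  define E where "E = A * sqrt b"
  have E: "E > 0" using A b by (simp add: E_def)
  have inv_V: "inv_into {0..} V (1 / sqrt (\<phi> (1 / t\<^sup>2))) \<le> E * t" if t: "0 < t" "t \<le> 1 / sqrt b" for t
  proof -
    define y where "y = 1 / sqrt (\<phi> (1 / t\<^sup>2))"
    have p: "\<phi> (1 / t\<^sup>2) > 0" using phi_t_pos t by simp
    have "t\<^sup>2 \<le> (1 / sqrt b)\<^sup>2" using t by (intro power_mono) auto
    then have bt: "1 \<le> 1 / (b * t\<^sup>2)" using b t by (simp add: power_divide field_simps)
    have pb: "\<phi> (1 / (b * t\<^sup>2)) > 0" using b t by (intro phi_pos) simp
    have "1 / c\<^sup>2 * \<phi> (1 / (b * t\<^sup>2)) \<le> max 1 (1 / c\<^sup>2) * \<phi> (1 / (b * t\<^sup>2))"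
      using pb by (intro mult_right_mono) auto
    also have "\<dots> \<le> \<phi> (1 / t\<^sup>2)" using sc[OF bt] b by simp
    finally have "\<phi> (1 / (b * t\<^sup>2)) \<le> c\<^sup>2 * \<phi> (1 / t\<^sup>2)" using A by (simp add: field_simps)
    then have "sqrt (\<phi> (1 / (b * t\<^sup>2))) \<le> sqrt (c\<^sup>2 * \<phi> (1 / t\<^sup>2))" by (rule real_sqrt_le_mono)
    then have "sqrt (\<phi> (1 / (b * t\<^sup>2))) \<le> c * sqrt (\<phi> (1 / t\<^sup>2))" using A by (simp add: real_sqrt_mult)
    then have "y \<le> c / sqrt (\<phi> (1 / (b * t\<^sup>2)))" using p pb unfolding y_def by (simp add: field_simps)
    also have "\<dots> = c / sqrt (\<phi> (1 / (sqrt b * t)\<^sup>2))" using b by (simp add: power_mult_distrib)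
    also have "\<dots> \<le> V (A * (sqrt b * t))" using b t by (intro V_ge) simp
    finally have y_le: "y \<le> V (E * t)" by (simp add: E_def mult.assoc)
    have Et: "0 \<le> E * t" using E t by simp
    have "continuous_on {0..E * t} V" by (rule continuous_on_subset[OF V(2)]) auto
    then obtain v where "0 \<le> v" "V v = y" using IVT'[of V 0 y "E * t"] y_le Et V(4) p by (auto simp: y_def)
    then have img: "y \<in> V ` {0..}" by (auto intro!: image_eqI[of _ _ v])
    have "V (inv_into {0..} V y) = y" "inv_into {0..} V y \<in> {0..}"
      using f_inv_into_f[OF img] inv_into_into[OF img] by simp_all
    then have "\<not> E * t < inv_into {0..} V y"
      using strict_mono_onD[OF V(3), of "E * t" "inv_into {0..} V y"] y_le Et by auto
    then show ?thesis by (simp add: y_def)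
  qed
  define Q where "Q = c' / a / E"
  have Q: "Q > 0" using A' a E by (simp add: Q_def)
  obtain S where S: "\<And>s. s \<ge> S \<Longrightarrow> Z / Q \<le> inv_into {0..} V (sqrt (s / f s)) * sqrt (s * f s)"
    using lim unfolding filterlim_at_top eventually_at_top_linorder by blast
  obtain t0 where t0: "t0 > 0" "\<And>t. 0 < t \<Longrightarrow> t \<le> t0 \<Longrightarrow> S \<le> U t" using U_large[of S] by blast
  show ?thesis
  proof (rule that[of "min t0 (1 / sqrt b)"])
    show "0 < min t0 (1 / sqrt b)" using t0 b by simp
    fix t assume t: "0 < t" "t \<le> min t0 (1 / sqrt b)"
    define s where "s = U t"
    have s: "s > 0" unfolding s_def by (rule U_pos[OF t(1)])
    have f: "f s = s * \<phi> (1 / t\<^sup>2)" using h_U[OF t(1)] s by (simp add: h_def s_def field_simps)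
    have p: "\<phi> (1 / t\<^sup>2) > 0" by (rule phi_t_pos[OF t(1)])
    have e1: "sqrt (s / f s) = 1 / sqrt (\<phi> (1 / t\<^sup>2))" using s by (simp add: f real_sqrt_divide)
    have e2: "sqrt (s * f s) = s * sqrt (\<phi> (1 / t\<^sup>2))" using s by (simp add: f real_sqrt_mult)
    have "Z / Q \<le> inv_into {0..} V (sqrt (s / f s)) * sqrt (s * f s)" using t t0 by (intro S) (simp add: s_def)
    also have "\<dots> \<le> (E * t) * (s * sqrt (\<phi> (1 / t\<^sup>2)))"
      unfolding e1 e2 using inv_V[of t] t s p by (intro mult_right_mono) auto
    finally have "Z \<le> Q * ((E * t) * (s * sqrt (\<phi> (1 / t\<^sup>2))))" using Q by (simp add: pos_divide_le_eq mult.commute)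
    also have "\<dots> = c' / a * (t * sqrt (\<phi> (1 / t\<^sup>2))) * s" using E by (simp add: Q_def)
    also have "\<dots> \<le> Vs t * s" using Vs_lower[OF t(1)] s by (intro mult_right_mono) auto
    finally show "Z \<le> Vs t * U t" by (simp add: s_def)
  qed
qed

end

section \<open>Assembling the supersolution\<close>

lemma locally_C11_on_cmult:
  assumes "locally_C11_on \<Omega> u"
  shows "locally_C11_on \<Omega> (\<lambda>x. A * u x)"
proof -
  obtain G where G: "\<And>x. x \<in> \<Omega> \<Longrightarrow> GDERIV u x :> G x"
    and lip: "\<And>K. compact K \<Longrightarrow> K \<subseteq> \<Omega> \<Longrightarrow> \<exists>C. C-lipschitz_on K G"
    using assms unfolding locally_C11_on_def by blast
  have "GDERIV (\<lambda>x. A * u x) x :> A *\<^sub>R G x" if "x \<in> \<Omega>" for x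
    using has_derivative_mult_right[OF G[OF that, unfolded gderiv_def], of A] by (simp add: gderiv_def)
  moreover have "\<exists>C. C-lipschitz_on K (\<lambda>x. A *\<^sub>R G x)" if K: "compact K" "K \<subseteq> \<Omega>" for K
  proof -
    obtain C where C: "C-lipschitz_on K G" using lip[OF K] by blast
    have "(\<bar>A\<bar> * C)-lipschitz_on K (\<lambda>x. A *\<^sub>R G x)"
    proof (rule lipschitz_onI)
      fix x y assume "x \<in> K" "y \<in> K"
      then have "\<bar>A\<bar> * dist (G x) (G y) \<le> \<bar>A\<bar> * (C * dist x y)"
        by (intro mult_left_mono lipschitz_onD[OF C]) auto
      then show "dist (A *\<^sub>R G x) (A *\<^sub>R G y) \<le> \<bar>A\<bar> * C * dist x y"
        by (simp add: dist_norm mult.assoc flip: scaleR_diff_right)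
    qed (use lipschitz_on_nonneg[OF C] in simp)
    then show ?thesis ..
  qed
  ultimately show ?thesis
    unfolding locally_C11_on_def by (intro exI[of _ "\<lambda>x. A *\<^sub>R G x"] conjI ballI allI impI) auto
qed

theorem lemma3p5:
  fixes \<Omega> :: "'a::euclidean_space set"
    and \<phi> \<nu> V Vs f :: "real \<Rightarrow> real"
    and m M R C\<^sub>1 :: real
  assumes dim: "DIM('a) \<ge> 2"
    and Omega: "bounded \<Omega>" "C11_open_set \<Omega>"
    and phi: "complete_bernstein \<phi> \<nu>" "scaling_condition \<phi>"
    and V: "renewal_function \<phi> V" "continuous_on {0..} V" "strict_mono_on {0..} V"
      "V 0 = 0" "filterlim V at_top at_top"
    and Vs: "renewal_function (conjugate_bernstein \<phi>) Vs"
    and f: "\<And>t. 0 \<le> f t" "mono f" "f C1_differentiable_on UNIV" "f 0 = 0"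
    and F_pos: "\<And>t. t > 0 \<Longrightarrow> F_prim f t > 0"
    and m_M: "0 < m" "m \<le> M"
    and cond1: "\<And>t. (1 + m) * f t \<le> t * deriv f t \<and> t * deriv f t \<le> (1 + M) * f t"
    and R_C: "R > 0" "C\<^sub>1 > 0"
    and cond2: "\<And>r. r \<ge> R \<Longrightarrow>
      set_integrable lborel {r..} (\<lambda>t. 1 / sqrt (inv_into {0..} \<phi> (1 / (varphi f t)\<^sup>2))) \<and>
      (LBINT t:{r..}. 1 / sqrt (inv_into {0..} \<phi> (1 / (varphi f t)\<^sup>2)))
        \<le> C\<^sub>1 * (r / sqrt (inv_into {0..} \<phi> (1 / (varphi f r)\<^sup>2)))"
    and cond3: "filterlim (\<lambda>s. inv_into {0..} V (sqrt (s / f s)) * sqrt (s * f s)) at_top at_top"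
  shows "\<exists>u. supersolution \<nu> f Vs \<Omega> u \<and> locally_C11_on \<Omega> u"
proof (cases "\<Omega> = {}")
  case True
  \<comment> \<open>The empty set has no frontier, and the boundary limit is then taken along the
    trivial filter.\<close>
  then have "supersolution \<nu> f Vs \<Omega> (\<lambda>_. 0)"
    by (simp add: supersolution_def filterlim_def)
  moreover have "locally_C11_on \<Omega> (\<lambda>_. 0)"
    using True by (auto simp: locally_C11_on_def intro!: exI[of _ "\<lambda>_. 0"] exI[of _ 0])
  ultimately show ?thesis by blast
next
  case False
  interpret levy_density \<phi> \<nu> by (rule complete_bernstein_levy_density) (rule phi)
  interpret P: profile \<phi> \<nu> f m M
    by unfold_locales (use phi f F_pos m_M cond1 in auto)
  obtain Cm where Cm: "Cm > 0" "\<And>x t \<rho>. 0 < t \<Longrightarrow> t \<le> \<rho> \<Longrightarrow>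
      measure lborel {y \<in> \<Omega>. bdist \<Omega> y < t \<and> dist x y < \<rho>} \<le> Cm * t * \<rho> ^ (DIM('a) - 1)"
    using measure_boundary_layer_le[OF Omega] by blast
  obtain r0 Cs where r0: "r0 > 0" "\<And>r n. 0 < r \<Longrightarrow> r \<le> r0 \<Longrightarrow>
      (\<Sum>k<n. (P.U (r / 2 ^ Suc k) - P.U (r / 2 ^ k)) / 2 ^ k) \<le> Cs * P.U r"
    using P.dyadic_sum_le[OF R_C cond2] by blast
  have opn: "open \<Omega>" using Omega by (simp add: C11_open_set_def)
  have ne: "frontier \<Omega> \<noteq> {}"
    using False Omega by (metis frontier_eq_empty not_bounded_UNIV)
  interpret B: barrier \<phi> \<nu> P.U \<Omega> "4 powr (1 / m)" Cm r0 Cs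
    by unfold_locales (use opn ne Omega Cm r0 P.U_meas P.U_pos P.U_anti P.U_half in auto)
  obtain K where K: "\<And>x. x \<in> \<Omega> \<Longrightarrow> \<exists>l. has_L \<nu> B.u x l \<and> l \<le> K * (P.U (bdist \<Omega> x) * \<phi> (1 / (bdist \<Omega> x)\<^sup>2))"
    using B.L_u_bound by blast
  \<comment> \<open>The minimum with 1 keeps \<open>c * P.U t\<close> below \<open>P.U t\<close>, as
    the upper growth bound of \<open>f\<close> requires.\<close>
  define c where "c = min 1 (B.B / (2 * 20 ^ DIM('a) * 4 powr (1 / m)))"
  have c: "0 < c" "c \<le> 1" using B.B_pos by (auto simp: c_def)
  have u_ge: "c * P.U (bdist \<Omega> x) \<le> B.u x" if x: "x \<in> \<Omega>" for x
  proof -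
    have "c * P.U (bdist \<Omega> x) \<le> B.B / (2 * 20 ^ DIM('a) * 4 powr (1 / m)) * P.U (bdist \<Omega> x)"
      using P.U_pos[OF B.\<delta>_pos[OF x]] by (intro mult_right_mono) (auto simp: c_def)
    then show ?thesis using B.u_lower[OF x] by linarith
  qed
  define K' where "K' = max 1 (\<bar>K\<bar> * (1 / c) powr (1 + M))"
  \<comment> \<open>Chosen so that \<open>A powr m = K'\<close>: multiplying the argument by
    \<open>A\<close> raises \<open>f\<close> by at least \<open>A powr (1 + m) = A * K'\<close>,
    whereas the linear operator gains only the factor \<open>A\<close>.\<close>
  define A where "A = K' powr (1 / m)"
  have A1: "A \<ge> 1" unfolding A_def K'_def using m_M by (intro ge_one_powr_ge_zero) auto
  have Am: "A powr (1 + m) = A * K'"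
    using A1 m_M by (simp add: powr_add A_def powr_powr K'_def)
  define u where "u x = A * B.u x" for x
  have L: "\<exists>l. has_L \<nu> u x l \<and> - l \<ge> - f (u x)" if x: "x \<in> \<Omega>" for x
  proof -
    define t where "t = bdist \<Omega> x"
    have t: "t > 0" unfolding t_def by (rule B.\<delta>_pos) fact
    have U: "P.U t > 0" by (rule P.U_pos[OF t])
    have u0: "B.u x > 0" using u_ge[OF x] c U unfolding t_def by (smt (verit) mult_pos_pos)
    obtain l where l: "has_L \<nu> B.u x l" "l \<le> K * (P.U t * \<phi> (1 / t\<^sup>2))" using K[OF x] by (auto simp: t_def)
    have "P.U t * \<phi> (1 / t\<^sup>2) = f (P.U t)" using P.h_U[OF t] U by (simp add: P.h_def field_simps)
    then have "l \<le> \<bar>K\<bar> * f (P.U t)"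
      using l(2) f(1)[of "P.U t"] mult_right_mono[OF abs_ge_self[of K], of "f (P.U t)"] by simp
    also have "f (P.U t) \<le> (1 / c) powr (1 + M) * f (c * P.U t)"
      using P.growth_upper[of "c * P.U t" "P.U t"] c U by (simp add: mult_le_cancel_right2)
    also have "\<dots> \<le> (1 / c) powr (1 + M) * f (B.u x)"
      using u_ge[OF x] monoD[OF f(2)] by (intro mult_left_mono) (auto simp: t_def)
    finally have "l \<le> \<bar>K\<bar> * (1 / c) powr (1 + M) * f (B.u x)" by (simp add: mult_left_mono mult.assoc)
    also have "\<dots> \<le> K' * f (B.u x)" using f(1) by (intro mult_right_mono) (auto simp: K'_def)
    finally have "A * l \<le> A * (K' * f (B.u x))" using A1 by (intro mult_left_mono) auto
    also have "\<dots> = A powr (1 + m) * f (B.u x)" by (simp add: Am)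
    also have "\<dots> \<le> f (u x)" unfolding u_def
      using P.growth_lower[of "B.u x" "A * B.u x"] u0 A1 by (simp add: mult_le_cancel_right1)
    finally show ?thesis using has_L_cmult[OF l(1), of A] by (auto simp: u_def[abs_def])
  qed
  have blow: "filterlim (\<lambda>x. Vs (bdist \<Omega> x) * u x) at_top
      (inf (filtercomap (bdist \<Omega>) (at_right 0)) (principal \<Omega>))"
    unfolding filterlim_at_top
  proof
    fix Z :: real
    obtain t0 where t0: "t0 > 0" "\<And>t. 0 < t \<Longrightarrow> t \<le> t0 \<Longrightarrow> Z / (A * c) \<le> Vs t * P.U t"
      using P.boundary_blow_up[OF V(1-4) Vs cond3] by blast
    have Vs0: "0 \<le> Vs t" if "t > 0" for t
    proof -
      have "mono Vs" "Vs (- 1) = 0" using Vs by (auto simp: renewal_function_def)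
      then show ?thesis using monoD[of Vs "- 1" t] that by simp
    qed
    have key: "Z \<le> Vs (bdist \<Omega> x) * u x" if x: "x \<in> \<Omega>" "0 < bdist \<Omega> x" "bdist \<Omega> x < t0" for x
    proof -
      have "Z / (A * c) \<le> Vs (bdist \<Omega> x) * P.U (bdist \<Omega> x)" using x by (intro t0) auto
      then have "Z \<le> Vs (bdist \<Omega> x) * (A * (c * P.U (bdist \<Omega> x)))"
        using A1 c by (simp add: pos_divide_le_eq mult_ac)
      also have "\<dots> \<le> Vs (bdist \<Omega> x) * u x"
        unfolding u_def using u_ge[OF x(1)] A1 Vs0[OF x(2)] by (intro mult_left_mono) auto
      finally show ?thesis .
    qed
    have "eventually (\<lambda>t. 0 < t \<and> t < t0) (at_right (0::real))"
      using eventually_at_right_less[of "0::real"] eventually_at_right_real[OF t0(1)]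
      by eventually_elim auto
    then show "\<forall>\<^sub>F x in inf (filtercomap (bdist \<Omega>) (at_right 0)) (principal \<Omega>). Z \<le> Vs (bdist \<Omega> x) * u x"
      unfolding eventually_inf_principal eventually_filtercomap using key by blast
  qed
  have "supersolution \<nu> f Vs \<Omega> u"
    unfolding supersolution_def using L blow B.u_outside by (auto simp: u_def)
  moreover have "locally_C11_on \<Omega> u"
    unfolding u_def[abs_def] by (rule locally_C11_on_cmult) (rule B.u_locally_C11)
  ultimately show ?thesis by blast
qed

end
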